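(* Let $d\in\mathbb N$, let $\mathcal H$ be a separable complex Hilbert space, let $\alpha\neq0$ be real and $s>(d+1)^2$. Let $\varphi^n\in\ell^1(\mathbb Z^d,\mathcal H)$, $n\in\mathbb Z^d$, be an $(s,\alpha)$-localized $p$-frame for some $p\in\{0\}\cup[1,\infty]$. Then: (i) The $q$-analysis operator $T$ is well defined and left invertible for all $q\in\{0\}\cup[1,\infty]$, and the $q$-synthesis operator $T^\sharp=(T^*T)^{-1}T^*$ is also well defined for all $q\in\{0\}\cup[1,\infty]$. (ii) The sequence $\varphi^n$, $n\in\mathbb Z^d$, and its dual sequence $\tilde\varphi^n=(T^*T)^{-1}\varphi^n$, $n\in\mathbb Z^d$, are both $(s,\alpha)$-localized $q$-frames for all $q\in\{0\}\cup[1,\infty]$. (iii) For $f$ in $\mathfrak c_0(\mathbb Z^d,\mathcal H)$ or in $\ell^q(\mathbb Z^d,\mathcal H)$, $q\in[1,\infty)$, we have the reconstruction formula $$f=T^\sharp Tf=\sum_{n\in\mathbb Z^d}\langle f,\varphi^n\rangle\tilde\varphi^n=\sum_{n\in\mathbb Z^d}\langle f,\tilde\varphi^n\rangle\varphi^n .$$ For $f\in\ell^\infty(\mathbb Z^d,\mathcal H)$ the reconstruction formula remains valid provided the convergence is understood in the weak$^*$-topology.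
   Context: For $n\in\mathbb Z^d$, $|n|=\max_{1\le k\le d}|n_k|$. $\ell^p(\mathbb Z^d,\mathcal H)$ is the Banach space of sequences $f=(f_m)_{m\in\mathbb Z^d}$ in $\mathcal H$ with norm $\|f\|_p=(\sum_m\|f_m\|^p)^{1/p}$ ($1\le p<\infty$), $\|f\|_\infty=\sup_m\|f_m\|$; $\mathfrak c_0(\mathbb Z^d,\mathcal H)$ is the subspace of $\ell^\infty(\mathbb Z^d,\mathcal H)$ of sequences with $\lim_{|m|\to\infty}\|f_m\|=0$. $\ell^p(\mathbb Z^d)=\ell^p(\mathbb Z^d,\mathbb C)$, $\mathfrak c_0(\mathbb Z^d)=\mathfrak c_0(\mathbb Z^d,\mathbb C)$. The index value $0$ refers to the spaces $\mathfrak c_0$ with the sup-norm (i.e. "$\ell^p$ with $p=0$" means $\mathfrak c_0$). For $f\in\ell^\infty(\mathbb Z^d,\mathcal H)$ and $\psi=(\psi_m)\in\ell^1(\mathbb Z^d,\mathcal H)$ write $\langle f,\psi\rangle=\sum_{m}\langle f_m,\psi_m\rangle$. A sequence $\varphi^n=(\varphi^n_m)_{m\in\mathbb Z^d}\in\ell^1(\mathbb Z^d,\mathcal H)$, $n\in\mathbb Z^d$, is a $p$-frame, $p\in[1,\infty)$, if there are $0<a\le b<\infty$ with $a\|f\|^p\le\sum_{n}|\langle f,\varphi^n\rangle|^p\le b\|f\|^p$ for all $f\in\ell^p(\mathbb Z^d,\mathcal H)$. It is an $\infty$-frame if $a\|f\|\le\sup_n|\langle f,\varphi^n\rangle|\le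 b\|f\|$ for some $0<a\le b<\infty$ and all $f\in\ell^\infty(\mathbb Z^d,\mathcal H)$, and a $0$-frame if this holds for all $f\in\mathfrak c_0(\mathbb Z^d,\mathcal H)$. The $p$-analysis operator is $T:\ell^p(\mathbb Z^d,\mathcal H)\to\ell^p(\mathbb Z^d)$, $Tf=(\langle f,\varphi^n\rangle)_{n\in\mathbb Z^d}$, $p\in[1,\infty]$; the $0$-analysis operator is defined in the same way on $\mathfrak c_0(\mathbb Z^d,\mathcal H)$. $T^*$ is the operator $T^*c=\sum_nc_n\varphi^n$, i.e. $(T^*c)_m=\sum_nc_n\varphi^n_m$, and the $q$-synthesis operator $T^\sharp=(T^*T)^{-1}T^*$ acts from $\ell^q(\mathbb Z^d)$ to $\ell^q(\mathbb Z^d,\mathcal H)$ (from $\mathfrak c_0(\mathbb Z^d)$ to $\mathfrak c_0(\mathbb Z^d,\mathcal H)$ for $q=0$). Slanted matrices: for a matrix $\mathbb A=(a_{mn})_{m,n\in\mathbb Z^d}$ of bounded operators $a_{mn}:\mathcal H\to\mathbb C$, $\|\mathbb A\|_{\sup}=\sup_{m,n}\|a_{mn}\|$; for $j\in\mathbb Z^d$ the $j$-th $\alpha$-slant is $A_j=(a^{(j)}_{mn})$, $a^{(j)}_{mn}=a_{mn}\prod_{k=1}^d\chi_{[j_k,j_k+1)}(\alpha m_k-n_k)$; with $K=\lceil|\alpha|^{-1}\rceil^d$ and $\omega:\mathbb Z^d\to[1,\infty)$, $\Sigma^\omega_\alpha$ is the class of matrices with $K\sum_j\|A_j\|_{\sup}\omega(j)<\infty$.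 Operators are identified with their matrices: an operator belongs to $\Sigma_\alpha^\omega$ if it is given by a matrix in this class via $(\mathbb Ax)_m=\sum_na_{mn}x_n$. A $p$-frame $\varphi^n$ with $p$-analysis operator $T$, $p\in\{0\}\cup[1,\infty]$, is $(s,\alpha)$-localized, for some $s>1$ and $\alpha\neq0$, if there exists an isomorphism $J:\ell^\infty(\mathbb Z^d,\mathcal H)\to\ell^\infty(\mathbb Z^d,\mathcal H)$ which leaves invariant $\mathfrak c_0(\mathbb Z^d,\mathcal H)$ and all $\ell^q(\mathbb Z^d,\mathcal H)$, $q\in[1,\infty)$, and such that $TJ|_{\ell^p}\in\Sigma_\alpha^\omega$, where $\omega(n)=(1+|n|)^s$.
   Formalization: The isomorphism J is required to map c_0 and every ℓ^q onto itself, not only into itself; with mere inclusion (i) fails (d=1, H=ℂ, J=3/2−D with (Df)_n=f_{⌊n/2⌋}, T=J^{-1}: an ∞-frame with TJ=I, but T e_1 is not in ℓ^1). *)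

theory Defs
  imports "HOL-Analysis.Analysis"
begin

section \<open>Complex Hilbert spaces\<close>

text \<open>
  Inner products are linear in the first argument, so that \<open>pairing f \<psi>\<close> below is linear in \<open>f\<close>.
  Nonnegativity and definiteness of the inner product follow from the last axiom together with
  the norm axioms of class banach.
\<close>

class chilbert_space = banach +
  fixes scaleC :: "complex \<Rightarrow> 'a \<Rightarrow> 'a"
    and cinner :: "'a \<Rightarrow> 'a \<Rightarrow> complex"
  assumes scaleC_of_real: "scaleC (complex_of_real r) x = scaleR r x"
    and scaleC_add_right: "scaleC a (x + y) = scaleC a x + scaleC a y"
    and scaleC_add_left: "scaleC (a + b) x = scaleC a x + scaleC b x"
    and scaleC_scaleC: "scaleC a (scaleC b x) = scaleC (a * b) x"
    and cinner_commute: "cinner x y = cnj (cinner y x)"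
    and cinner_add_left: "cinner (x + y) z = cinner x z + cinner y z"
    and cinner_scaleC_left: "cinner (scaleC a x) y = a * cinner x y"
    and norm_eq_sqrt_cinner: "norm x = sqrt (Re (cinner x x))"

instantiation complex :: chilbert_space
begin

definition scaleC_complex :: "complex \<Rightarrow> complex \<Rightarrow> complex"
  where "scaleC_complex a x = a * x"

definition cinner_complex :: "complex \<Rightarrow> complex \<Rightarrow> complex"
  where "cinner_complex x y = x * cnj y"

instance
  by standard
    (auto simp: scaleC_complex_def cinner_complex_def scaleR_conv_of_real algebra_simps
       cmod_def power2_eq_square)

end


section \<open>Sequence spaces over the integer lattice\<close>

definition znorm :: "int ^ 'd::finite \<Rightarrow> int"
  where "znorm n = Max (range (\<lambda>k. \<bar>n $ k\<bar>))"

text \<open>The index value 0 stands for the space \<open>c\<^sub>0\<close> with the supremum norm.\<close>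

definition lp_index :: "ereal set"
  where "lp_index = {p. p = 0 \<or> 1 \<le> p}"

definition lp :: "ereal \<Rightarrow> (int ^ 'd::finite \<Rightarrow> 'a::real_normed_vector) set"
  where "lp p =
    (if p = 0 then
       {f. bounded (range f) \<and> ((\<lambda>m. norm (f m)) \<longlongrightarrow> 0) (filtercomap znorm at_top)}
     else if p = \<infinity> then {f. bounded (range f)}
     else {f. (\<lambda>m. norm (f m) powr real_of_ereal p) summable_on UNIV})"

definition lp_norm :: "ereal \<Rightarrow> (int ^ 'd::finite \<Rightarrow> 'a::real_normed_vector) \<Rightarrow> real"
  where "lp_norm p f =
    (if p = 0 \<or> p = \<infinity> then (SUP m. norm (f m))
     else (\<Sum>\<^sub>\<infinity>m. norm (f m) powr real_of_ereal p) powr (1 / real_of_ereal p))"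

definition lp_operator ::
  "ereal \<Rightarrow> ((int ^ 'd::finite \<Rightarrow> 'a::chilbert_space) \<Rightarrow> (int ^ 'd \<Rightarrow> 'b::chilbert_space)) \<Rightarrow> bool"
  where "lp_operator p A \<longleftrightarrow>
    (\<forall>f\<in>lp p. A f \<in> lp p) \<and>
    (\<forall>f\<in>lp p. \<forall>g\<in>lp p. A (\<lambda>m. f m + g m) = (\<lambda>m. A f m + A g m)) \<and>
    (\<forall>c. \<forall>f\<in>lp p. A (\<lambda>m. scaleC c (f m)) = (\<lambda>m. scaleC c (A f m))) \<and>
    (\<exists>C. \<forall>f\<in>lp p. lp_norm p (A f) \<le> C * lp_norm p f)"

definition pairing ::
  "(int ^ 'd::finite \<Rightarrow> 'a::chilbert_space) \<Rightarrow> (int ^ 'd \<Rightarrow> 'a) \<Rightarrow> complex"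
  where "pairing f \<psi> = (\<Sum>\<^sub>\<infinity>m. cinner (f m) (\<psi> m))"

text \<open>Unconditional convergence of a series of sequences in the norm of the space with index p.\<close>

definition lp_has_sum ::
  "ereal \<Rightarrow> (int ^ 'd::finite \<Rightarrow> int ^ 'd \<Rightarrow> 'a::real_normed_vector) \<Rightarrow> (int ^ 'd \<Rightarrow> 'a) \<Rightarrow> bool"
  where "lp_has_sum p g f \<longleftrightarrow>
    f \<in> lp p \<and> (\<forall>n. g n \<in> lp p) \<and>
    ((\<lambda>F. lp_norm p (\<lambda>m. (\<Sum>n\<in>F. g n m) - f m)) \<longlongrightarrow> 0) (finite_subsets_at_top UNIV)"

text \<open>The weak-star topology of \<open>\<ell>\<^sup>\<infinity>\<close> as the dual of \<open>\<ell>\<^sup>1\<close>.\<close>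

definition weak_star_topology :: "(int ^ 'd::finite \<Rightarrow> 'a::chilbert_space) topology"
  where "weak_star_topology =
    topology_generated_by
      {{f \<in> lp \<infinity>. pairing f \<psi> \<in> U} | \<psi> U. \<psi> \<in> lp 1 \<and> open U}"

definition weak_star_has_sum ::
  "(int ^ 'd::finite \<Rightarrow> int ^ 'd \<Rightarrow> 'a::chilbert_space) \<Rightarrow> (int ^ 'd \<Rightarrow> 'a) \<Rightarrow> bool"
  where "weak_star_has_sum g f \<longleftrightarrow>
    limitin weak_star_topology (\<lambda>F m. \<Sum>n\<in>F. g n m) f (finite_subsets_at_top UNIV)"


section \<open>Frames\<close>

definition analysis ::
  "(int ^ 'd::finite \<Rightarrow> int ^ 'd \<Rightarrow> 'a::chilbert_space) \<Rightarrow> (int ^ 'd \<Rightarrow> 'a) \<Rightarrow> (int ^ 'd \<Rightarrow> complex)"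
  where "analysis \<phi> f = (\<lambda>n. pairing f (\<phi> n))"

definition analysis_adj ::
  "(int ^ 'd::finite \<Rightarrow> int ^ 'd \<Rightarrow> 'a::chilbert_space) \<Rightarrow> (int ^ 'd \<Rightarrow> complex) \<Rightarrow> (int ^ 'd \<Rightarrow> 'a)"
  where "analysis_adj \<phi> c = (\<lambda>m. \<Sum>\<^sub>\<infinity>n. scaleC (c n) (\<phi> n m))"

definition frame_op ::
  "(int ^ 'd::finite \<Rightarrow> int ^ 'd \<Rightarrow> 'a::chilbert_space) \<Rightarrow> (int ^ 'd \<Rightarrow> 'a) \<Rightarrow> (int ^ 'd \<Rightarrow> 'a)"
  where "frame_op \<phi> f = analysis_adj \<phi> (analysis \<phi> f)"

definition frame_op_inv ::
  "ereal \<Rightarrow> (int ^ 'd::finite \<Rightarrow> int ^ 'd \<Rightarrow> 'a::chilbert_space) \<Rightarrow> (int ^ 'd \<Rightarrow> 'a) \<Rightarrow> (int ^ 'd \<Rightarrow> 'a)"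
  where "frame_op_inv q \<phi> = inv_into (lp q) (frame_op \<phi>)"

definition synthesis ::
  "ereal \<Rightarrow> (int ^ 'd::finite \<Rightarrow> int ^ 'd \<Rightarrow> 'a::chilbert_space) \<Rightarrow> (int ^ 'd \<Rightarrow> complex) \<Rightarrow> (int ^ 'd \<Rightarrow> 'a)"
  where "synthesis q \<phi> c = frame_op_inv q \<phi> (analysis_adj \<phi> c)"

text \<open>
  The inverse is taken on \<open>\<ell>\<^sup>\<infinity>\<close>, which contains all the other spaces; whenever the frame
  operator is bijective on each of the spaces, the inverses are restrictions of this one.
\<close>

definition dual_sequence ::
  "(int ^ 'd::finite \<Rightarrow> int ^ 'd \<Rightarrow> 'a::chilbert_space) \<Rightarrow> int ^ 'd \<Rightarrow> int ^ 'd \<Rightarrow> 'a"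
  where "dual_sequence \<phi> n = frame_op_inv \<infinity> \<phi> (\<phi> n)"

definition is_frame ::
  "ereal \<Rightarrow> (int ^ 'd::finite \<Rightarrow> int ^ 'd \<Rightarrow> 'a::chilbert_space) \<Rightarrow> bool"
  where "is_frame p \<phi> \<longleftrightarrow>
    (\<forall>n. \<phi> n \<in> lp 1) \<and>
    (\<exists>a b. 0 < a \<and> a \<le> b \<and>
      (\<forall>f\<in>lp p.
        if p = 0 \<or> p = \<infinity> then
          bdd_above (range (\<lambda>n. norm (pairing f (\<phi> n)))) \<and>
          a * lp_norm p f \<le> (SUP n. norm (pairing f (\<phi> n))) \<and>
          (SUP n. norm (pairing f (\<phi> n))) \<le> b * lp_norm p f
        else
          (\<lambda>n. norm (pairing f (\<phi> n)) powr real_of_ereal p) summable_on UNIV \<and>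
          a * lp_norm p f powr real_of_ereal p
            \<le> (\<Sum>\<^sub>\<infinity>n. norm (pairing f (\<phi> n)) powr real_of_ereal p) \<and>
          (\<Sum>\<^sub>\<infinity>n. norm (pairing f (\<phi> n)) powr real_of_ereal p)
            \<le> b * lp_norm p f powr real_of_ereal p))"


section \<open>Slanted matrices\<close>

definition bounded_clinear_functional :: "('a::chilbert_space \<Rightarrow> complex) \<Rightarrow> bool"
  where "bounded_clinear_functional u \<longleftrightarrow>
    bounded_linear u \<and> (\<forall>c x. u (scaleC c x) = c * u x)"

definition matrix_sup_norm ::
  "(int ^ 'd::finite \<Rightarrow> int ^ 'd \<Rightarrow> 'a::chilbert_space \<Rightarrow> complex) \<Rightarrow> ennreal"
  where "matrix_sup_norm A = (SUP m. SUP n. ennreal (onorm (A m n)))"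

definition slant ::
  "real \<Rightarrow> int ^ 'd::finite \<Rightarrow> (int ^ 'd \<Rightarrow> int ^ 'd \<Rightarrow> 'a::chilbert_space \<Rightarrow> complex) \<Rightarrow>
    (int ^ 'd \<Rightarrow> int ^ 'd \<Rightarrow> 'a \<Rightarrow> complex)"
  where "slant \<alpha> j A = (\<lambda>m n x.
    (\<Prod>k\<in>UNIV. indicator {real_of_int (j $ k)..<real_of_int (j $ k) + 1}
                 (\<alpha> * real_of_int (m $ k) - real_of_int (n $ k))) * A m n x)"

definition slanted_class ::
  "real \<Rightarrow> (int ^ 'd::finite \<Rightarrow> real) \<Rightarrow> (int ^ 'd \<Rightarrow> int ^ 'd \<Rightarrow> 'a::chilbert_space \<Rightarrow> complex) set"
  where "slanted_class \<alpha> \<omega> =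
    {A. (\<forall>m n. bounded_clinear_functional (A m n)) \<and>
        ennreal (real_of_int \<lceil>inverse \<bar>\<alpha>\<bar>\<rceil> ^ CARD('d)) *
          (\<Sum>\<^sub>\<infinity>j. matrix_sup_norm (slant \<alpha> j A) * ennreal (\<omega> j)) < \<infinity>}"

definition in_slanted_class ::
  "real \<Rightarrow> (int ^ 'd::finite \<Rightarrow> real) \<Rightarrow> ereal \<Rightarrow>
    ((int ^ 'd \<Rightarrow> 'a::chilbert_space) \<Rightarrow> (int ^ 'd \<Rightarrow> complex)) \<Rightarrow> bool"
  where "in_slanted_class \<alpha> \<omega> p B \<longleftrightarrow>
    (\<exists>A\<in>slanted_class \<alpha> \<omega>. \<forall>x\<in>lp p. \<forall>m. ((\<lambda>n. A m n (x n)) has_sum B x m) UNIV)"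


section \<open>Localized frames\<close>

definition linf_isomorphism ::
  "((int ^ 'd::finite \<Rightarrow> 'a::chilbert_space) \<Rightarrow> (int ^ 'd \<Rightarrow> 'a)) \<Rightarrow> bool"
  where "linf_isomorphism J \<longleftrightarrow>
    bij_betw J (lp \<infinity>) (lp \<infinity>) \<and> lp_operator \<infinity> J \<and> lp_operator \<infinity> (inv_into (lp \<infinity>) J)"

definition poly_weight :: "real \<Rightarrow> int ^ 'd::finite \<Rightarrow> real"
  where "poly_weight s n = (1 + real_of_int (znorm n)) powr s"

text \<open>
  An isomorphism leaves a subspace invariant if it restricts to a bijection of the subspace.
  The mere inclusion \<open>J ` lp q \<subseteq> lp q\<close> does not suffice for the theory: over the integers, let
  \<open>(D f)\<^sub>n = f\<^bsub>n div 2\<^esub>\<close> and \<open>J = 3/2 - D\<close>; then the rows of the inverse of J on \<open>\<ell>\<^sup>\<infinity>\<close> form an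
  \<open>\<infinity>\<close>-frame with \<open>T J = id\<close>, but T does not map \<open>\<ell>\<^sup>1\<close> into itself.
\<close>

definition localized_frame ::
  "real \<Rightarrow> real \<Rightarrow> ereal \<Rightarrow> (int ^ 'd::finite \<Rightarrow> int ^ 'd \<Rightarrow> 'a::chilbert_space) \<Rightarrow> bool"
  where "localized_frame s \<alpha> p \<phi> \<longleftrightarrow>
    is_frame p \<phi> \<and> 1 < s \<and> \<alpha> \<noteq> 0 \<and>
    (\<exists>J. linf_isomorphism J \<and>
      (\<forall>q\<in>lp_index. J ` lp q = lp q) \<and>
      in_slanted_class \<alpha> (poly_weight s) p (\<lambda>f. analysis \<phi> (J f)))"

end

theory Submission
  imports Defs
begin

text \<open>
  Write \<open>A = T J\<close>. Multiplying a sequence by the slowly varying weight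
  \<open>\<theta>\<^sub>k(n) = (1 + |n - k|/N)\<^sup>-\<^sup>t\<close> almost commutes with the localized matrix \<open>A\<close>, so a lower bound
  for \<open>A\<close> on one \<open>\<ell>\<^sup>p\<close> gives the pointwise bound
  \<open>\<parallel>x\<^sub>k\<parallel> \<le> \<Sum>\<^sub>m \<kappa>(\<lfloor>\<alpha> m\<rfloor> - k) \<bar>(A x)\<^sub>m\<bar>\<close> with a summable \<open>\<kappa>\<close>, and hence a lower bound on every \<open>\<ell>\<^sup>q\<close>.
  On \<open>\<ell>\<^sup>2\<close> the localized operator \<open>A\<^sup>*A\<close> is then invertible, and the same pointwise bound for
  \<open>A\<^sup>*A\<close> makes its inverse bounded on every \<open>\<ell>\<^sup>q\<close>. Finally \<open>T\<^sup>*T\<close> has the inverse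
  \<open>J (A\<^sup>*A)\<^sup>-\<^sup>1 J\<^sup>*\<close>, and the dual sequence is localized through \<open>T\<^sup>*T J\<close>, because
  \<open>T (T\<^sup>*T)\<^sup>-\<^sup>1 T\<^sup>*T J = A\<close>. Since \<open>J\<close> need not be weak-star continuous on \<open>\<ell>\<^sup>\<infinity>\<close>, it is first
  replaced there by the bidual of its restriction to \<open>c\<^sub>0\<close>.
\<close>

section \<open>Complex Hilbert spaces\<close>

text \<open>The obstacle is l^infty: finite sequences are not norm dense there, so a bounded
  operator on it is not determined by its matrix. Operators are therefore carried together with an
  adjoint on all spaces (\<open>adj_pair\<close>); this makes them weak-star continuous, and
  identities can be checked on single entries. Boundedness of \<open>J\<close> is given on l^infty
  only; on l^q it is deduced from invariance. Only boundedness of the inverse has to reach the other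
  spaces, because the dual sequence reuses the matrix \<open>A\<close> itself. The inverse found on
  l^2 says nothing about l^q for q > 2. The transfer runs through c_0, which contains every l^q with
  q finite: right-hand sides of finite support are solved in l^2, the pointwise bound puts the
  solution into c_0, and density does the rest. The exponent: \<theta> is summable over the lattice
  for t = 2d, and commuting it past \<open>A\<close> spends t + 1 = 2d + 1 moments of the decay; 2d
  + 1 <= (d + 1)^2 < s provides them. The slant enters through the map sending m to floor(\<alpha>
  m), whose fibres have bounded size.\<close>

lemma scaleC_zero_left [simp]: "scaleC 0 (x::'a::chilbert_space) = 0"
  using scaleC_of_real[of 0 x] by simp

lemma scaleC_one [simp]: "scaleC 1 (x::'a::chilbert_space) = x"
  using scaleC_of_real[of 1 x] by simp

lemma scaleC_minus_one [simp]: "scaleC (- 1) (x::'a::chilbert_space) = - x"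
  using scaleC_of_real[of "-1" x] by simp

lemma scaleC_zero_right [simp]: "scaleC c (0::'a::chilbert_space) = 0"
  using scaleC_add_right[of c 0 "0::'a"] by simp

lemma scaleC_minus_right: "scaleC c (- x::'a::chilbert_space) = - scaleC c x"
  using scaleC_add_right[of c x "-x"] by (simp add: eq_neg_iff_add_eq_0 add.commute)

lemma scaleC_diff_right: "scaleC c (x - y::'a::chilbert_space) = scaleC c x - scaleC c y"
  using scaleC_add_right[of c x "-y"] by (simp add: scaleC_minus_right)

lemma scaleC_complex [simp]: "scaleC c (x::complex) = c * x"
  by (simp add: scaleC_complex_def)

lemma cinner_complex [simp]: "cinner (x::complex) y = x * cnj y"
  by (simp add: cinner_complex_def)

lemma cinner_zero_left [simp]: "cinner 0 (y::'a::chilbert_space) = 0"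
  using cinner_scaleC_left[of 0 "0::'a" y] by simp

lemma cinner_zero_right [simp]: "cinner (y::'a::chilbert_space) 0 = 0"
  using cinner_commute[of y 0] by simp

lemma cinner_minus_left: "cinner (- x) (y::'a::chilbert_space) = - cinner x y"
  using cinner_scaleC_left[of "-1" x y] by simp

lemma cinner_diff_left: "cinner (x - z) (y::'a::chilbert_space) = cinner x y - cinner z y"
  using cinner_add_left[of x "-z" y] by (simp add: cinner_minus_left)

lemma cinner_add_right: "cinner x (y + z) = cinner x y + cinner x (z::'a::chilbert_space)"
  by (metis cinner_add_left cinner_commute complex_cnj_add)

lemma cinner_scaleC_right: "cinner x (scaleC c y) = cnj c * cinner x (y::'a::chilbert_space)"
  by (metis cinner_scaleC_left cinner_commute complex_cnj_mult)

lemma cinner_minus_right: "cinner x (- y) = - cinner x (y::'a::chilbert_space)"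
  using cinner_scaleC_right[of x "-1" y] by simp

lemma cinner_diff_right: "cinner x (y - z) = cinner x y - cinner x (z::'a::chilbert_space)"
  using cinner_add_right[of x y "-z"] by (simp add: cinner_minus_right)

lemma cinner_scaleR_left: "cinner (scaleR r x) y = of_real r * cinner x (y::'a::chilbert_space)"
  by (metis cinner_scaleC_left scaleC_of_real)

lemma cinner_scaleR_right: "cinner x (scaleR r y) = of_real r * cinner x (y::'a::chilbert_space)"
  by (metis cinner_scaleC_right scaleC_of_real complex_cnj_complex_of_real)

lemma cinner_self: "cinner x x = of_real ((norm (x::'a::chilbert_space))\<^sup>2)"
proof (rule complex_eqI)
  \<comment> \<open>The real \<open>sqrt\<close> is odd, so a nonnegative value forces a nonnegative
    argument.\<close>
  have "0 \<le> Re (cinner x x)"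
    using norm_ge_zero[of x] norm_eq_sqrt_cinner[of x] by (metis real_sqrt_ge_0_iff)
  then show "Re (cinner x x) = Re (of_real ((norm x)\<^sup>2))"
    by (simp add: norm_eq_sqrt_cinner)
  show "Im (cinner x x) = Im (of_real ((norm x)\<^sup>2))"
    using arg_cong[OF cinner_commute[of x x], of Im] by simp
qed

lemma norm_scaleC: "norm (scaleC c (x::'a::chilbert_space)) = cmod c * norm x"
proof -
  have "of_real ((norm (scaleC c x))\<^sup>2) = c * cnj c * cinner x x"
    by (simp only: cinner_self[symmetric] cinner_scaleC_left cinner_scaleC_right mult_ac)
  also have "\<dots> = of_real ((cmod c * norm x)\<^sup>2)"
    by (simp add: complex_norm_square[symmetric] cinner_self power_mult_distrib)
  finally have "(norm (scaleC c x))\<^sup>2 = (cmod c * norm x)\<^sup>2"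
    using of_real_eq_iff by blast
  then show ?thesis
    by (simp add: power2_eq_iff_nonneg)
qed

lemma norm_add_sq:
  "(norm (x + y::'a::chilbert_space))\<^sup>2 = (norm x)\<^sup>2 + 2 * Re (cinner x y) + (norm y)\<^sup>2"
proof -
  have *: "(norm z)\<^sup>2 = Re (cinner z z)" for z :: 'a
    by (simp add: cinner_self)
  have "Re (cinner y x) = Re (cinner x y)"
    using arg_cong[OF cinner_commute[of y x], of Re] by simp
  then show ?thesis
    unfolding * by (simp add: cinner_add_left cinner_add_right)
qed

lemma norm_diff_sq:
  "(norm (x - y::'a::chilbert_space))\<^sup>2 = (norm x)\<^sup>2 - 2 * Re (cinner x y) + (norm y)\<^sup>2"
  using norm_add_sq[of x "-y"] by (simp add: cinner_minus_right)

lemma cinner_Cauchy_Schwarz: "cmod (cinner x y) \<le> norm x * norm (y::'a::chilbert_space)"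
proof (cases "y = 0")
  case False
  then have y: "norm y > 0" by simp
  define c where "c = cinner x y / of_real ((norm y)\<^sup>2)"
  have "0 \<le> (norm (x - scaleC c y))\<^sup>2" by simp
  also have "\<dots> = (norm x)\<^sup>2 - 2 * Re (cnj c * cinner x y) + (cmod c * norm y)\<^sup>2"
    by (simp add: norm_diff_sq cinner_scaleC_right norm_scaleC)
  also have "cnj c * cinner x y = of_real ((cmod (cinner x y))\<^sup>2 / (norm y)\<^sup>2)"
    using complex_norm_square[of "cinner x y"] by (simp add: c_def field_simps)
  also have "cmod c = cmod (cinner x y) / (norm y)\<^sup>2"
    by (simp add: c_def norm_divide norm_power)
  also have "(norm x)\<^sup>2 - 2 * Re (of_real ((cmod (cinner x y))\<^sup>2 / (norm y)\<^sup>2))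
      + (cmod (cinner x y) / (norm y)\<^sup>2 * norm y)\<^sup>2
      = (norm x)\<^sup>2 - (cmod (cinner x y))\<^sup>2 / (norm y)\<^sup>2"
    using y by (simp add: field_simps power2_eq_square)
  finally have "(cmod (cinner x y))\<^sup>2 \<le> (norm x * norm y)\<^sup>2"
    using y by (simp add: field_simps power_mult_distrib)
  then show ?thesis
    by (simp add: power2_le_iff_abs_le)
qed simp

lemma bounded_linear_cinner_right: "bounded_linear (cinner (x::'a::chilbert_space))"
proof (rule bounded_linear_intro[where K = "norm x"])
  show "norm (cinner x y) \<le> norm y * norm x" for y
    using cinner_Cauchy_Schwarz[of x y] by (simp add: mult.commute)
qed (simp_all add: cinner_add_right cinner_scaleR_right scaleR_conv_of_real)

lemma cinner_sum_right: "cinner y (\<Sum>i\<in>F. f i) = (\<Sum>i\<in>F. cinner y (f i :: 'a::chilbert_space))"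
  using linear_sum[OF bounded_linear.linear[OF bounded_linear_cinner_right[of y]]] .

lemma cinner_extensionality:
  assumes "\<And>h. cinner h x = cinner h (y::'a::chilbert_space)"
  shows "x = y"
proof -
  have "cinner (x - y) (x - y) = 0"
    using assms[of "x - y"] by (simp add: cinner_diff_right)
  then show ?thesis by (simp add: cinner_self)
qed

lemma norm_le_cinnerI:
  fixes x :: "'a::chilbert_space"
  assumes "cmod (cinner x x) \<le> C * norm x" "0 \<le> C"
  shows "norm x \<le> C"
proof (cases "x = 0")
  case False
  have "norm x * norm x \<le> C * norm x"
    using assms(1) by (simp add: cinner_self power2_eq_square norm_mult)
  with False show ?thesis by simp
qed (use assms in simp)

text \<open>The representing vector minimizes \<open>\<parallel>x\<parallel>\<^sup>2 - 2 Re (u x)\<close>.\<close>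

lemma riesz_representation:
  fixes u :: "'a::chilbert_space \<Rightarrow> complex"
  assumes "bounded_clinear_functional u"
  shows "\<exists>v. \<forall>x. u x = cinner x v"
proof -
  have bl: "bounded_linear u" and sc: "\<And>c x. u (scaleC c x) = c * u x"
    using assms by (auto simp: bounded_clinear_functional_def)
  interpret u: bounded_linear u by fact
  define Q where "Q x = (norm x)\<^sup>2 - 2 * Re (u x)" for x
  define C where "C = onorm u"
  have uC: "cmod (u x) \<le> C * norm x" for x
    using onorm[OF bl] by (simp add: C_def)
  have lower: "- C\<^sup>2 \<le> Q x" for x
  proof -
    have "Re (u x) \<le> C * norm x"
      using complex_Re_le_cmod[of "u x"] uC[of x] by linarith
    moreover have "0 \<le> (norm x - C)\<^sup>2" by simp
    ultimately show ?thesis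
      by (simp add: Q_def power2_eq_square algebra_simps)
  qed
  define I where "I = (INF x. Q x)"
  have bdd: "bdd_below (range Q)"
    using lower by (auto intro!: bdd_belowI[where m = "- C\<^sup>2"])
  have IQ: "I \<le> Q x" for x
    unfolding I_def by (rule cINF_lower[OF bdd]) simp
  have "\<exists>x. Q x < I + 1 / real (Suc n)" for n
  proof -
    have "I < I + 1 / real (Suc n)" by simp
    then show ?thesis
      using cINF_less_iff[OF _ bdd, of "I + 1 / real (Suc n)"] unfolding I_def by (auto simp del: of_nat_Suc)
  qed
  then obtain X where X: "\<And>n. Q (X n) < I + 1 / real (Suc n)" by metis
  \<comment> \<open>The parallelogram law for \<open>Q\<close>: the linear part cancels, so two
    almost minimal points are close, since their midpoint cannot lie below \<open>I\<close>.\<close>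
  have par: "(norm (x - y))\<^sup>2 = 2 * Q x + 2 * Q y - 4 * Q (scaleR (1/2) (x + y))" for x y
  proof -
    have "(norm (scaleR (1/2) (x + y)))\<^sup>2
        = ((norm x)\<^sup>2 + 2 * Re (cinner x y) + (norm y)\<^sup>2) / 4"
      by (simp add: norm_add_sq[symmetric] power_divide)
    then have "Q (scaleR (1/2) (x + y))
        = ((norm x)\<^sup>2 + 2 * Re (cinner x y) + (norm y)\<^sup>2) / 4 - (Re (u x) + Re (u y))"
      unfolding Q_def by (simp only: u.scaleR u.add) (simp add: field_simps)
    then show ?thesis
      by (simp add: Q_def norm_diff_sq field_simps)
  qed
  have dist: "(norm (X m - X n))\<^sup>2 \<le> 2 / real (Suc m) + 2 / real (Suc n)" for m n
    using par[of "X m" "X n"] X[of m] X[of n] IQ[of "scaleR (1/2) (X m + X n)"] by simp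
  have "Cauchy X"
  proof (rule metric_CauchyI)
    fix e :: real assume e: "0 < e"
    obtain M where M: "4 / e\<^sup>2 < real M" using reals_Archimedean2 by blast
    show "\<exists>M. \<forall>m\<ge>M. \<forall>n\<ge>M. dist (X m) (X n) < e"
    proof (intro exI allI impI)
      fix m n assume mn: "M \<le> m" "M \<le> n"
      have Mp: "0 < real M" using M e by (smt (verit) divide_pos_pos zero_less_power)
      have "2 / real (Suc m) \<le> 2 / real M" "2 / real (Suc n) \<le> 2 / real M"
        using mn Mp by (auto intro!: divide_left_mono)
      then have "(norm (X m - X n))\<^sup>2 \<le> 4 / real M"
        using dist[of m n] by simp
      also have "\<dots> < e\<^sup>2"
        using M Mp e by (simp add: field_simps)
      finally show "dist (X m) (X n) < e"
        using e by (simp add: dist_norm power2_less_imp_less)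
    qed
  qed
  then obtain v where v: "X \<longlonglongrightarrow> v"
    using Cauchy_convergent_iff convergent_def by blast
  have "(\<lambda>n. Q (X n)) \<longlonglongrightarrow> Q v"
    unfolding Q_def by (intro tendsto_intros v u.tendsto)
  moreover have "(\<lambda>n. I + 1 / real (Suc n)) \<longlonglongrightarrow> I + 0"
    by (intro tendsto_intros LIMSEQ_Suc[OF lim_const_over_n])
  ultimately have "Q v \<le> I + 0"
    by (rule LIMSEQ_le) (use X less_imp_le in blast)
  then have min: "Q v \<le> Q x" for x using IQ[of x] by simp
  have re: "Re (cinner x v) = Re (u x)" for x
  proof -
    define b where "b = Re (cinner x v) - Re (u x)"
    have sym: "Re (cinner v x) = Re (cinner x v)"
      using arg_cong[OF cinner_commute[of v x], of Re] by simp
    \<comment> \<open>First variation at the minimizer \<open>v\<close> in direction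
      \<open>x\<close>; the value t = -b/|x|^2 below forces b = 0.\<close>
    have *: "0 \<le> 2 * t * b + t\<^sup>2 * (norm x)\<^sup>2" for t
    proof -
      have "Q (v + scaleR t x) = Q v + 2 * t * b + t\<^sup>2 * (norm x)\<^sup>2"
        by (simp add: Q_def norm_add_sq u.add u.scaleR cinner_scaleR_right sym b_def
            power_mult_distrib algebra_simps)
      then show ?thesis using min[of "v + scaleR t x"] by simp
    qed
    show ?thesis
    proof (cases "x = 0")
      case True then show ?thesis by simp
    next
      case False
      have "0 \<le> - (b\<^sup>2 / (norm x)\<^sup>2)"
        using *[of "- b / (norm x)\<^sup>2"] False by (simp add: field_simps power2_eq_square)
      with False have "b = 0" by (simp add: divide_le_0_iff)
      then show ?thesis by (simp add: b_def)
    qed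
  qed
  have "u x = cinner x v" for x
  proof (rule complex_eqI)
    show "Re (u x) = Re (cinner x v)" using re by simp
    \<comment> \<open>Since Re (-i z) = Im z, complex linearity turns the identity of real parts at
      -i x into the one for imaginary parts.\<close>
    show "Im (u x) = Im (cinner x v)"
      using re[of "scaleC (- \<i>) x"] by (simp add: sc cinner_scaleC_left)
  qed
  then show ?thesis by blast
qed

section \<open>Unconditional convergence of vector series\<close>

lemma summable_on_Cauchy_blocks:
  fixes x :: "'i \<Rightarrow> 'a::banach"
  assumes "\<And>e. e > 0 \<Longrightarrow> \<exists>F. finite F \<and> (\<forall>G. finite G \<longrightarrow> G \<inter> F = {} \<longrightarrow> norm (sum x G) < e)"
  shows "x summable_on UNIV"
proof -
  have "\<exists>d. filterlim (sum x) (nhds d) (finite_subsets_at_top UNIV)"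
  proof -
    have "\<exists>P. eventually P (finite_subsets_at_top UNIV) \<and>
            (\<forall>F F'. P F \<and> P F' \<longrightarrow> dist (sum x F) (sum x F') < e)" if e: "0 < e" for e
    proof -
      obtain F where F: "finite F" "\<And>G. finite G \<Longrightarrow> G \<inter> F = {} \<Longrightarrow> norm (sum x G) < e/2"
        using assms[of "e/2"] e by auto
      \<comment> \<open>Two index sets containing \<open>F\<close> differ only by blocks that miss
        \<open>F\<close>, and each block contributes less than e/2.\<close>
      define P where "P = (\<lambda>H. finite H \<and> F \<subseteq> H)"
      have "eventually P (finite_subsets_at_top UNIV)"
        unfolding P_def eventually_finite_subsets_at_top using F(1) by auto
      moreover have "dist (sum x H) (sum x H') < e" if "P H" "P H'" for H H'
      proof -
        have H: "sum x H = sum x F + sum x (H - F)" if "P H" for H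
          using that F(1) sum.subset_diff[of F H x] by (auto simp: P_def add.commute)
        have "norm (sum x (H - F)) < e/2" "norm (sum x (H' - F)) < e/2"
          by (rule F(2); use that in \<open>auto simp: P_def\<close>)+
        then show ?thesis
          unfolding dist_norm H[OF that(1)] H[OF that(2)]
          using norm_triangle_ineq4[of "sum x (H - F)" "sum x (H' - F)"] by simp
      qed
      ultimately show ?thesis by blast
    qed
    then have "cauchy_filter (filtermap (sum x) (finite_subsets_at_top UNIV))"
      by (simp add: cauchy_filter_metric_filtermap)
    moreover have "complete (UNIV :: 'a set)"
      by (meson Cauchy_convergent UNIV_I complete_def convergent_def)
    ultimately obtain d where "filtermap (sum x) (finite_subsets_at_top UNIV) \<le> nhds d"
      using cauchy_filter_complete_converges[of "filtermap (sum x) (finite_subsets_at_top UNIV)" UNIV]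
      by (auto simp: filtermap_bot_iff finite_subsets_at_top_neq_bot)
    then show ?thesis by (auto simp: filterlim_def)
  qed
  then show ?thesis
    by (auto simp: summable_on_def has_sum_def)
qed

text \<open>
  Take a finite signed partial sum whose norm is almost maximal; adding a disjoint block with a
  suitable sign enlarges it by at least the block, so the block is small.
\<close>

lemma weakly_summable_imp_summable:
  fixes x :: "'i \<Rightarrow> 'a::chilbert_space"
  assumes wuc: "\<And>h F. finite F \<Longrightarrow> (\<Sum>n\<in>F. cmod (cinner h (x n))) \<le> C * norm h"
  shows "x summable_on UNIV"
proof (rule summable_on_Cauchy_blocks)
  fix e :: real assume e: "e > 0"

  define S where "S = {(norm (\<Sum>n\<in>F. scaleR (\<epsilon> n) (x n)))\<^sup>2 | F \<epsilon>. finite F \<and> (\<forall>n. \<bar>\<epsilon> n\<bar> = (1::real))}"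
  \<comment> \<open>Pairing a signed sum with itself and taking absolute values removes the signs,
    so the weak bound becomes a norm bound uniform in the signs.\<close>
  have "norm (\<Sum>n\<in>F. scaleR (\<epsilon> n) (x n)) \<le> \<bar>C\<bar>" if "finite F" "\<forall>n. \<bar>\<epsilon> n\<bar> = (1::real)" for F \<epsilon>
  proof (rule norm_le_cinnerI)
    let ?s = "\<Sum>n\<in>F. scaleR (\<epsilon> n) (x n)"
    have "cmod (cinner ?s ?s) = cmod (\<Sum>n\<in>F. of_real (\<epsilon> n) * cinner ?s (x n))"
      by (simp add: cinner_sum_right cinner_scaleR_right)
    also have "\<dots> \<le> (\<Sum>n\<in>F. cmod (of_real (\<epsilon> n) * cinner ?s (x n)))"
      by (rule norm_sum)
    also have "\<dots> = (\<Sum>n\<in>F. cmod (cinner ?s (x n)))"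
      using that by (simp add: norm_mult)
    also have "\<dots> \<le> C * norm ?s" by (rule wuc) fact
    also have "\<dots> \<le> \<bar>C\<bar> * norm ?s" by (simp add: mult_right_mono)
    finally show "cmod (cinner ?s ?s) \<le> \<bar>C\<bar> * norm ?s" .
  qed simp
  then have "z \<le> \<bar>C\<bar>\<^sup>2" if "z \<in> S" for z
    using that unfolding S_def by (blast intro: power_mono norm_ge_zero)
  then have bdd: "bdd_above S" by (rule bdd_aboveI)
  have ne: "S \<noteq> {}"
  proof -
    have "0 \<in> S" unfolding S_def by (rule CollectI, rule exI[of _ "{}"], rule exI[of _ "\<lambda>_. 1"]) simp
    then show ?thesis by auto
  qed
  have "Sup S - e\<^sup>2 < Sup S" using e by simp
  then obtain z where "z \<in> S" "Sup S - e\<^sup>2 < z"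
    using less_cSupD[OF ne] by blast
  then obtain F \<epsilon> where F: "finite F" and \<epsilon>: "\<forall>n. \<bar>\<epsilon> n\<bar> = (1::real)"
    and big: "Sup S - e\<^sup>2 < (norm (\<Sum>n\<in>F. scaleR (\<epsilon> n) (x n)))\<^sup>2"
    by (auto simp: S_def)
  let ?s = "\<Sum>n\<in>F. scaleR (\<epsilon> n) (x n)"
  show "\<exists>F. finite F \<and> (\<forall>G. finite G \<longrightarrow> G \<inter> F = {} \<longrightarrow> norm (sum x G) < e)"
  proof (intro exI[of _ F] conjI allI impI F)
    fix G assume G: "finite G" "G \<inter> F = {}"
    define \<sigma> :: real where "\<sigma> = (if 0 \<le> Re (cinner ?s (sum x G)) then 1 else - 1)"
    define \<delta> where "\<delta> n = (if n \<in> F then \<epsilon> n else \<sigma>)" for n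
    have "(\<Sum>n\<in>F \<union> G. scaleR (\<delta> n) (x n)) = ?s + scaleR \<sigma> (sum x G)"
    proof -
      have "(\<Sum>n\<in>F \<union> G. scaleR (\<delta> n) (x n)) = (\<Sum>n\<in>F. scaleR (\<delta> n) (x n)) + (\<Sum>n\<in>G. scaleR (\<delta> n) (x n))"
        using F G by (subst sum.union_disjoint) auto
      moreover have "(\<Sum>n\<in>G. scaleR (\<delta> n) (x n)) = (\<Sum>n\<in>G. scaleR \<sigma> (x n))"
        using G(2) by (intro sum.cong) (auto simp: \<delta>_def)
      ultimately show ?thesis by (simp add: \<delta>_def scaleR_sum_right)
    qed
    moreover have "(norm (\<Sum>n\<in>F \<union> G. scaleR (\<delta> n) (x n)))\<^sup>2 \<in> S"
    proof -
      have "\<forall>n. \<bar>\<delta> n\<bar> = 1" using \<epsilon> by (simp add: \<delta>_def \<sigma>_def)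
      then show ?thesis using F G unfolding S_def by blast
    qed
    ultimately have "(norm (?s + scaleR \<sigma> (sum x G)))\<^sup>2 \<le> Sup S"
      using cSup_upper[OF _ bdd] by metis
    moreover have "(norm (?s + scaleR \<sigma> (sum x G)))\<^sup>2
        = (norm ?s)\<^sup>2 + 2 * \<bar>Re (cinner ?s (sum x G))\<bar> + (norm (sum x G))\<^sup>2"
      by (simp add: norm_add_sq cinner_scaleR_right \<sigma>_def)
    ultimately have "(norm (sum x G))\<^sup>2 < e\<^sup>2" using big by simp
    then show "norm (sum x G) < e" using e by (simp add: power2_less_imp_less)
  qed
qed

section \<open>Sequence spaces\<close>

lemma znorm_le_iff: "znorm n \<le> N \<longleftrightarrow> (\<forall>k. \<bar>n $ k\<bar> \<le> N)"
  by (auto simp: znorm_def)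

lemma abs_component_le_znorm: "\<bar>n $ k\<bar> \<le> znorm n"
  using znorm_le_iff by blast

lemma znorm_nonneg [simp]: "0 \<le> znorm n"
  using abs_component_le_znorm[of n undefined] by linarith

lemma znorm_zero [simp]: "znorm 0 = 0"
  by (simp add: znorm_def)

lemma znorm_minus [simp]: "znorm (- n) = znorm n"
  by (simp add: znorm_def)

lemma znorm_triangle: "znorm (m + n) \<le> znorm m + znorm n"
  unfolding znorm_le_iff
proof
  fix k
  show "\<bar>(m + n) $ k\<bar> \<le> znorm m + znorm n"
    using abs_component_le_znorm[of m k] abs_component_le_znorm[of n k] by simp
qed

lemma finite_znorm_le: "finite {m :: int ^ 'd::finite. znorm m \<le> N}"
proof (rule finite_subset)
  show "{m :: int ^ 'd. znorm m \<le> N} \<subseteq> (\<lambda>g. \<chi> k. g k) ` (PiE UNIV (\<lambda>_. {- N..N}))"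
  proof
    fix m :: "int ^ 'd" assume "m \<in> {m. znorm m \<le> N}"
    then have "\<forall>k. \<bar>m $ k\<bar> \<le> N" by (simp add: znorm_le_iff)
    then have "($) m \<in> PiE UNIV (\<lambda>_. {- N..N})" by (auto simp: abs_le_iff minus_le_iff)
    then show "m \<in> (\<lambda>g. \<chi> k. g k) ` (PiE UNIV (\<lambda>_. {- N..N}))"
      by (rule rev_image_eqI) simp
  qed
  show "finite ((\<lambda>g. \<chi> k. g k) ` (PiE (UNIV :: 'd set) (\<lambda>_. {- N..N})))"
    by (intro finite_imageI finite_PiE) auto
qed

lemma lp_index_cases:
  assumes "q \<in> lp_index"
  obtains (zero) "q = 0" | (infty) "q = \<infinity>" | (finite) p where "q = ereal p" "1 \<le> p"
  using assms by (cases q) (auto simp: lp_index_def)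

lemma lp_index_simps [simp]: "0 \<in> lp_index" "1 \<in> lp_index" "\<infinity> \<in> lp_index"
  by (auto simp: lp_index_def)

lemma lp_index_ereal [simp]: "1 \<le> p \<Longrightarrow> ereal p \<in> lp_index"
  by (auto simp: lp_index_def)

lemma lp_infty_iff: "f \<in> lp \<infinity> \<longleftrightarrow> bounded (range f)"
  by (simp add: lp_def)

lemma lp_ereal_iff: "1 \<le> p \<Longrightarrow> f \<in> lp (ereal p) \<longleftrightarrow> (\<lambda>m. norm (f m) powr p) summable_on UNIV"
  by (simp add: lp_def zero_ereal_def)

lemma lp_norm_sup: "q = 0 \<or> q = \<infinity> \<Longrightarrow> lp_norm q f = (SUP m. norm (f m))"
  by (auto simp: lp_norm_def)

lemma lp_norm_zero_eq: "lp_norm 0 f = lp_norm \<infinity> f"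
  by (simp add: lp_norm_def)

lemma lp_norm_ereal: "1 \<le> p \<Longrightarrow> lp_norm (ereal p) f = (\<Sum>\<^sub>\<infinity>m. norm (f m) powr p) powr (1 / p)"
  by (simp add: lp_norm_def zero_ereal_def)

text \<open>Balls of \<open>znorm\<close> are finite, so vanishing at infinity amounts to finite
  level sets. In this form boundedness is automatic and the filter at infinity no longer
  appears.\<close>

lemma lp_zero_iff:
  fixes f :: "int ^ 'd::finite \<Rightarrow> 'a::real_normed_vector"
  shows "f \<in> lp 0 \<longleftrightarrow> (\<forall>e>0. finite {m. e \<le> norm (f m)})"
proof
  assume "f \<in> lp 0"
  then have *: "((\<lambda>m. norm (f m)) \<longlongrightarrow> 0) (filtercomap znorm at_top)" by (simp add: lp_def)
  show "\<forall>e>0. finite {m. e \<le> norm (f m)}"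
  proof (intro allI impI)
    fix e :: real assume "0 < e"
    then have "eventually (\<lambda>m. norm (f m) < e) (filtercomap znorm at_top)"
      using tendstoD[OF *, of e] by simp
    then obtain N where "\<And>m. N \<le> znorm m \<Longrightarrow> norm (f m) < e"
      unfolding eventually_filtercomap eventually_at_top_linorder by blast
    then have "{m. e \<le> norm (f m)} \<subseteq> {m. znorm m \<le> N}"
      by (smt (verit) Collect_mono)
    then show "finite {m. e \<le> norm (f m)}"
      by (rule finite_subset) (rule finite_znorm_le)
  qed
next
  assume *: "\<forall>e>0. finite {m. e \<le> norm (f m)}"
  have "bounded (range f)"
  proof -
    have "range f \<subseteq> f ` {m. 1 \<le> norm (f m)} \<union> ball 0 1" by force
    moreover have "bounded (f ` {m. 1 \<le> norm (f m)})"
      using * by (simp add: finite_imp_bounded)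
    ultimately show ?thesis by (meson bounded_Un bounded_ball bounded_subset)
  qed
  moreover have "((\<lambda>m. norm (f m)) \<longlongrightarrow> 0) (filtercomap znorm at_top)"
  proof (rule tendstoI)
    fix e :: real assume "0 < e"
    then have fin: "finite {m. e \<le> norm (f m)}" using * by simp
    \<comment> \<open>The inserted 0 covers an empty level set; the 1 puts every point of the level
      set strictly below \<open>N\<close>.\<close>
    define N where "N = Max (insert 0 (znorm ` {m. e \<le> norm (f m)})) + 1"
    have "norm (f m) < e" if "N \<le> znorm m" for m
    proof (rule ccontr)
      assume "\<not> norm (f m) < e"
      then have "znorm m \<le> N - 1" using fin by (auto simp: N_def intro!: Max_ge)
      with that show False by simp
    qed
    then show "eventually (\<lambda>m. dist (norm (f m)) 0 < e) (filtercomap znorm at_top)"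
      unfolding eventually_filtercomap eventually_at_top_linorder by auto
  qed
  ultimately show "f \<in> lp 0" by (simp add: lp_def)
qed

lemma lp_zero_finite: "f \<in> lp 0 \<Longrightarrow> 0 < e \<Longrightarrow> finite {m. e \<le> norm (f m)}"
  by (simp add: lp_zero_iff)

lemma lp_zero_imp_infty: "f \<in> lp 0 \<Longrightarrow> f \<in> lp \<infinity>"
  by (simp add: lp_def)

lemma lp_sup_bdd: "f \<in> lp \<infinity> \<Longrightarrow> bdd_above (range (\<lambda>m. norm (f m)))"
  by (auto simp: lp_infty_iff bounded_iff bdd_above_def)

lemma lp_sup_boundI:
  assumes "\<And>m. norm (f m) \<le> C"
  shows "f \<in> lp \<infinity>" "q = 0 \<or> q = \<infinity> \<Longrightarrow> lp_norm q f \<le> C"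
  using assms by (auto simp: lp_infty_iff bounded_iff lp_norm_sup intro!: cSUP_least)

lemma lp_norm_infty_ge: "f \<in> lp \<infinity> \<Longrightarrow> norm (f m) \<le> lp_norm \<infinity> f"
  unfolding lp_norm_sup[OF disjI2[OF refl]] by (rule cSUP_upper[OF UNIV_I lp_sup_bdd])

lemma lp_norm_nonneg:
  assumes "f \<in> lp q" "q \<in> lp_index"
  shows "0 \<le> lp_norm q f"
proof -
  have "0 \<le> lp_norm \<infinity> f" if "f \<in> lp \<infinity>"
    using lp_norm_infty_ge[OF that, of undefined] norm_ge_zero[of "f undefined"] by linarith
  note infty = this
  show ?thesis using assms(2,1)
    by (cases rule: lp_index_cases)
      (auto simp: lp_norm_zero_eq lp_zero_imp_infty lp_norm_ereal infty)
qed

text \<open>Finite partial sums carry all the information about a nonnegative series, so one uniform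
  bound gives membership and the norm estimate together. Norm bounds at finite exponents below are
  proved in this form.\<close>

lemma lp_ereal_boundI:
  assumes p: "1 \<le> p" and C: "0 \<le> C"
    and le: "\<And>F. finite F \<Longrightarrow> (\<Sum>m\<in>F. norm (f m) powr p) \<le> C powr p"
  shows "f \<in> lp (ereal p)" "lp_norm (ereal p) f \<le> C"
proof -
  have s: "(\<lambda>m. norm (f m) powr p) summable_on UNIV"
    by (rule nonneg_bdd_above_summable_on) (auto intro!: bdd_aboveI2 le)
  then show "f \<in> lp (ereal p)" by (simp add: lp_ereal_iff p)
  have "(\<Sum>\<^sub>\<infinity>m. norm (f m) powr p) \<le> C powr p"
    by (rule infsum_le_finite_sums[OF s]) (simp add: le)
  then have "(\<Sum>\<^sub>\<infinity>m. norm (f m) powr p) powr (1 / p) \<le> (C powr p) powr (1 / p)"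
    using p by (intro powr_mono2) (auto intro!: infsum_nonneg)
  also have "\<dots> = C" using p C by (simp add: powr_powr)
  finally show "lp_norm (ereal p) f \<le> C" by (simp add: lp_norm_ereal p)
qed

lemma lp_norm_ereal_powr:
  assumes p: "1 \<le> p"
  shows "lp_norm (ereal p) f powr p = (\<Sum>\<^sub>\<infinity>m. norm (f m) powr p)"
proof -
  have "0 \<le> (\<Sum>\<^sub>\<infinity>m. norm (f m) powr p)" by (auto intro!: infsum_nonneg)
  then show ?thesis using p by (simp add: lp_norm_ereal powr_powr)
qed

lemma lp_ereal_sum_le:
  assumes p: "1 \<le> p" and f: "f \<in> lp (ereal p)" and F: "finite F"
  shows "(\<Sum>m\<in>F. norm (f m) powr p) \<le> lp_norm (ereal p) f powr p"
proof -
  have "(\<Sum>m\<in>F. norm (f m) powr p) \<le> (\<Sum>\<^sub>\<infinity>m. norm (f m) powr p)"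
    using f F p by (intro finite_sum_le_infsum) (auto simp: lp_ereal_iff)
  then show ?thesis using lp_norm_ereal_powr[OF p, of f] by simp
qed

lemma lp_one_iff: "f \<in> lp 1 \<longleftrightarrow> (\<lambda>m. norm (f m)) summable_on UNIV"
  using lp_ereal_iff[of 1 f] by (simp add: one_ereal_def)

lemma lp_norm_one: "lp_norm 1 f = (\<Sum>\<^sub>\<infinity>m. norm (f m))"
  using lp_norm_ereal[of 1 f] infsum_nonneg[of UNIV "\<lambda>m. norm (f m)"] by (simp add: one_ereal_def)

lemma lp_norm_ge:
  assumes "q \<in> lp_index" "f \<in> lp q"
  shows "norm (f m) \<le> lp_norm q f"
  using assms
proof (cases rule: lp_index_cases)
  case (finite p)
  have "norm (f m) powr p \<le> lp_norm q f powr p"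
    using lp_ereal_sum_le[of p f "{m}"] assms finite by simp
  then show ?thesis
    using powr_less_mono2[of p "lp_norm q f" "norm (f m)"] finite lp_norm_nonneg[of f q] assms
    by (meson linorder_not_le less_le_trans zero_less_one)
qed (auto simp: lp_norm_zero_eq lp_zero_imp_infty lp_norm_infty_ge)

lemma lp_imp_infty: "q \<in> lp_index \<Longrightarrow> f \<in> lp q \<Longrightarrow> f \<in> lp \<infinity>"
  using lp_norm_ge by (rule lp_sup_boundI(1))

lemma lp_norm_infty_le: "q \<in> lp_index \<Longrightarrow> f \<in> lp q \<Longrightarrow> lp_norm \<infinity> f \<le> lp_norm q f"
  using lp_norm_ge by (rule lp_sup_boundI(2)) auto

text \<open>Chebyshev: at most ||f||^p / e^p entries have norm at least e. A constant sequence shows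
  why the index must not be \<infinity>.\<close>

lemma lp_imp_zero:
  assumes "q \<in> lp_index" "q \<noteq> \<infinity>" "f \<in> lp q"
  shows "f \<in> lp 0"
  using assms
proof (cases rule: lp_index_cases)
  case (finite p)
  show ?thesis unfolding lp_zero_iff
  proof (intro allI impI)
    fix e :: real assume e: "0 < e"
    define S where "S = {m. e \<le> norm (f m)}"
    have "card G \<le> nat \<lceil>lp_norm q f powr p / e powr p\<rceil>" if G: "G \<subseteq> S" "finite G" for G
    proof -
      have "real (card G) * e powr p = (\<Sum>m\<in>G. e powr p)" by simp
      also have "\<dots> \<le> (\<Sum>m\<in>G. norm (f m) powr p)"
        using G e finite by (intro sum_mono powr_mono2) (auto simp: S_def)
      also have "\<dots> \<le> lp_norm q f powr p"
        using lp_ereal_sum_le[of p f G] assms finite G by simp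
      finally have "real (card G) \<le> lp_norm q f powr p / e powr p"
        using e by (simp add: field_simps)
      then show ?thesis by linarith
    qed
    then show "finite {m. e \<le> norm (f m)}"
      unfolding S_def[symmetric] using finite_if_finite_subsets_card_bdd[of S] by blast
  qed
qed auto

section \<open>Solidity, Minkowski's inequality and finite sums\<close>

lemma lp_norm_cong:
  fixes f :: "int ^ 'd::finite \<Rightarrow> 'a::real_normed_vector"
    and g :: "int ^ 'd::finite \<Rightarrow> 'b::real_normed_vector"
  assumes "\<And>m. norm (f m) = norm (g m)"
  shows "f \<in> lp q \<longleftrightarrow> g \<in> lp q" "lp_norm q f = lp_norm q g"
proof -
  have "bounded (range f) \<longleftrightarrow> bounded (range g)"
    using assms by (simp add: bounded_iff)
  then show "f \<in> lp q \<longleftrightarrow> g \<in> lp q" "lp_norm q f = lp_norm q g"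
    using assms by (auto simp: lp_def lp_norm_def)
qed

lemma lp_scale_le:
  fixes f :: "int ^ 'd::finite \<Rightarrow> 'a::real_normed_vector"
    and g :: "int ^ 'd::finite \<Rightarrow> 'b::real_normed_vector"
  assumes q: "q \<in> lp_index" and f: "f \<in> lp q" and c: "0 \<le> c"
    and le: "\<And>m. norm (g m) \<le> c * norm (f m)"
  shows "g \<in> lp q" "lp_norm q g \<le> c * lp_norm q f"
proof -
  have le': "norm (g m) \<le> c * lp_norm q f" for m
    using le[of m] mult_left_mono[OF lp_norm_ge[OF q f, of m] c] by simp
  have "g \<in> lp q \<and> lp_norm q g \<le> c * lp_norm q f"
    using q
  proof (cases rule: lp_index_cases)
    case zero
    have "g \<in> lp 0" unfolding lp_zero_iff
    proof (intro allI impI)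
      fix e :: real assume e: "0 < e"
      \<comment> \<open>Dividing by c + 1 instead of c covers the case c = 0.\<close>
      have "e / (c + 1) \<le> norm (f m)" if "e \<le> norm (g m)" for m
      proof -
        have "e \<le> (c + 1) * norm (f m)"
          using that le[of m] norm_ge_zero[of "f m"] unfolding distrib_right by linarith
        then show ?thesis using c by (simp add: field_simps)
      qed
      moreover have "finite {m. e / (c + 1) \<le> norm (f m)}"
        using f zero e c by (simp add: lp_zero_iff)
      ultimately show "finite {m. e \<le> norm (g m)}"
        by (auto elim!: rev_finite_subset)
    qed
    with lp_sup_boundI(2)[OF le', of q] zero show ?thesis by simp
  next
    case infty
    with lp_sup_boundI[of g, OF le'] show ?thesis by simp
  next
    case (finite p)
    have "(\<Sum>m\<in>F. norm (g m) powr p) \<le> (c * lp_norm q f) powr p" if "finite F" for F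
    proof -
      have "(\<Sum>m\<in>F. norm (g m) powr p) \<le> (\<Sum>m\<in>F. c powr p * norm (f m) powr p)"
      proof (rule sum_mono)
        fix m
        have "norm (g m) powr p \<le> (c * norm (f m)) powr p"
          using finite le by (intro powr_mono2) auto
        then show "norm (g m) powr p \<le> c powr p * norm (f m) powr p"
          using c by (simp add: powr_mult)
      qed
      also have "\<dots> \<le> c powr p * lp_norm q f powr p"
        using lp_ereal_sum_le[of p f F] f finite that
        by (simp add: sum_distrib_left[symmetric] mult_left_mono)
      finally show ?thesis using c lp_norm_nonneg[OF f q] by (simp add: powr_mult)
    qed
    then show ?thesis
      using lp_ereal_boundI[of p "c * lp_norm q f" g] finite lp_norm_nonneg[OF f q] c by simp
  qed
  then show "g \<in> lp q" "lp_norm q g \<le> c * lp_norm q f" by auto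
qed

lemma lp_solid:
  fixes f :: "int ^ 'd::finite \<Rightarrow> 'a::real_normed_vector"
    and g :: "int ^ 'd::finite \<Rightarrow> 'b::real_normed_vector"
  assumes q: "q \<in> lp_index" and g: "g \<in> lp q" and le: "\<And>m. norm (f m) \<le> norm (g m)"
  shows "f \<in> lp q" "lp_norm q f \<le> lp_norm q g"
  using lp_scale_le[OF q g, of 1 f] le by auto

text \<open>Convexity of t^p with zero endpoints included. If one point is 0, only one term is left
  and u^p <= u for 0 < u <= 1 settles it.\<close>

lemma powr_convex_combination:
  fixes x y u v p :: real
  assumes "1 \<le> p" "0 \<le> x" "0 \<le> y" "0 < u" "0 < v" "u + v = 1"
  shows "(u * x + v * y) powr p \<le> u * x powr p + v * y powr p"
proof -
  have le: "t powr p \<le> t" if "0 < t" "t \<le> 1" for t :: real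
    using powr_mono'[of 1 p t] that assms(1) by simp
  consider "x = 0" | "y = 0" | "0 < x" "0 < y" using assms by fastforce
  then show ?thesis
  proof cases
    case 1
    have "(v * y) powr p = v powr p * y powr p" using assms by (simp add: powr_mult)
    also have "\<dots> \<le> v * y powr p" using le[of v] assms by (intro mult_right_mono) auto
    finally show ?thesis using 1 assms by simp
  next
    case 2
    have "(u * x) powr p = u powr p * x powr p" using assms by (simp add: powr_mult)
    also have "\<dots> \<le> u * x powr p" using le[of u] assms by (intro mult_right_mono) auto
    finally show ?thesis using 2 assms by simp
  next
    case 3
    have u: "u = 1 - v" using assms by simp
    show ?thesis
      using convex_onD[OF powr_convex[OF assms(1)], of v x y] assms(1,5) \<open>0 < u\<close> 3 unfolding u by simp
  qed
qed

text \<open>Minkowski at finite p: with a and b the two norms, f + g is a + b times the convex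
  combination of f/a and g/b with weights a/(a+b) and b/(a+b), and convexity of t^p bounds its p-th
  powers. A vanishing norm is treated apart because it cannot be divided by.\<close>

lemma lp_add:
  fixes f g :: "int ^ 'd::finite \<Rightarrow> 'a::real_normed_vector"
  assumes q: "q \<in> lp_index" and f: "f \<in> lp q" and g: "g \<in> lp q"
  shows "(\<lambda>m. f m + g m) \<in> lp q" "lp_norm q (\<lambda>m. f m + g m) \<le> lp_norm q f + lp_norm q g"
proof -
  let ?h = "\<lambda>m. f m + g m"
  have le': "norm (?h m) \<le> lp_norm q f + lp_norm q g" for m
    using norm_triangle_ineq[of "f m" "g m"] lp_norm_ge[OF q f, of m] lp_norm_ge[OF q g, of m] by linarith
  have "?h \<in> lp q \<and> lp_norm q ?h \<le> lp_norm q f + lp_norm q g"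
    using q
  proof (cases rule: lp_index_cases)
    case zero
    have "?h \<in> lp 0" unfolding lp_zero_iff
    proof (intro allI impI)
      fix e :: real assume "0 < e"
      then have "finite ({m. e/2 \<le> norm (f m)} \<union> {m. e/2 \<le> norm (g m)})"
        using f g zero by (intro finite_UnI lp_zero_finite) auto
      then show "finite {m. e \<le> norm (?h m)}"
      proof (rule rev_finite_subset, safe)
        fix m assume "e \<le> norm (f m + g m)" "\<not> e / 2 \<le> norm (g m)"
        then show "e / 2 \<le> norm (f m)" using norm_triangle_ineq[of "f m" "g m"] by linarith
      qed
    qed
    with lp_sup_boundI(2)[OF le', of q] zero show ?thesis by simp
  next
    case infty
    with lp_sup_boundI[of ?h, OF le'] show ?thesis by simp
  next
    case (finite p)
    define a where "a = lp_norm q f"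
    define b where "b = lp_norm q g"
    have ab: "0 \<le> a" "0 \<le> b" using lp_norm_nonneg q f g by (auto simp: a_def b_def)
    show ?thesis
    proof (cases "a = 0 \<or> b = 0")
      case True
      then show ?thesis
      proof
        assume a: "a = 0"
        then have "f m = 0" for m using lp_norm_ge[OF q f, of m] by (simp add: a_def)
        then show ?thesis using g a by (simp add: a_def)
      next
        assume b: "b = 0"
        then have "g m = 0" for m using lp_norm_ge[OF q g, of m] by (simp add: b_def)
        then show ?thesis using f b by (simp add: b_def)
      qed
    next
      case False
      then have pos: "0 < a" "0 < b" using ab by auto
      define s where "s = a + b"
      have s: "0 < s" using pos by (simp add: s_def)
      have pt: "norm (?h m) powr p \<le> s powr p * (a/s * (norm (f m) powr p / a powr p)
          + b/s * (norm (g m) powr p / b powr p))" for m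
      proof -
        have "norm (?h m) \<le> s * (a/s * (norm (f m) / a) + b/s * (norm (g m) / b))"
        proof -
          have "s * (a/s * (norm (f m) / a) + b/s * (norm (g m) / b)) = norm (f m) + norm (g m)"
            using pos s by (simp add: distrib_left)
          then show ?thesis using norm_triangle_ineq[of "f m" "g m"] by simp
        qed
        then have "norm (?h m) powr p \<le> (s * (a/s * (norm (f m) / a) + b/s * (norm (g m) / b))) powr p"
          using finite by (intro powr_mono2) auto
        also have "\<dots> = s powr p * (a/s * (norm (f m) / a) + b/s * (norm (g m) / b)) powr p"
          by (rule powr_mult)
        also have "\<dots> \<le> s powr p * (a/s * (norm (f m) / a) powr p + b/s * (norm (g m) / b) powr p)"
          using s pos finite
          by (intro mult_left_mono powr_convex_combination)
            (auto simp: s_def add_divide_distrib[symmetric])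
        also have "(norm (f m) / a) powr p = norm (f m) powr p / a powr p"
          by (rule powr_divide)
        also have "(norm (g m) / b) powr p = norm (g m) powr p / b powr p"
          by (rule powr_divide)
        finally show ?thesis .
      qed
      have "(\<Sum>m\<in>F. norm (?h m) powr p) \<le> (lp_norm q f + lp_norm q g) powr p" if F: "finite F" for F
      proof -
        have "(\<Sum>m\<in>F. norm (?h m) powr p) \<le> (\<Sum>m\<in>F. s powr p * (a/s * (norm (f m) powr p / a powr p)
          + b/s * (norm (g m) powr p / b powr p)))"
          by (rule sum_mono) (rule pt)
        also have "\<dots> = s powr p * (a/s * ((\<Sum>m\<in>F. norm (f m) powr p) / a powr p)
          + b/s * ((\<Sum>m\<in>F. norm (g m) powr p) / b powr p))"
          by (simp add: sum_distrib_left sum.distrib sum_divide_distrib distrib_left)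
        also have "\<dots> \<le> s powr p * (a/s * 1 + b/s * 1)"
        proof (intro mult_left_mono add_mono)
          show "(\<Sum>m\<in>F. norm (f m) powr p) / a powr p \<le> 1"
            using lp_ereal_sum_le[of p f F] f finite F pos by (simp add: a_def)
          show "(\<Sum>m\<in>F. norm (g m) powr p) / b powr p \<le> 1"
            using lp_ereal_sum_le[of p g F] g finite F pos by (simp add: b_def)
        qed (use pos s in auto)
        also have "\<dots> = s powr p" using s by (simp add: s_def add_divide_distrib[symmetric])
        finally show ?thesis by (simp add: s_def a_def b_def)
      qed
      then show ?thesis
        using lp_ereal_boundI[of p "lp_norm q f + lp_norm q g" ?h] finite ab by (simp add: a_def b_def)
    qed
  qed
  then show "?h \<in> lp q" "lp_norm q ?h \<le> lp_norm q f + lp_norm q g" by auto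
qed

lemma lp_const_zero:
  assumes q: "q \<in> lp_index"
  shows "(\<lambda>_. 0 :: 'a::real_normed_vector) \<in> lp q" "lp_norm q (\<lambda>_. 0 :: 'a) = 0"
proof -
  have "(\<lambda>_. 0 :: 'a) \<in> lp q \<and> lp_norm q (\<lambda>_. 0 :: 'a) = 0" using q
    by (cases rule: lp_index_cases)
       (auto simp: lp_zero_iff lp_norm_sup lp_ereal_iff lp_norm_ereal lp_infty_iff)
  then show "(\<lambda>_. 0 :: 'a) \<in> lp q" "lp_norm q (\<lambda>_. 0 :: 'a) = 0" by auto
qed

lemma lp_scaleC:
  fixes f :: "int ^ 'd::finite \<Rightarrow> 'a::chilbert_space"
  assumes q: "q \<in> lp_index" and f: "f \<in> lp q"
  shows "(\<lambda>m. scaleC c (f m)) \<in> lp q" "lp_norm q (\<lambda>m. scaleC c (f m)) = cmod c * lp_norm q f"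
proof -
  have 1: "(\<lambda>m. scaleC c (f m)) \<in> lp q" "lp_norm q (\<lambda>m. scaleC c (f m)) \<le> cmod c * lp_norm q f"
    using lp_scale_le[OF q f, of "cmod c" "\<lambda>m. scaleC c (f m)"] by (auto simp: norm_scaleC)
  show "(\<lambda>m. scaleC c (f m)) \<in> lp q" by fact
  show "lp_norm q (\<lambda>m. scaleC c (f m)) = cmod c * lp_norm q f"
  proof (cases "c = 0")
    case True
    then show ?thesis by (simp add: lp_const_zero q)
  next
    case False
    have "lp_norm q f \<le> (1 / cmod c) * lp_norm q (\<lambda>m. scaleC c (f m))"
      by (rule lp_scale_le(2)[OF q 1(1)]) (use False in \<open>auto simp: norm_scaleC\<close>)
    then show ?thesis using 1(2) False by (simp add: field_simps)
  qed
qed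

lemma lp_minus:
  fixes f :: "int ^ 'd::finite \<Rightarrow> 'a::real_normed_vector"
  shows "(\<lambda>m. - f m) \<in> lp q \<longleftrightarrow> f \<in> lp q" "lp_norm q (\<lambda>m. - f m) = lp_norm q f"
  by (rule lp_norm_cong; simp)+

lemma lp_diff:
  fixes f g :: "int ^ 'd::finite \<Rightarrow> 'a::real_normed_vector"
  assumes q: "q \<in> lp_index" and f: "f \<in> lp q" and g: "g \<in> lp q"
  shows "(\<lambda>m. f m - g m) \<in> lp q" "lp_norm q (\<lambda>m. f m - g m) \<le> lp_norm q f + lp_norm q g"
  using lp_add[OF q f, of "\<lambda>m. - g m"] g by (simp_all add: lp_minus)

lemma lp_sum:
  fixes f :: "'i \<Rightarrow> int ^ 'd::finite \<Rightarrow> 'a::real_normed_vector"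
  assumes q: "q \<in> lp_index" and "finite F" and "\<And>i. i \<in> F \<Longrightarrow> f i \<in> lp q"
  shows "(\<lambda>m. \<Sum>i\<in>F. f i m) \<in> lp q \<and> lp_norm q (\<lambda>m. \<Sum>i\<in>F. f i m) \<le> (\<Sum>i\<in>F. lp_norm q (f i))"
  using assms(2,3)
proof (induction F)
  case empty
  then show ?case by (simp add: lp_const_zero q)
next
  case (insert i F)
  then have "(\<lambda>m. \<Sum>i\<in>F. f i m) \<in> lp q" "lp_norm q (\<lambda>m. \<Sum>i\<in>F. f i m) \<le> (\<Sum>i\<in>F. lp_norm q (f i))"
    and "f i \<in> lp q" by auto
  with lp_add[OF q, of "f i" "\<lambda>m. \<Sum>i\<in>F. f i m"] show ?case using insert by auto
qed

section \<open>Finitely supported sequences and their density\<close>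

definition trunc :: "'i set \<Rightarrow> ('i \<Rightarrow> 'a::zero) \<Rightarrow> 'i \<Rightarrow> 'a"
  where "trunc F f = (\<lambda>m. if m \<in> F then f m else 0)"

definition single :: "'i \<Rightarrow> 'a::zero \<Rightarrow> 'i \<Rightarrow> 'a"
  where "single n h = (\<lambda>m. if m = n then h else 0)"

lemma lp_one_finite_support:
  assumes "finite F" "\<And>m. m \<notin> F \<Longrightarrow> f m = 0"
  shows "f \<in> lp 1" "lp_norm 1 f = (\<Sum>m\<in>F. norm (f m))"
proof -
  have "((\<lambda>m. norm (f m)) has_sum (\<Sum>m\<in>F. norm (f m))) UNIV"
    using assms by (intro has_sum_finite_neutralI[where B = F]) auto
  then show "f \<in> lp 1" "lp_norm 1 f = (\<Sum>m\<in>F. norm (f m))"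
    by (auto simp: lp_one_iff lp_norm_one has_sum_imp_summable infsumI)
qed

text \<open>Split |f_m|^p = |f_m| |f_m|^(p-1) and bound the second factor by the power p - 1 of the
  l^1 norm; this gives the embedding with constant 1 at every index.\<close>

lemma lp_one_imp:
  fixes f :: "int ^ 'd::finite \<Rightarrow> 'a::real_normed_vector"
  assumes q: "q \<in> lp_index" and f: "f \<in> lp 1"
  shows "f \<in> lp q" "lp_norm q f \<le> lp_norm 1 f"
proof -
  have nn: "0 \<le> lp_norm 1 f" using f by (simp add: lp_norm_nonneg)
  have le: "norm (f m) \<le> lp_norm 1 f" for m by (rule lp_norm_ge) (use f in auto)
  have "f \<in> lp q \<and> lp_norm q f \<le> lp_norm 1 f"
    using q
  proof (cases rule: lp_index_cases)
    case zero
    with lp_imp_zero[OF _ _ f] lp_sup_boundI(2)[OF le, of q] show ?thesis by simp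
  next
    case infty
    with lp_sup_boundI[of f, OF le] show ?thesis by simp
  next
    case (finite p)
    have "(\<Sum>m\<in>F. norm (f m) powr p) \<le> lp_norm 1 f powr p" if F: "finite F" for F
    proof (cases "lp_norm 1 f = 0")
      case True
      then have "f m = 0" for m using le[of m] by simp
      then show ?thesis by simp
    next
      case False
      define C where "C = lp_norm 1 f"
      have C: "0 < C" using False nn by (simp add: C_def)
      have "(\<Sum>m\<in>F. norm (f m) powr p) \<le> (\<Sum>m\<in>F. norm (f m) * C powr (p - 1))"
      proof (rule sum_mono)
        fix m
        have "norm (f m) powr p = norm (f m) * norm (f m) powr (p - 1)"
          using finite by (cases "f m = 0") (auto simp: powr_diff)
        also have "\<dots> \<le> norm (f m) * C powr (p - 1)"
          using finite le[of m] by (intro mult_left_mono powr_mono2) (auto simp: C_def)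
        finally show "norm (f m) powr p \<le> norm (f m) * C powr (p - 1)" .
      qed
      also have "\<dots> \<le> C * C powr (p - 1)"
        using lp_ereal_sum_le[of 1 f F] f F nn
        by (simp add: sum_distrib_right[symmetric] mult_right_mono C_def one_ereal_def)
      also have "\<dots> = C powr p" using C by (simp add: powr_diff)
      finally show ?thesis by (simp add: C_def)
    qed
    then show ?thesis using lp_ereal_boundI[of p "lp_norm 1 f" f] finite nn by simp
  qed
  then show "f \<in> lp q" "lp_norm q f \<le> lp_norm 1 f" by auto
qed

lemma single_lp:
  fixes h :: "'a::real_normed_vector"
  assumes q: "q \<in> lp_index"
  shows "single n h \<in> lp q" "lp_norm q (single n h) = norm h"
proof -
  have 1: "single n h \<in> lp 1" "lp_norm 1 (single n h) = norm h"
    using lp_one_finite_support[of "{n}" "single n h"] by (auto simp: single_def)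
  show *: "single n h \<in> lp q" using lp_one_imp[OF q 1(1)] by simp
  show "lp_norm q (single n h) = norm h"
    using lp_one_imp(2)[OF q 1(1)] lp_norm_ge[OF q *, of n] 1(2) by (simp add: single_def)
qed

lemma trunc_lp_one: "finite F \<Longrightarrow> trunc F f \<in> lp 1"
  by (rule lp_one_finite_support[of F]) (auto simp: trunc_def)

lemma trunc_lp:
  "q \<in> lp_index \<Longrightarrow> f \<in> lp q \<Longrightarrow> trunc F f \<in> lp q"
  "q \<in> lp_index \<Longrightarrow> f \<in> lp q \<Longrightarrow> lp_norm q (trunc F f) \<le> lp_norm q f"
  using lp_solid[of q f "trunc F f"] by (auto simp: trunc_def)

lemma trunc_eq_sum: "finite F \<Longrightarrow> trunc F f = (\<lambda>m. \<Sum>n\<in>F. single n (f n) m)"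
  by (rule ext) (simp add: trunc_def single_def)

lemma trunc_tendsto:
  fixes f :: "int ^ 'd::finite \<Rightarrow> 'a::real_normed_vector"
  assumes q: "q \<in> lp_index" "q \<noteq> \<infinity>" and f: "f \<in> lp q"
  shows "((\<lambda>F. lp_norm q (\<lambda>m. trunc F f m - f m)) \<longlongrightarrow> 0) (finite_subsets_at_top UNIV)"
proof (rule tendstoI)
  fix e :: real assume e: "0 < e"
  have d: "(\<lambda>m. trunc F f m - f m) \<in> lp q" for F
    by (rule lp_diff[OF q(1) trunc_lp(1)[OF q(1) f] f])
  \<comment> \<open>Suprema and partial sums only yield weak inequalities, so the estimates are made
    with e/2.\<close>
  have half: "x < e" if "x \<le> e/2" for x using that e by linarith
  have "\<exists>F0. finite F0 \<and> (\<forall>F. finite F \<and> F0 \<subseteq> F \<longrightarrow> lp_norm q (\<lambda>m. trunc F f m - f m) < e)"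
    using q(1)
  proof (cases rule: lp_index_cases)
    case zero
    define F0 where "F0 = {m. e/2 \<le> norm (f m)}"
    have "finite F0" unfolding F0_def using f zero e by (intro lp_zero_finite) auto
    moreover have "norm (f m) \<le> e/2" if "m \<notin> F0" for m using that by (simp add: F0_def)
    moreover have "lp_norm q (\<lambda>m. trunc F f m - f m) \<le> e/2" if "F0 \<subseteq> F" for F
      by (rule lp_sup_boundI(2)) (use that zero e calculation in \<open>auto simp: trunc_def\<close>)
    ultimately show ?thesis using half by blast
  next
    case infty
    with q show ?thesis by simp
  next
    case (finite p)
    have s: "(\<lambda>m. norm (f m) powr p) summable_on UNIV"
      using f finite by (simp add: lp_ereal_iff)
    then obtain F0 where F0: "finite F0"
      "dist (\<Sum>m\<in>F0. norm (f m) powr p) (\<Sum>\<^sub>\<infinity>m. norm (f m) powr p) \<le> (e/2) powr p"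
      using infsum_finite_approximation[OF s, of "(e/2) powr p"] e by auto
    have "lp_norm q (\<lambda>m. trunc F f m - f m) \<le> e/2" if F: "finite F" "F0 \<subseteq> F" for F
      unfolding finite(1)
    proof (rule lp_ereal_boundI)
      fix G :: "(int ^ 'd) set" assume G: "finite G"
      have "(\<Sum>m\<in>G. norm (trunc F f m - f m) powr p) = (\<Sum>m\<in>G - F. norm (f m) powr p)"
        using G by (intro sum.mono_neutral_cong_right) (auto simp: trunc_def)
      also have "\<dots> \<le> (\<Sum>\<^sub>\<infinity>m. norm (f m) powr p) - (\<Sum>m\<in>F0. norm (f m) powr p)"
      proof -
        have "(\<Sum>m\<in>G - F. norm (f m) powr p) + (\<Sum>m\<in>F0. norm (f m) powr p)
            = (\<Sum>m\<in>(G - F) \<union> F0. norm (f m) powr p)"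
          using F F0 G by (intro sum.union_disjoint[symmetric]) auto
        also have "\<dots> \<le> (\<Sum>\<^sub>\<infinity>m. norm (f m) powr p)"
          using F0 G by (intro finite_sum_le_infsum s) auto
        finally show ?thesis by simp
      qed
      also have "\<dots> \<le> (e/2) powr p" using F0(2) by (simp add: dist_real_def)
      finally show "(\<Sum>m\<in>G. norm (trunc F f m - f m) powr p) \<le> (e/2) powr p" .
    qed (use finite e in auto)
    then show ?thesis using F0(1) half by blast
  qed
  then show "eventually (\<lambda>F. dist (lp_norm q (\<lambda>m. trunc F f m - f m)) 0 < e) (finite_subsets_at_top UNIV)"
    unfolding eventually_finite_subsets_at_top
    using lp_norm_nonneg[OF d q(1)] by (simp add: dist_real_def)
qed

lemma trunc_approx:
  assumes "q \<in> lp_index" "q \<noteq> \<infinity>" "f \<in> lp q" "0 < e"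
  obtains F where "finite F" "lp_norm q (\<lambda>m. f m - trunc F f m) < e"
proof -
  have "eventually (\<lambda>F. dist (lp_norm q (\<lambda>m. trunc F f m - f m)) 0 < e) (finite_subsets_at_top UNIV)"
    using tendstoD[OF trunc_tendsto[OF assms(1-3)] assms(4)] .
  then obtain F where F: "finite F" "\<bar>lp_norm q (\<lambda>m. trunc F f m - f m)\<bar> < e"
    unfolding eventually_finite_subsets_at_top by (auto simp: dist_real_def)
  moreover have "lp_norm q (\<lambda>m. trunc F f m - f m) = lp_norm q (\<lambda>m. f m - trunc F f m)"
    by (rule lp_norm_cong) (simp add: norm_minus_commute)
  ultimately show ?thesis using that by simp
qed

text \<open>The norm is lower semicontinuous under pointwise limits, since each coordinate and each
  finite partial sum passes to the limit. Index 0 is excluded: the truncations of a constant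
  sequence are bounded in c_0 and converge pointwise to a sequence outside it.\<close>

lemma lp_Fatou:
  fixes f :: "'i \<Rightarrow> int ^ 'd::finite \<Rightarrow> 'a::real_normed_vector"
  assumes q: "q \<in> lp_index" "q \<noteq> 0" and Fl: "Fl \<noteq> bot" and C: "0 \<le> C"
    and lim: "\<And>m. ((\<lambda>i. f i m) \<longlongrightarrow> g m) Fl"
    and bd: "eventually (\<lambda>i. f i \<in> lp q \<and> lp_norm q (f i) \<le> C) Fl"
  shows "g \<in> lp q" "lp_norm q g \<le> C"
proof -
  have "g \<in> lp q \<and> lp_norm q g \<le> C"
    using q(1)
  proof (cases rule: lp_index_cases)
    case zero
    with q show ?thesis by simp
  next
    case infty
    have "norm (g m) \<le> C" for m
    proof (rule tendsto_upperbound[OF tendsto_norm[OF lim] _ Fl])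
      show "eventually (\<lambda>i. norm (f i m) \<le> C) Fl"
        using bd by eventually_elim (use lp_norm_ge[OF q(1)] in \<open>meson order_trans\<close>)
    qed
    with lp_sup_boundI[of g C] infty show ?thesis by simp
  next
    case (finite p)
    have "(\<Sum>m\<in>F. norm (g m) powr p) \<le> C powr p" if F: "finite F" for F
    proof (rule tendsto_upperbound[OF _ _ Fl])
      show "((\<lambda>i. \<Sum>m\<in>F. norm (f i m) powr p) \<longlongrightarrow> (\<Sum>m\<in>F. norm (g m) powr p)) Fl"
        using finite by (intro tendsto_sum tendsto_powr' tendsto_norm lim tendsto_const) auto
      show "eventually (\<lambda>i. (\<Sum>m\<in>F. norm (f i m) powr p) \<le> C powr p) Fl"
        using bd
      proof eventually_elim
        case (elim i)
        have "(\<Sum>m\<in>F. norm (f i m) powr p) \<le> lp_norm q (f i) powr p"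
          using lp_ereal_sum_le[of p "f i" F] finite F elim by simp
        also have "\<dots> \<le> C powr p"
          using elim finite lp_norm_nonneg[OF _ q(1)] by (intro powr_mono2) auto
        finally show ?case .
      qed
    qed
    then show ?thesis using lp_ereal_boundI[of p C g] finite C by simp
  qed
  then show "g \<in> lp q" "lp_norm q g \<le> C" by auto
qed

text \<open>An entry of \<open>g\<close> of norm at least e forces an entry of \<open>f\<close> of
  norm at least e/2. This takes the place of the Fatou argument at index 0.\<close>

lemma lp_zero_closed:
  assumes "\<And>e. 0 < e \<Longrightarrow> \<exists>f\<in>lp 0. \<forall>m. norm (g m - f m) \<le> e"
  shows "g \<in> lp 0"
  unfolding lp_zero_iff
proof (intro allI impI)
  fix e :: real assume "0 < e"
  then obtain f where f: "f \<in> lp 0" "\<And>m. norm (g m - f m) \<le> e/2"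
    using assms[of "e/2"] by auto
  have "e/2 \<le> norm (f m)" if "e \<le> norm (g m)" for m
    using that f(2)[of m] norm_triangle_ineq2[of "g m" "f m"] by linarith
  moreover have "finite {m. e/2 \<le> norm (f m)}" using f \<open>0 < e\<close> by (intro lp_zero_finite) auto
  ultimately show "finite {m. e \<le> norm (g m)}" by (auto elim!: rev_finite_subset)
qed

text \<open>Completeness, in the form that absolutely convergent series converge. The sum is taken
  coordinatewise, and Fatou applied to the partial sums beyond \<open>n\<close> bounds the tail. At
  index 0 Fatou is used in l^infty, which has the same norm, and membership follows by uniform
  approximation.\<close>

lemma lp_series:
  fixes g :: "nat \<Rightarrow> int ^ 'd::finite \<Rightarrow> 'a::banach"
  assumes q: "q \<in> lp_index" and g: "\<And>k. g k \<in> lp q" and s: "summable (\<lambda>k. lp_norm q (g k))"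
  shows "\<exists>x\<in>lp q. \<forall>n. lp_norm q (\<lambda>m. x m - (\<Sum>k<n. g k m)) \<le> (\<Sum>k. lp_norm q (g (k + n)))"
proof -
  have nn: "0 \<le> lp_norm q (g k)" for k by (rule lp_norm_nonneg[OF g q])
  have sm: "summable (\<lambda>k. g k m)" for m
    by (rule summable_comparison_test'[OF s, of 0]) (rule lp_norm_ge[OF q g])
  define x where "x m = (\<Sum>k. g k m)" for m
  define S where "S n m = (\<Sum>k<n. g k m)" for n m
  define t where "t n = (\<Sum>k. lp_norm q (g (k + n)))" for n
  have S: "S n \<in> lp q" for n unfolding S_def using lp_sum[OF q, of "{..<n}" g] g by simp
  have sh: "summable (\<lambda>k. lp_norm q (g (k + n)))" for n
    by (rule summable_ignore_initial_segment[OF s])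
  have t0: "0 \<le> t n" for n unfolding t_def
    by (rule suminf_nonneg) (use sh nn in auto)
  have bd: "(\<lambda>m. S N m - S n m) \<in> lp q \<and> lp_norm q (\<lambda>m. S N m - S n m) \<le> t n" if "n \<le> N" for n N
  proof -
    have *: "S N m - S n m = (\<Sum>k<N - n. g (k + n) m)" for m
    proof -
      have "S N m = S n m + (\<Sum>k=n..<N. g k m)"
        using that unfolding S_def by (metis sum.atLeastLessThan_concat atLeast0LessThan zero_le)
      also have "(\<Sum>k=n..<N. g k m) = (\<Sum>k<N - n. g (k + n) m)"
        using that sum.shift_bounds_nat_ivl[of "\<lambda>k. g k m" 0 n "N - n"] by (simp add: atLeast0LessThan)
      finally show ?thesis by simp
    qed
    have "(\<Sum>k<N - n. lp_norm q (g (k + n))) \<le> t n"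
      unfolding t_def by (rule sum_le_suminf) (use sh nn in auto)
    then show ?thesis
      unfolding * using lp_sum[OF q, of "{..<N - n}" "\<lambda>k. g (k + n)"] g by fastforce
  qed
  have lim: "(\<lambda>N. S N m - S n m) \<longlonglongrightarrow> x m - S n m" for n m
    unfolding S_def x_def by (intro tendsto_diff summable_LIMSEQ sm tendsto_const)
  have ev: "eventually (\<lambda>N. (\<lambda>m. S N m - S n m) \<in> lp r \<and> lp_norm r (\<lambda>m. S N m - S n m) \<le> t n) sequentially"
    if r: "r = q \<or> r = \<infinity>" for n r
  proof (rule eventually_sequentiallyI[of n])
    fix N assume "n \<le> N"
    then show "(\<lambda>m. S N m - S n m) \<in> lp r \<and> lp_norm r (\<lambda>m. S N m - S n m) \<le> t n"
      using r bd[of n N] lp_imp_infty[OF q] lp_norm_infty_le[OF q] order_trans by blast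
  qed
  have tail: "lp_norm q (\<lambda>m. x m - S n m) \<le> t n" and mem: "q \<noteq> 0 \<Longrightarrow> (\<lambda>m. x m - S n m) \<in> lp q" for n
  proof -
    have "lp_norm \<infinity> (\<lambda>m. x m - S n m) \<le> t n"
      by (rule lp_Fatou(2)[OF _ _ sequentially_bot t0 lim ev]) auto
    then show "lp_norm q (\<lambda>m. x m - S n m) \<le> t n"
      using lp_Fatou(2)[OF q _ sequentially_bot t0 lim ev]
      by (cases "q = 0") (auto simp: lp_norm_zero_eq)
    show "q \<noteq> 0 \<Longrightarrow> (\<lambda>m. x m - S n m) \<in> lp q"
      using lp_Fatou(1)[OF q _ sequentially_bot t0 lim ev] by auto
  qed
  have "x \<in> lp q"
  proof (cases "q = 0")
    case True
    have "x \<in> lp 0"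
    proof (rule lp_zero_closed)
      fix e :: real assume e: "0 < e"
      have "t \<longlonglongrightarrow> 0" unfolding t_def by (rule suminf_exist_split2[OF s])
      then obtain n where n: "t n < e"
        using order_tendstoD(2)[OF _ e] eventually_happens' sequentially_bot by blast
      have "(\<lambda>m. x m - S n m) \<in> lp \<infinity>"
        by (rule lp_Fatou(1)[OF _ _ sequentially_bot t0 lim ev]) auto
      then have "norm (x m - S n m) \<le> e" for m
        using lp_norm_infty_ge[of "\<lambda>m. x m - S n m" m] tail[of n] True n
        by (simp add: lp_norm_zero_eq)
      then show "\<exists>f\<in>lp 0. \<forall>m. norm (x m - f m) \<le> e" using S[of n] True by blast
    qed
    then show ?thesis by (simp add: True)
  next
    case False
    then show ?thesis using mem[of 0] by (simp add: S_def)
  qed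
  then show ?thesis using tail unfolding S_def t_def by blast
qed

section \<open>Bounded operators\<close>

lemma lp_operator_mem: "lp_operator q U \<Longrightarrow> f \<in> lp q \<Longrightarrow> U f \<in> lp q"
  by (simp add: lp_operator_def)

lemma lp_operator_add:
  "lp_operator q U \<Longrightarrow> f \<in> lp q \<Longrightarrow> g \<in> lp q \<Longrightarrow> U (\<lambda>m. f m + g m) = (\<lambda>m. U f m + U g m)"
  by (simp add: lp_operator_def)

lemma lp_operator_scaleC:
  "lp_operator q U \<Longrightarrow> f \<in> lp q \<Longrightarrow> U (\<lambda>m. scaleC c (f m)) = (\<lambda>m. scaleC c (U f m))"
  by (simp add: lp_operator_def)

lemma lp_operator_bound:
  fixes U :: "(int ^ 'd::finite \<Rightarrow> 'a::chilbert_space) \<Rightarrow> (int ^ 'd \<Rightarrow> 'b::chilbert_space)"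
  assumes "lp_operator q U" "q \<in> lp_index"
  obtains C where "0 \<le> C" "\<And>f. f \<in> lp q \<Longrightarrow> lp_norm q (U f) \<le> C * lp_norm q f"
proof -
  obtain C where C: "\<And>f. f \<in> lp q \<Longrightarrow> lp_norm q (U f) \<le> C * lp_norm q f"
    using assms unfolding lp_operator_def by blast
  have "lp_norm q (U f) \<le> \<bar>C\<bar> * lp_norm q f" if "f \<in> lp q" for f
  proof -
    have "C * lp_norm q f \<le> \<bar>C\<bar> * lp_norm q f"
      by (intro mult_right_mono lp_norm_nonneg[OF that assms(2)]) simp
    then show ?thesis using C[OF that] by linarith
  qed
  then show ?thesis using that[of "\<bar>C\<bar>"] by simp
qed

lemma lp_operator_diff:
  assumes "lp_operator q U" "q \<in> lp_index" "f \<in> lp q" "g \<in> lp q"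
  shows "U (\<lambda>m. f m - g m) = (\<lambda>m. U f m - U g m)"
proof -
  have "U (\<lambda>m. f m + scaleC (- 1) (g m)) = (\<lambda>m. U f m + U (\<lambda>m. scaleC (- 1) (g m)) m)"
    by (rule lp_operator_add[OF assms(1,3) lp_scaleC(1)[OF assms(2,4)]])
  also have "\<dots> = (\<lambda>m. U f m + scaleC (- 1) (U g m))"
    by (simp only: lp_operator_scaleC[OF assms(1,4)])
  finally show ?thesis by simp
qed

lemma lp_operator_zero:
  assumes "lp_operator q U" "q \<in> lp_index"
  shows "U (\<lambda>_. 0) = (\<lambda>_. 0)"
  using lp_operator_diff[OF assms lp_const_zero(1)[OF assms(2)] lp_const_zero(1)[OF assms(2)]] by simp

lemma lp_operator_sum:
  assumes U: "lp_operator q U" "q \<in> lp_index" and "finite F" and "\<And>i. i \<in> F \<Longrightarrow> f i \<in> lp q"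
  shows "U (\<lambda>m. \<Sum>i\<in>F. f i m) = (\<lambda>m. \<Sum>i\<in>F. U (f i) m)"
  using assms(3,4)
proof (induction F)
  case empty
  then show ?case by (simp add: lp_operator_zero[OF U])
next
  case (insert i F)
  have "(\<lambda>m. \<Sum>i\<in>F. f i m) \<in> lp q" using lp_sum[OF U(2), of F f] insert by auto
  then show ?case using lp_operator_add[OF U(1), of "f i" "\<lambda>m. \<Sum>i\<in>F. f i m"] insert by simp
qed

lemma lp_operator_cong:
  fixes U V :: "(int ^ 'd::finite \<Rightarrow> 'a::chilbert_space) \<Rightarrow> (int ^ 'd \<Rightarrow> 'b::chilbert_space)"
  assumes "lp_operator q U" "q \<in> lp_index" "\<And>f. f \<in> lp q \<Longrightarrow> V f = U f"
  shows "lp_operator q V"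
  using assms unfolding lp_operator_def by (simp add: lp_add(1) lp_scaleC(1))

lemma lp_operator_comp:
  assumes "q \<in> lp_index" "lp_operator q V" "lp_operator q U"
  shows "lp_operator q (\<lambda>f. V (U f))"
proof -
  obtain C where C: "0 \<le> C" "\<And>f. f \<in> lp q \<Longrightarrow> lp_norm q (U f) \<le> C * lp_norm q f"
    using lp_operator_bound[OF assms(3,1)] by blast
  obtain D where D: "0 \<le> D" "\<And>f. f \<in> lp q \<Longrightarrow> lp_norm q (V f) \<le> D * lp_norm q f"
    using lp_operator_bound[OF assms(2,1)] by blast
  have "lp_norm q (V (U f)) \<le> (D * C) * lp_norm q f" if f: "f \<in> lp q" for f
  proof -
    have "lp_norm q (V (U f)) \<le> D * lp_norm q (U f)"
      by (rule D(2)) (rule lp_operator_mem[OF assms(3) f])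
    also have "\<dots> \<le> D * (C * lp_norm q f)" by (rule mult_left_mono[OF C(2)[OF f] D(1)])
    finally show ?thesis by (simp add: mult.assoc)
  qed
  then show ?thesis
    unfolding lp_operator_def
    using lp_operator_mem[OF assms(2)] lp_operator_mem[OF assms(3)]
      lp_operator_add[OF assms(2)] lp_operator_add[OF assms(3)]
      lp_operator_scaleC[OF assms(2)] lp_operator_scaleC[OF assms(3)]
    by (intro conjI ballI allI exI[of _ "D * C"]) simp_all
qed

lemma lp_operator_restrict:
  fixes U :: "(int ^ 'd::finite \<Rightarrow> 'a::chilbert_space) \<Rightarrow> (int ^ 'd \<Rightarrow> 'b::chilbert_space)"
  assumes "lp_operator r U" "\<And>f :: int ^ 'd \<Rightarrow> 'a. f \<in> lp q \<Longrightarrow> f \<in> lp r"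
    and "\<And>f. f \<in> lp q \<Longrightarrow> U f \<in> lp q \<and> lp_norm q (U f) \<le> C * lp_norm q f"
  shows "lp_operator q U"
  unfolding lp_operator_def
proof (intro conjI ballI allI exI[of _ C])
  note U = assms(1)[unfolded lp_operator_def]
  show "U (\<lambda>m. f m + g m) = (\<lambda>m. U f m + U g m)" if "f \<in> lp q" "g \<in> lp q" for f g
    using U assms(2) that by simp
  show "U (\<lambda>m. scaleC c (f m)) = (\<lambda>m. scaleC c (U f m))" if "f \<in> lp q" for c f
    using U assms(2) that by simp
qed (use assms(3) in auto)

lemma lp_operator_trunc:
  assumes U: "lp_operator q U" "q \<in> lp_index" and F: "finite F"
  shows "U (trunc F f) = (\<lambda>m. \<Sum>n\<in>F. U (single n (f n)) m)"
  unfolding trunc_eq_sum[OF F] by (rule lp_operator_sum[OF U F]) (rule single_lp(1)[OF U(2)])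

lemma lp_operator_tendsto:
  assumes U: "lp_operator q U" "q \<in> lp_index" and f: "\<And>i. f i \<in> lp q" "g \<in> lp q"
    and lim: "((\<lambda>i. lp_norm q (\<lambda>m. f i m - g m)) \<longlongrightarrow> 0) F"
  shows "((\<lambda>i. lp_norm q (\<lambda>m. U (f i) m - U g m)) \<longlongrightarrow> 0) F"
proof -
  obtain C where C: "0 \<le> C" "\<And>f. f \<in> lp q \<Longrightarrow> lp_norm q (U f) \<le> C * lp_norm q f"
    using lp_operator_bound[OF U] by blast
  have d: "(\<lambda>m. f i m - g m) \<in> lp q" for i by (rule lp_diff(1)[OF U(2) f])
  have eq: "(\<lambda>m. U (f i) m - U g m) = U (\<lambda>m. f i m - g m)" for i
    using lp_operator_diff[OF U f] by simp
  show ?thesis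
  proof (rule tendsto_sandwich[OF _ _ tendsto_const])
    show "eventually (\<lambda>i. 0 \<le> lp_norm q (\<lambda>m. U (f i) m - U g m)) F"
      unfolding eq by (intro always_eventually allI lp_norm_nonneg[OF _ U(2)] lp_operator_mem[OF U(1)] d)
    show "eventually (\<lambda>i. lp_norm q (\<lambda>m. U (f i) m - U g m) \<le> C * lp_norm q (\<lambda>m. f i m - g m)) F"
      unfolding eq by (intro always_eventually allI C d)
    show "((\<lambda>i. C * lp_norm q (\<lambda>m. f i m - g m)) \<longlongrightarrow> 0) F"
      using tendsto_mult_right_zero[OF lim] by simp
  qed
qed

lemma infsum_diff:
  fixes f g :: "'i \<Rightarrow> 'b::{topological_ab_group_add,t2_space}"
  assumes "f summable_on A" "g summable_on A"
  shows "infsum (\<lambda>x. f x - g x) A = infsum f A - infsum g A"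
  using infsum_add[OF assms(1), of "\<lambda>x. - g x"] assms(2) by (simp add: infsum_uminus summable_on_uminus)

section \<open>Convolution bounds\<close>

text \<open>Row m of a slanted matrix is centred at floor(\<alpha> m). For |\<alpha>| < 1 this map
  repeats values, and \<open>K\<close> bounds the multiplicity that appears in sums over m.\<close>

definition fibers_le :: "nat \<Rightarrow> ('i \<Rightarrow> 'j) \<Rightarrow> bool"
  where "fibers_le K r \<longleftrightarrow> (\<forall>y. finite {m. r m = y} \<and> card {m. r m = y} \<le> K)"

lemma fibers_le_id: "fibers_le 1 (\<lambda>m. m)"
  by (simp add: fibers_le_def)

lemma fibers_le_diff:
  fixes r :: "'i \<Rightarrow> 'j::group_add"
  assumes "fibers_le K r"
  shows "fibers_le K (\<lambda>m. r m - j)"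
proof -
  have "{m. r m - j = y} = {m. r m = y + j}" for y by (auto simp: diff_eq_eq)
  then show ?thesis using assms by (simp add: fibers_le_def)
qed

lemma sum_fibers_le:
  fixes g :: "'j \<Rightarrow> real"
  assumes r: "fibers_le K r" and g: "\<And>y. 0 \<le> g y" and F: "finite F"
  shows "(\<Sum>m\<in>F. g (r m)) \<le> real K * (\<Sum>y\<in>r ` F. g y)"
proof -
  have "(\<Sum>m\<in>F. g (r m)) = (\<Sum>y\<in>r ` F. \<Sum>m\<in>{m. m \<in> F \<and> r m = y}. g (r m))"
    by (rule sum.image_gen[OF F])
  also have "\<dots> \<le> (\<Sum>y\<in>r ` F. real K * g y)"
  proof (rule sum_mono)
    fix y
    have "card {m. m \<in> F \<and> r m = y} \<le> card {m. r m = y}"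
      using r by (intro card_mono) (auto simp: fibers_le_def)
    also have "\<dots> \<le> K" using r by (simp add: fibers_le_def)
    finally have "real (card {m. m \<in> F \<and> r m = y}) * g y \<le> real K * g y"
      using g by (intro mult_right_mono) auto
    moreover have "(\<Sum>m\<in>{m. m \<in> F \<and> r m = y}. g (r m)) = real (card {m. m \<in> F \<and> r m = y}) * g y"
      by simp
    ultimately show "(\<Sum>m\<in>{m. m \<in> F \<and> r m = y}. g (r m)) \<le> real K * g y" by linarith
  qed
  finally show ?thesis by (simp add: sum_distrib_left)
qed

lemma infsum_fibers_le:
  fixes g :: "'j \<Rightarrow> real"
  assumes r: "fibers_le K r" and g: "\<And>y. 0 \<le> g y" and s: "g summable_on UNIV"
  shows "(\<lambda>m. g (r m)) summable_on UNIV" "(\<Sum>\<^sub>\<infinity>m. g (r m)) \<le> real K * (\<Sum>\<^sub>\<infinity>y. g y)"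
proof -
  have le: "(\<Sum>m\<in>F. g (r m)) \<le> real K * (\<Sum>\<^sub>\<infinity>y. g y)" if "finite F" for F
  proof -
    have "(\<Sum>y\<in>r ` F. g y) \<le> (\<Sum>\<^sub>\<infinity>y. g y)"
      using that by (intro finite_sum_le_infsum s g) auto
    then have "real K * (\<Sum>y\<in>r ` F. g y) \<le> real K * (\<Sum>\<^sub>\<infinity>y. g y)" by (intro mult_left_mono) auto
    then show ?thesis using sum_fibers_le[of K r g F, OF r g that] by linarith
  qed
  show s: "(\<lambda>m. g (r m)) summable_on UNIV"
    by (rule nonneg_bdd_above_summable_on) (auto intro!: bdd_aboveI2 le g)
  show "(\<Sum>\<^sub>\<infinity>m. g (r m)) \<le> real K * (\<Sum>\<^sub>\<infinity>y. g y)"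
    by (rule infsum_le_finite_sums[OF s]) (simp add: le)
qed

text \<open>At exponent p the multiplicity enters as K^(1/p), which is at most K because K >= 1; so
  one constant serves all indices.\<close>

lemma lp_comp_fibers:
  fixes f :: "int ^ 'd::finite \<Rightarrow> 'a::real_normed_vector" and r :: "int ^ 'd \<Rightarrow> int ^ 'd"
  assumes q: "q \<in> lp_index" "q \<noteq> 0" and f: "f \<in> lp q" and r: "fibers_le K r" "1 \<le> K"
  shows "(\<lambda>m. f (r m)) \<in> lp q" "lp_norm q (\<lambda>m. f (r m)) \<le> real K * lp_norm q f"
proof -
  have nn: "0 \<le> lp_norm q f" by (rule lp_norm_nonneg[OF f q(1)])
  have le: "lp_norm q f \<le> real K * lp_norm q f"
    using mult_right_mono[of 1 "real K" "lp_norm q f"] nn r(2) by simp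
  have "(\<lambda>m. f (r m)) \<in> lp q \<and> lp_norm q (\<lambda>m. f (r m)) \<le> real K * lp_norm q f"
    using q(1)
  proof (cases rule: lp_index_cases)
    case zero
    with q show ?thesis by simp
  next
    case infty
    have "norm (f (r m)) \<le> real K * lp_norm q f" for m
      using lp_norm_ge[OF q(1) f, of "r m"] le by linarith
    then show ?thesis using infty lp_sup_boundI[of "\<lambda>m. f (r m)"] by auto
  next
    case (finite p)
    have "(\<Sum>m\<in>F. norm (f (r m)) powr p) \<le> (real K * lp_norm q f) powr p" if F: "finite F" for F
    proof -
      have "(\<Sum>m\<in>F. norm (f (r m)) powr p) \<le> real K * (\<Sum>y\<in>r ` F. norm (f y) powr p)"
        by (rule sum_fibers_le[OF r(1) _ F]) simp
      also have "\<dots> \<le> real K * lp_norm q f powr p"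
        using lp_ereal_sum_le[of p f "r ` F"] finite f F by (intro mult_left_mono) auto
      also have "\<dots> \<le> real K powr p * lp_norm q f powr p"
        using powr_mono[of 1 p "real K"] finite r(2) by (intro mult_right_mono) auto
      also have "\<dots> = (real K * lp_norm q f) powr p" by (simp add: powr_mult)
      finally show ?thesis .
    qed
    then show ?thesis
      using lp_ereal_boundI[of p "real K * lp_norm q f" "\<lambda>m. f (r m)"] finite nn by simp
  qed
  then show "(\<lambda>m. f (r m)) \<in> lp q" "lp_norm q (\<lambda>m. f (r m)) \<le> real K * lp_norm q f" by auto
qed

section \<open>Convolution with a summable weight\<close>

lemma bij_diff_left: "bij (\<lambda>n. m - n :: 'i::ab_group_add)"
  by (rule o_bij[of "\<lambda>n. m - n"]) (auto simp: fun_eq_iff)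

lemma summable_on_reflect:
  fixes v :: "'i::ab_group_add \<Rightarrow> 'b::{comm_monoid_add,topological_space}"
  shows "(\<lambda>n. v (m - n)) summable_on UNIV \<longleftrightarrow> v summable_on UNIV"
  by (rule summable_on_reindex_bij_betw[OF bij_diff_left])

lemma infsum_reflect:
  fixes v :: "'i::ab_group_add \<Rightarrow> 'b::{comm_monoid_add,t2_space}"
  shows "(\<Sum>\<^sub>\<infinity>n. v (m - n)) = (\<Sum>\<^sub>\<infinity>n. v n)"
  by (rule infsum_reindex_bij_betw[OF bij_diff_left])

lemma summable_mult_bounded:
  fixes v :: "'i \<Rightarrow> real"
  assumes v: "\<And>j. 0 \<le> v j" "v summable_on UNIV" and f: "\<And>j. 0 \<le> f j" "\<And>j. f j \<le> C"
  shows "(\<lambda>j. v j * f j) summable_on UNIV" "(\<Sum>\<^sub>\<infinity>j. v j * f j) \<le> (\<Sum>\<^sub>\<infinity>j. v j) * C"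
proof -
  have s: "(\<lambda>j. v j * C) summable_on UNIV" by (rule summable_on_cmult_left[OF v(2)])
  have le: "v j * f j \<le> v j * C" for j by (rule mult_left_mono[OF f(2) v(1)])
  show 1: "(\<lambda>j. v j * f j) summable_on UNIV"
    by (rule summable_on_comparison_test[OF s le]) (simp add: v f)
  show "(\<Sum>\<^sub>\<infinity>j. v j * f j) \<le> (\<Sum>\<^sub>\<infinity>j. v j) * C"
    using infsum_mono[OF 1 s le] by (simp add: infsum_cmult_left')
qed

lemma summable_convolution:
  fixes v :: "int ^ 'd::finite \<Rightarrow> real"
  assumes v: "\<And>j. 0 \<le> v j" "v summable_on UNIV" and f: "f \<in> lp \<infinity>"
  shows "(\<lambda>n. v (m - n) * norm (f n)) summable_on UNIV"
  by (rule summable_mult_bounded(1)[OF _ _ _ lp_norm_infty_ge[OF f]])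
    (simp_all add: v summable_on_reflect)

text \<open>The substitution j = r m - n writes the convolution as a superposition of the sequences
  |f (r m - j)| with weights v j. Minkowski handles finite superpositions and Fatou the
  limit.\<close>

lemma Young_convolution_nonzero:
  fixes v :: "int ^ 'd::finite \<Rightarrow> real" and f :: "int ^ 'd \<Rightarrow> 'a::real_normed_vector"
    and r :: "int ^ 'd \<Rightarrow> int ^ 'd"
  assumes v: "\<And>j. 0 \<le> v j" "v summable_on UNIV" and r: "fibers_le K r" "1 \<le> K"
    and q: "q \<in> lp_index" "q \<noteq> 0" and f: "f \<in> lp q"
  shows "(\<lambda>m. \<Sum>\<^sub>\<infinity>n. v (r m - n) * norm (f n)) \<in> lp q"
    "lp_norm q (\<lambda>m. \<Sum>\<^sub>\<infinity>n. v (r m - n) * norm (f n)) \<le> real K * (\<Sum>\<^sub>\<infinity>j. v j) * lp_norm q f"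
proof -
  define C where "C = real K * (\<Sum>\<^sub>\<infinity>j. v j) * lp_norm q f"
  have nn: "0 \<le> lp_norm q f" by (rule lp_norm_nonneg[OF f q(1)])
  have C: "0 \<le> C" unfolding C_def using nn v by (auto intro!: mult_nonneg_nonneg infsum_nonneg)
  have fi: "f \<in> lp \<infinity>" by (rule lp_imp_infty[OF q(1) f])
  have eq: "(\<Sum>\<^sub>\<infinity>n. v (r m - n) * norm (f n)) = (\<Sum>\<^sub>\<infinity>j. v j * norm (f (r m - j)))" for m
    using infsum_reflect[of "\<lambda>j. v j * norm (f (r m - j))" "r m"] by simp
  have s: "(\<lambda>j. v j * norm (f (r m - j))) summable_on UNIV" for m
    using summable_convolution[OF v fi, of "r m"]
      summable_on_reflect[of "\<lambda>j. v j * norm (f (r m - j))" "r m"] by simp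
  have lim: "((\<lambda>E. \<Sum>j\<in>E. v j * norm (f (r m - j))) \<longlongrightarrow> (\<Sum>\<^sub>\<infinity>n. v (r m - n) * norm (f n)))
      (finite_subsets_at_top UNIV)" for m
    unfolding eq by (rule infsum_tendsto[OF s])
  have tbound: "(\<lambda>m. v j * norm (f (r m - j))) \<in> lp q \<and>
      lp_norm q (\<lambda>m. v j * norm (f (r m - j))) \<le> v j * (real K * lp_norm q f)" for j
  proof -
    have 1: "(\<lambda>m. f (r m - j)) \<in> lp q" "lp_norm q (\<lambda>m. f (r m - j)) \<le> real K * lp_norm q f"
      using lp_comp_fibers[OF q f, of K "\<lambda>m. r m - j"] fibers_le_diff[OF r(1)] r(2) by auto
    have "(\<lambda>m. v j * norm (f (r m - j))) \<in> lp q \<and>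
      lp_norm q (\<lambda>m. v j * norm (f (r m - j))) \<le> v j * lp_norm q (\<lambda>m. f (r m - j))"
      using lp_scale_le[OF q(1) 1(1) v(1), of "\<lambda>m. v j * norm (f (r m - j))" j] v(1) by simp
    moreover have "v j * lp_norm q (\<lambda>m. f (r m - j)) \<le> v j * (real K * lp_norm q f)"
      by (rule mult_left_mono[OF 1(2) v(1)])
    ultimately show ?thesis by linarith
  qed
  have "eventually (\<lambda>E. (\<lambda>m. \<Sum>j\<in>E. v j * norm (f (r m - j))) \<in> lp q \<and>
      lp_norm q (\<lambda>m. \<Sum>j\<in>E. v j * norm (f (r m - j))) \<le> C) (finite_subsets_at_top UNIV)"
    unfolding eventually_finite_subsets_at_top
  proof (intro exI[of _ "{}"] conjI allI impI; (elim conjE)?)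
    fix E :: "(int ^ 'd) set" assume E: "finite E"
    have *: "(\<lambda>m. \<Sum>j\<in>E. v j * norm (f (r m - j))) \<in> lp q \<and>
      lp_norm q (\<lambda>m. \<Sum>j\<in>E. v j * norm (f (r m - j)))
        \<le> (\<Sum>j\<in>E. lp_norm q (\<lambda>m. v j * norm (f (r m - j))))"
      by (rule lp_sum[OF q(1) E]) (simp add: tbound)
    then show "(\<lambda>m. \<Sum>j\<in>E. v j * norm (f (r m - j))) \<in> lp q" by simp
    have "(\<Sum>j\<in>E. lp_norm q (\<lambda>m. v j * norm (f (r m - j)))) \<le> (\<Sum>j\<in>E. v j * (real K * lp_norm q f))"
      by (rule sum_mono) (simp add: tbound)
    also have "\<dots> = (\<Sum>j\<in>E. v j) * (real K * lp_norm q f)" by (simp add: sum_distrib_right)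
    also have "\<dots> \<le> (\<Sum>\<^sub>\<infinity>j. v j) * (real K * lp_norm q f)"
      using nn E by (intro mult_right_mono finite_sum_le_infsum v) auto
    finally show "lp_norm q (\<lambda>m. \<Sum>j\<in>E. v j * norm (f (r m - j))) \<le> C"
      using * by (simp add: C_def mult_ac)
  qed auto
  note Fat = lp_Fatou[OF q finite_subsets_at_top_neq_bot C lim this]
  show "(\<lambda>m. \<Sum>\<^sub>\<infinity>n. v (r m - n) * norm (f n)) \<in> lp q"
    "lp_norm q (\<lambda>m. \<Sum>\<^sub>\<infinity>n. v (r m - n) * norm (f n)) \<le> real K * (\<Sum>\<^sub>\<infinity>j. v j) * lp_norm q f"
    using Fat unfolding C_def by auto
qed

text \<open>At index 0 the image of a finite truncation lies in l^1, hence in c_0, and the sup-norm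
  bound makes such images approximate the convolution of \<open>f\<close> uniformly.\<close>

lemma Young_convolution:
  fixes v :: "int ^ 'd::finite \<Rightarrow> real" and f :: "int ^ 'd \<Rightarrow> 'a::real_normed_vector"
    and r :: "int ^ 'd \<Rightarrow> int ^ 'd"
  assumes v: "\<And>j. 0 \<le> v j" "v summable_on UNIV" and r: "fibers_le K r" "1 \<le> K"
    and q: "q \<in> lp_index" and f: "f \<in> lp q"
  shows "(\<lambda>m. \<Sum>\<^sub>\<infinity>n. v (r m - n) * norm (f n)) \<in> lp q"
    "lp_norm q (\<lambda>m. \<Sum>\<^sub>\<infinity>n. v (r m - n) * norm (f n)) \<le> real K * (\<Sum>\<^sub>\<infinity>j. v j) * lp_norm q f"
proof -
  note Y = Young_convolution_nonzero[OF v r]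
  let ?Y = "\<lambda>f m. \<Sum>\<^sub>\<infinity>n. v (r m - n) * norm (f n :: 'a)"
  have "?Y f \<in> lp q \<and> lp_norm q (?Y f) \<le> real K * (\<Sum>\<^sub>\<infinity>j. v j) * lp_norm q f"
  proof (cases "q = 0")
    case False
    then show ?thesis using Y[OF q _ f] by auto
  next
    case True
    have f0: "f \<in> lp 0" and fi: "f \<in> lp \<infinity>" using f True lp_zero_imp_infty by auto
    have bd: "lp_norm \<infinity> (?Y f) \<le> real K * (\<Sum>\<^sub>\<infinity>j. v j) * lp_norm \<infinity> f"
      by (rule Y(2)) (use fi in auto)
    define D where "D = real K * (\<Sum>\<^sub>\<infinity>j. v j)"
    have D: "0 \<le> D" unfolding D_def using v by (auto intro!: mult_nonneg_nonneg infsum_nonneg)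
    have "?Y f \<in> lp 0"
    proof (rule lp_zero_closed)
      fix e :: real assume e: "0 < e"
      obtain F where F: "finite F" "lp_norm 0 (\<lambda>m. f m - trunc F f m) < e / (D + 1)"
        by (rule trunc_approx[OF _ _ f0, of "e / (D + 1)"]) (use e D in auto)
      have t1: "trunc F f \<in> lp 1" by (rule trunc_lp_one[OF F(1)])
      then have ti: "trunc F f \<in> lp \<infinity>" by (rule lp_one_imp[rotated]) simp
      have di: "(\<lambda>m. f m - trunc F f m) \<in> lp \<infinity>" by (rule lp_diff(1)[OF _ fi ti]) simp
      have "?Y (trunc F f) \<in> lp 1" by (rule Y(1)[OF _ _ t1]) auto
      then have Y0: "?Y (trunc F f) \<in> lp 0" by (rule lp_one_imp[rotated]) simp
      have "norm (?Y f m - ?Y (trunc F f) m) \<le> e" for m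
      proof -
        have "?Y f m - ?Y (trunc F f) m
            = (\<Sum>\<^sub>\<infinity>n. v (r m - n) * norm (f n) - v (r m - n) * norm (trunc F f n))"
          by (rule infsum_diff[symmetric]; rule summable_convolution[OF v]; fact)
        also have "\<dots> = ?Y (\<lambda>m. f m - trunc F f m) m"
          by (rule infsum_cong) (simp add: trunc_def)
        finally have "norm (?Y f m - ?Y (trunc F f) m) = norm (?Y (\<lambda>m. f m - trunc F f m) m)" by simp
        also have "\<dots> \<le> lp_norm \<infinity> (?Y (\<lambda>m. f m - trunc F f m))"
          by (rule lp_norm_infty_ge[OF Y(1)]) (use di in auto)
        also have "\<dots> \<le> D * lp_norm \<infinity> (\<lambda>m. f m - trunc F f m)"
          unfolding D_def by (rule Y(2)) (use di in auto)
        also have "\<dots> \<le> D * (e / (D + 1))"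
          using F(2) D by (intro mult_left_mono) (auto simp: lp_norm_zero_eq)
        also have "\<dots> \<le> e" using e D by (simp add: field_simps)
        finally show ?thesis .
      qed
      then show "\<exists>g\<in>lp 0. \<forall>m. norm (?Y f m - g m) \<le> e"
        by (intro bexI[OF _ Y0] allI)
    qed
    then show ?thesis using bd True by (simp add: lp_norm_zero_eq)
  qed
  then show "?Y f \<in> lp q" "lp_norm q (?Y f) \<le> real K * (\<Sum>\<^sub>\<infinity>j. v j) * lp_norm q f" by auto
qed

section \<open>Summable polynomial weights on the lattice\<close>

lemma summable_on_inverse_square_int: "(\<lambda>i::int. 1 / (1 + real_of_int \<bar>i\<bar>)\<^sup>2) summable_on UNIV"
proof -
  let ?g = "\<lambda>i::int. 1 / (1 + real_of_int \<bar>i\<bar>)\<^sup>2"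
  have "summable (\<lambda>n. inverse (real n ^ 2))" by (rule inverse_power_summable) simp
  then have "summable (\<lambda>n. inverse (real (Suc n) ^ 2))"
    using summable_Suc_iff[of "\<lambda>n. inverse (real n ^ 2)"] by blast
  then have s: "(\<lambda>n. 1 / (1 + real n)\<^sup>2) summable_on UNIV"
    by (intro summable_nonneg_imp_summable_on) (auto simp: inverse_eq_divide)
  have 1: "?g summable_on range int"
    using s by (subst summable_on_reindex) (auto simp: o_def inj_on_def)
  have 2: "?g summable_on range (\<lambda>n. - int n)"
    using s by (subst summable_on_reindex) (auto simp: o_def inj_on_def)
  have "UNIV = range int \<union> range (\<lambda>n. - int n)"
    by (auto intro: int_cases2)
  then show ?thesis using summable_on_union[OF 1 2] by simp
qed

text \<open>The exponent 2d comes from 1 + |j| >= 1 + |j_k| in each of the d coordinates: the weight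
  is dominated by a product of one-dimensional inverse squares, whose sum over a box
  factors.\<close>

lemma summable_on_inverse_znorm:
  "(\<lambda>j :: int ^ 'd::finite. 1 / (1 + real_of_int (znorm j)) ^ (2 * CARD('d))) summable_on UNIV"
proof (rule nonneg_bdd_above_summable_on)
  define g where "g i = 1 / (1 + real_of_int \<bar>i\<bar>)\<^sup>2" for i :: int
  have g: "g summable_on UNIV" unfolding g_def by (rule summable_on_inverse_square_int)
  have g0: "0 \<le> g i" for i by (simp add: g_def)
  let ?h = "\<lambda>j :: int ^ 'd. 1 / (1 + real_of_int (znorm j)) ^ (2 * CARD('d))"
  have le: "?h j \<le> (\<Prod>k\<in>UNIV. g (j $ k))" for j
  proof -
    have "?h j = (\<Prod>k\<in>(UNIV :: 'd set). 1 / (1 + real_of_int (znorm j))\<^sup>2)"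
      by (simp add: power_mult power_one_over)
    also have "\<dots> \<le> (\<Prod>k\<in>UNIV. g (j $ k))"
    proof (rule prod_mono)
      fix k
      have "real_of_int \<bar>j $ k\<bar> \<le> real_of_int (znorm j)"
        using abs_component_le_znorm[of j k] of_int_le_iff by blast
      then have "(1 + real_of_int \<bar>j $ k\<bar>)\<^sup>2 \<le> (1 + real_of_int (znorm j))\<^sup>2"
        by (intro power_mono) auto
      then show "0 \<le> 1 / (1 + real_of_int (znorm j))\<^sup>2 \<and> 1 / (1 + real_of_int (znorm j))\<^sup>2 \<le> g (j $ k)"
        unfolding g_def by (auto intro!: divide_left_mono mult_pos_pos zero_less_power add_pos_nonneg)
    qed
    finally show ?thesis .
  qed
  have "sum ?h F \<le> (\<Sum>\<^sub>\<infinity>i. g i) ^ CARD('d)" if F: "finite F" for F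
  proof -
    define N where "N = Max (insert 0 (znorm ` F))"
    have N: "znorm j \<le> N" if "j \<in> F" for j using that F by (auto simp: N_def)
    have "sum ?h F \<le> (\<Sum>j\<in>F. \<Prod>k\<in>UNIV. g (j $ k))" by (rule sum_mono) (rule le)
    also have "\<dots> = (\<Sum>h\<in>($) ` F. \<Prod>k\<in>UNIV. g (h k))"
      by (subst sum.reindex) (auto simp: inj_on_def vec_eq_iff)
    also have "\<dots> \<le> (\<Sum>h\<in>PiE (UNIV :: 'd set) (\<lambda>_. {- N..N}). \<Prod>k\<in>UNIV. g (h k))"
    proof (rule sum_mono2)
      show "finite (PiE (UNIV :: 'd set) (\<lambda>_. {- N..N}))" by (intro finite_PiE) auto
      show "($) ` F \<subseteq> PiE UNIV (\<lambda>_. {- N..N})"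
      proof safe
        fix j k assume "j \<in> F"
        then have "\<bar>j $ k\<bar> \<le> N" using N[of j] abs_component_le_znorm[of j k] by linarith
        then show "j $ k \<in> {- N..N}" by auto
      qed auto
    qed (auto intro!: prod_nonneg g0)
    also have "\<dots> = (\<Prod>k\<in>(UNIV :: 'd set). \<Sum>i\<in>{- N..N}. g i)"
      by (rule prod_sum_PiE[symmetric]) auto
    also have "\<dots> = (\<Sum>i\<in>{- N..N}. g i) ^ CARD('d)" by simp
    also have "\<dots> \<le> (\<Sum>\<^sub>\<infinity>i. g i) ^ CARD('d)"
      by (intro power_mono finite_sum_le_infsum g sum_nonneg g0) auto
    finally show ?thesis .
  qed
  then show "bdd_above (sum ?h ` {F. F \<subseteq> UNIV \<and> finite F})" by (auto intro!: bdd_aboveI2)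
qed simp

section \<open>Duality\<close>

text \<open>Only the extreme pairings of l^1 with l^infty are used, in either order. Their series
  converge absolutely, and a finitely supported sequence may stand on either side of any bounded
  one.\<close>

definition dual_pair :: "(int ^ 'd::finite \<Rightarrow> 'a::chilbert_space) \<Rightarrow> (int ^ 'd \<Rightarrow> 'b::chilbert_space) \<Rightarrow> bool"
  where "dual_pair f g \<longleftrightarrow> f \<in> lp \<infinity> \<and> g \<in> lp 1 \<or> f \<in> lp 1 \<and> g \<in> lp \<infinity>"

text \<open>
  The conjugate of \<open>1\<close> is taken to be \<open>0\<close>, that is \<open>c\<^sub>0\<close> instead of \<open>\<ell>\<^sup>\<infinity>\<close>, so that finitely
  supported sequences are dense in every space with a conjugate index.
\<close>

definition conj_index :: "ereal \<Rightarrow> ereal"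
  where "conj_index q = (if q = 1 then 0 else if q = \<infinity> then 1
    else ereal (real_of_ereal q / (real_of_ereal q - 1)))"

lemma conj_index_simps [simp]: "conj_index 1 = 0" "conj_index \<infinity> = 1"
  by (simp_all add: conj_index_def)

lemma conj_index_ereal: "1 < p \<Longrightarrow> conj_index (ereal p) = ereal (p / (p - 1))"
  by (simp add: conj_index_def one_ereal_def)

lemma lp_index_cases':
  assumes "q \<in> lp_index" "q \<noteq> 0"
  obtains (one) "q = 1" | (infty) "q = \<infinity>" | (finite) p where "q = ereal p" "1 < p"
proof -
  show thesis using assms(1)
  proof (cases rule: lp_index_cases)
    case (finite p)
    then show thesis using that(1,3) by (cases "p = 1") (auto simp: one_ereal_def)
  qed (use assms that in auto)
qed

lemma conj_index_mem:
  assumes "q \<in> lp_index" "q \<noteq> 0"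
  shows "conj_index q \<in> lp_index" "conj_index q \<noteq> \<infinity>"
  using assms by (cases rule: lp_index_cases'; simp add: conj_index_ereal)+

lemma Holder_sum:
  fixes f :: "int ^ 'd::finite \<Rightarrow> 'a::real_normed_vector" and g :: "int ^ 'd \<Rightarrow> 'b::real_normed_vector"
  assumes q: "q \<in> lp_index" "q \<noteq> 0" and f: "f \<in> lp (conj_index q)" and g: "g \<in> lp q" and F: "finite F"
  shows "(\<Sum>m\<in>F. norm (f m) * norm (g m)) \<le> lp_norm (conj_index q) f * lp_norm q g"
proof -
  note c = conj_index_mem[OF q]
  have nn: "0 \<le> lp_norm (conj_index q) f" "0 \<le> lp_norm q g"
    using lp_norm_nonneg f g q c by auto
  have l1: "(\<Sum>m\<in>F. norm (h m)) \<le> lp_norm 1 h" if "h \<in> lp 1" for h :: "int ^ 'd \<Rightarrow> 'c::real_normed_vector"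
    using that F by (simp add: lp_one_iff lp_norm_one finite_sum_le_infsum)
  show ?thesis using q
  proof (cases rule: lp_index_cases')
    case one
    have "(\<Sum>m\<in>F. norm (f m) * norm (g m)) \<le> (\<Sum>m\<in>F. lp_norm (conj_index q) f * norm (g m))"
      by (intro sum_mono mult_right_mono lp_norm_ge c f) auto
    also have "\<dots> \<le> lp_norm (conj_index q) f * lp_norm q g"
      using l1[of g] g one nn by (simp add: sum_distrib_left[symmetric] mult_left_mono)
    finally show ?thesis .
  next
    case infty
    have "(\<Sum>m\<in>F. norm (f m) * norm (g m)) \<le> (\<Sum>m\<in>F. norm (f m) * lp_norm q g)"
      by (intro sum_mono mult_left_mono lp_norm_ge q g) auto
    also have "\<dots> \<le> lp_norm (conj_index q) f * lp_norm q g"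
      using l1[of f] f infty nn by (simp add: sum_distrib_right[symmetric] mult_right_mono)
    finally show ?thesis .
  next
    case (finite p)
    define p' where "p' = p / (p - 1)"
    have p': "1 < p'" "conj_index q = ereal p'" "1/p' + 1/p = 1"
      using finite by (auto simp: p'_def conj_index_ereal field_simps)
    define a where "a = lp_norm (conj_index q) f"
    define b where "b = lp_norm q g"
    show ?thesis
    proof (cases "a = 0 \<or> b = 0")
      case True
      then have "norm (f m) * norm (g m) = 0" for m
        using lp_norm_ge[OF c(1) f, of m] lp_norm_ge[OF q(1) g, of m] by (auto simp: a_def b_def)
      then have "(\<Sum>m\<in>F. norm (f m) * norm (g m)) = 0" by (intro sum.neutral ballI)
      then show ?thesis using mult_nonneg_nonneg[OF nn] by linarith
    next
      case False
      then have ab: "0 < a" "0 < b" using nn by (auto simp: a_def b_def)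
      have "(\<Sum>m\<in>F. norm (f m) / a * (norm (g m) / b))
          \<le> (\<Sum>m\<in>F. (norm (f m) / a) powr p' / p' + (norm (g m) / b) powr p / p)"
        using ab p' finite by (intro sum_mono Youngs_inequality) auto
      also have "\<dots> = (\<Sum>m\<in>F. norm (f m) powr p') / a powr p' / p' + (\<Sum>m\<in>F. norm (g m) powr p) / b powr p / p"
        by (simp add: sum.distrib sum_divide_distrib powr_divide)
      also have "\<dots> \<le> 1 / p' + 1 / p"
        using lp_ereal_sum_le[of p' f F] lp_ereal_sum_le[of p g F] f g finite p' F ab
        by (intro add_mono divide_right_mono) (auto simp: a_def b_def)
      also have "\<dots> = 1" by (rule p'(3))
      finally have "(\<Sum>m\<in>F. norm (f m) * norm (g m)) / (a * b) \<le> 1"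
        by (simp add: sum_divide_distrib)
      then show ?thesis using ab by (simp add: a_def b_def)
    qed
  qed
qed

lemma Holder_pairing:
  fixes f g :: "int ^ 'd::finite \<Rightarrow> 'a::chilbert_space"
  assumes q: "q \<in> lp_index" "q \<noteq> 0" and f: "f \<in> lp (conj_index q)" and g: "g \<in> lp q"
  shows "(\<lambda>m. norm (cinner (f m) (g m))) summable_on UNIV"
    "cmod (pairing f g) \<le> lp_norm (conj_index q) f * lp_norm q g"
proof -
  have le: "(\<Sum>m\<in>F. norm (cinner (f m) (g m))) \<le> lp_norm (conj_index q) f * lp_norm q g"
    if "finite F" for F
    using sum_mono[of F "\<lambda>m. norm (cinner (f m) (g m))" "\<lambda>m. norm (f m) * norm (g m)"]
      Holder_sum[OF q f g that] cinner_Cauchy_Schwarz by fastforce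
  show s: "(\<lambda>m. norm (cinner (f m) (g m))) summable_on UNIV"
    by (rule nonneg_bdd_above_summable_on) (auto intro!: bdd_aboveI2 le)
  show "cmod (pairing f g) \<le> lp_norm (conj_index q) f * lp_norm q g"
    unfolding pairing_def
    using norm_infsum_bound[OF s] infsum_le_finite_sums[OF s] le by fastforce
qed

text \<open>The extremal vector in Hoelder's inequality: normalized entries for q = 1, one entry of
  maximal norm for q = \<infinity>, and v |v|^(p-2) / L^(p-1) for finite p > 1, where L is the norm
  of the truncation. It converts bounds on pairings into bounds on norms of truncations.\<close>

lemma lp_norming_functional:
  fixes v :: "int ^ 'd::finite \<Rightarrow> 'a::chilbert_space"
  assumes q: "q \<in> lp_index" "q \<noteq> 0" and F: "finite F"
  shows "\<exists>f. (\<forall>m. m \<notin> F \<longrightarrow> f m = 0) \<and> lp_norm (conj_index q) f \<le> 1 \<and>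
    (\<Sum>m\<in>F. cinner (f m) (v m)) = of_real (lp_norm q (trunc F v))"
proof -
  have sc: "cinner (scaleR c x) x = of_real (c * (norm x)\<^sup>2)" for c and x :: 'a
    by (simp add: cinner_scaleR_left cinner_self)
  have zn: "lp_norm r (\<lambda>_ :: int ^ 'd. 0 :: 'a) = 0" if "r \<in> lp_index" for r
    by (rule lp_const_zero(2)[OF that])
  show ?thesis using q
  proof (cases rule: lp_index_cases')
    case one
    define f where "f m = (if m \<in> F then scaleR (1 / norm (v m)) (v m) else 0)" for m
    have "lp_norm (conj_index q) f \<le> 1"
      by (rule lp_sup_boundI(2)) (auto simp: f_def one)
    moreover have "(\<Sum>m\<in>F. cinner (f m) (v m)) = (\<Sum>m\<in>F. of_real (norm (v m)))"
      by (intro sum.cong) (auto simp: f_def sc power2_eq_square)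
    moreover have "lp_norm q (trunc F v) = (\<Sum>m\<in>F. norm (v m))"
      using lp_one_finite_support(2)[OF F, of "trunc F v"] one by (simp add: trunc_def)
    moreover have "\<forall>m. m \<notin> F \<longrightarrow> f m = 0" by (simp add: f_def)
    ultimately show ?thesis by (intro exI[of _ f]) simp
  next
    case infty
    show ?thesis
    proof (cases "F = {}")
      case True
      then show ?thesis
        using zn[of 1] zn[OF q(1)]
        by (intro exI[of _ "\<lambda>_. 0"]) (simp add: infty trunc_def)
    next
      case False
      obtain n where n: "n \<in> F" "\<And>m. m \<in> F \<Longrightarrow> norm (v m) \<le> norm (v n)"
        using obtains_MAX[OF F False, of "\<lambda>m. norm (v m)"] Max_ge[OF finite_imageI[OF F]]
        by (metis imageI)
      define f where "f = single n (scaleR (1 / norm (v n)) (v n))"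
      have "lp_norm (conj_index q) f \<le> 1"
        unfolding f_def by (simp add: infty single_lp(2))
      moreover have "(\<Sum>m\<in>F. cinner (f m) (v m)) = of_real (norm (v n))"
      proof -
        have "(\<Sum>m\<in>F. cinner (f m) (v m)) = (\<Sum>m\<in>F. if m = n then of_real (norm (v n)) else 0)"
          by (intro sum.cong) (auto simp: f_def single_def sc power2_eq_square)
        then show ?thesis using n F by simp
      qed
      moreover have "lp_norm q (trunc F v) = norm (v n)"
      proof (rule antisym)
        show "lp_norm q (trunc F v) \<le> norm (v n)"
          by (rule lp_sup_boundI(2)) (use n infty in \<open>auto simp: trunc_def\<close>)
        have "trunc F v \<in> lp q" using trunc_lp_one[OF F] lp_one_imp[OF q(1)] by blast
        then show "norm (v n) \<le> lp_norm q (trunc F v)"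
          using lp_norm_ge[OF q(1), of "trunc F v" n] n by (simp add: trunc_def)
      qed
      moreover have "\<forall>m. m \<notin> F \<longrightarrow> f m = 0" using n by (auto simp: f_def single_def)
      ultimately show ?thesis by (intro exI[of _ f]) simp
    qed
  next
    case (finite p)
    define p' where "p' = p / (p - 1)"
    have p': "1 < p'" "conj_index q = ereal p'" "(p - 1) * p' = p"
      using finite by (auto simp: p'_def conj_index_ereal field_simps)
    define L where "L = lp_norm q (trunc F v)"
    have tr: "trunc F v \<in> lp q" using trunc_lp_one[OF F] lp_one_imp[OF q(1)] by blast
    have L0: "0 \<le> L" unfolding L_def by (rule lp_norm_nonneg[OF tr q(1)])
    have Lp: "L powr p = (\<Sum>m\<in>F. norm (v m) powr p)"
    proof -
      have "L powr p = (\<Sum>\<^sub>\<infinity>m. norm (trunc F v m) powr p)"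
        unfolding L_def finite(1) by (rule lp_norm_ereal_powr) (use finite in simp)
      also have "\<dots> = (\<Sum>m\<in>F. norm (v m) powr p)"
        by (rule infsumI, rule has_sum_finite_neutralI[OF F]) (auto simp: trunc_def)
      finally show ?thesis .
    qed
    show ?thesis
    proof (cases "L = 0")
      case True
      then show ?thesis
        using zn[OF conj_index_mem(1)[OF q]]
        by (intro exI[of _ "\<lambda>_. 0"]) (simp add: L_def)
    next
      case False
      then have L: "0 < L" using L0 by simp
      define f where "f m = (if m \<in> F then scaleR (norm (v m) powr (p - 2) / L powr (p - 1)) (v m) else 0)" for m
      have nf: "norm (f m) = (norm (v m) / L) powr (p - 1)" if "m \<in> F" for m
      proof (cases "v m = 0")
        case False
        have "norm (v m) powr (p - 2) * norm (v m) = norm (v m) powr (p - 1)"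
          using False powr_add[of "norm (v m)" "p - 2" 1] by simp
        then show ?thesis using that by (simp add: f_def powr_divide)
      qed (use that in \<open>simp add: f_def\<close>)
      have "lp_norm (conj_index q) f \<le> 1"
        unfolding p'(2)
      proof (rule lp_ereal_boundI(2))
        fix G :: "(int ^ 'd) set" assume G: "finite G"
        have "(\<Sum>m\<in>G. norm (f m) powr p') = (\<Sum>m\<in>G \<inter> F. norm (f m) powr p')"
          using G by (intro sum.mono_neutral_right) (auto simp: f_def)
        also have "\<dots> \<le> (\<Sum>m\<in>F. norm (f m) powr p')"
          using F by (intro sum_mono2) auto
        also have "\<dots> = (\<Sum>m\<in>F. norm (v m) powr p / L powr p)"
          by (intro sum.cong) (auto simp: nf powr_powr p'(3) powr_divide)
        also have "\<dots> = 1" using L by (simp add: sum_divide_distrib[symmetric] Lp[symmetric])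
        finally show "(\<Sum>m\<in>G. norm (f m) powr p') \<le> 1 powr p'" by simp
      qed (use p' in auto)
      moreover have "(\<Sum>m\<in>F. cinner (f m) (v m)) = of_real L"
      proof -
        have "(\<Sum>m\<in>F. cinner (f m) (v m)) = (\<Sum>m\<in>F. of_real (norm (v m) powr p / L powr (p - 1)))"
        proof (rule sum.cong[OF refl])
          fix m assume m: "m \<in> F"
          have "norm (v m) powr (p - 2) * (norm (v m))\<^sup>2 = norm (v m) powr p"
            using powr_add[of "norm (v m)" "p - 2" 2] by (cases "v m = 0") auto
          then show "cinner (f m) (v m) = of_real (norm (v m) powr p / L powr (p - 1))"
            using m by (simp add: f_def sc flip: of_real_mult of_real_divide of_real_power)
        qed
        also have "\<dots> = of_real (L powr p / L powr (p - 1))"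
          by (simp add: Lp sum_divide_distrib)
        also have "L powr p / L powr (p - 1) = L"
          using L by (simp flip: powr_diff)
        finally show ?thesis .
      qed
      moreover have "\<forall>m. m \<notin> F \<longrightarrow> f m = 0" by (simp add: f_def)
      ultimately show ?thesis by (intro exI[of _ f]) (simp add: L_def)
    qed
  qed
qed

section \<open>Linearity and continuity of the pairing\<close>

lemma dual_pair_summable:
  fixes f g :: "int ^ 'd::finite \<Rightarrow> 'a::chilbert_space"
  assumes "dual_pair f g"
  shows "(\<lambda>m. cinner (f m) (g m)) summable_on UNIV"
proof -
  have "(\<lambda>m. norm (cinner (f m) (g m))) summable_on UNIV" if "f \<in> lp \<infinity>" "g \<in> lp 1" for f g :: "int ^ 'd \<Rightarrow> 'a"
  proof (rule Infinite_Sum.abs_summable_on_comparison_test)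
    show "(\<lambda>m. norm (lp_norm \<infinity> f * norm (g m))) summable_on UNIV"
      using that lp_norm_nonneg[of f \<infinity>]
      by (simp add: lp_one_iff norm_mult abs_of_nonneg summable_on_cmult_right)
    show "norm (cinner (f m) (g m)) \<le> norm (lp_norm \<infinity> f * norm (g m))" for m
      using cinner_Cauchy_Schwarz[of "f m" "g m"] lp_norm_infty_ge[OF that(1), of m] lp_norm_nonneg[of f \<infinity>] that
        mult_right_mono[of "norm (f m)" "lp_norm \<infinity> f" "norm (g m)"] by (simp add: norm_mult)
  qed
  moreover have "(\<lambda>m. norm (cinner (f m) (g m))) summable_on UNIV" if "f \<in> lp 1" "g \<in> lp \<infinity>"
    using Holder_pairing(1)[of \<infinity> f g] that by simp
  ultimately have "(\<lambda>m. norm (cinner (f m) (g m))) summable_on UNIV"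
    using assms unfolding dual_pair_def by blast
  then show ?thesis by (rule abs_summable_summable)
qed

lemma pairing_commute: "pairing f g = cnj (pairing g f)"
proof -
  have "pairing f g = (\<Sum>\<^sub>\<infinity>m. cnj (cinner (g m) (f m)))"
    unfolding pairing_def by (subst cinner_commute) (rule refl)
  then show ?thesis by (simp add: pairing_def)
qed

lemma pairing_bound_infty_one:
  assumes "f \<in> lp \<infinity>" "g \<in> lp 1"
  shows "cmod (pairing f g) \<le> lp_norm \<infinity> f * lp_norm 1 g"
  using Holder_pairing(2)[of \<infinity> g f] assms pairing_commute[of f g] by (simp add: mult.commute)

lemma dual_pair_commute: "dual_pair f g \<longleftrightarrow> dual_pair g f"
  by (auto simp: dual_pair_def)

lemma dual_pair_add:
  assumes "dual_pair f g" "dual_pair f' g"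
  shows "pairing (\<lambda>m. f m + f' m) g = pairing f g + pairing f' g"
    "pairing (\<lambda>m. f m - f' m) g = pairing f g - pairing f' g"
  using infsum_add[OF dual_pair_summable[OF assms(1)] dual_pair_summable[OF assms(2)]]
    infsum_diff[OF dual_pair_summable[OF assms(1)] dual_pair_summable[OF assms(2)]]
  by (simp_all add: pairing_def cinner_add_left cinner_diff_left)

lemma dual_pair_add_right:
  assumes "dual_pair f g" "dual_pair f g'"
  shows "pairing f (\<lambda>m. g m + g' m) = pairing f g + pairing f g'"
  using infsum_add[OF dual_pair_summable[OF assms(1)] dual_pair_summable[OF assms(2)]]
  by (simp add: pairing_def cinner_add_right)

lemma pairing_scaleC: "pairing (\<lambda>m. scaleC c (f m)) g = c * pairing f g"
    "pairing f (\<lambda>m. scaleC c (g m)) = cnj c * pairing f g"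
  by (simp_all add: pairing_def cinner_scaleC_left cinner_scaleC_right infsum_cmult_right')

lemma pairing_finite_support:
  assumes "finite F" "\<And>m. m \<notin> F \<Longrightarrow> f m = 0"
  shows "pairing f g = (\<Sum>m\<in>F. cinner (f m) (g m))"
  unfolding pairing_def
  by (rule infsumI, rule has_sum_finite_neutralI[OF assms(1)]) (auto simp: assms(2))

lemma pairing_trunc: "finite F \<Longrightarrow> pairing (trunc F f) g = (\<Sum>m\<in>F. cinner (f m) (g m))"
  using pairing_finite_support[of F "trunc F f" g] by (simp add: trunc_def)

lemma pairing_single [simp]: "pairing (single m h) g = cinner h (g m)"
  using pairing_finite_support[of "{m}" "single m h" g] by (simp add: single_def)

lemma pairing_single_right [simp]: "pairing f (single m h) = cinner (f m) h"
  by (metis pairing_commute cinner_commute pairing_single)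

lemma pairing_extensionality:
  assumes "\<And>m h. pairing (single m h) f = pairing (single m h) g"
  shows "f = g"
  by (rule ext, rule cinner_extensionality) (use assms in simp)

text \<open>For bounded \<open>f\<close> this is the weak-star density of finite sequences in
  l^infty; it stands in for norm density, which fails there.\<close>

lemma pairing_trunc_tendsto:
  assumes "dual_pair f g"
  shows "((\<lambda>F. pairing (trunc F f) g) \<longlongrightarrow> pairing f g) (finite_subsets_at_top UNIV)"
proof -
  have "((\<lambda>F. \<Sum>m\<in>F. cinner (f m) (g m)) \<longlongrightarrow> pairing f g) (finite_subsets_at_top UNIV)"
    unfolding pairing_def by (rule infsum_tendsto[OF dual_pair_summable[OF assms]])
  then show ?thesis
  proof (rule Lim_transform_eventually)
    show "eventually (\<lambda>F. (\<Sum>m\<in>F. cinner (f m) (g m)) = pairing (trunc F f) g) (finite_subsets_at_top UNIV)"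
      unfolding eventually_finite_subsets_at_top by (auto simp: pairing_trunc)
  qed
qed

lemma trunc_tendsto_pointwise: "((\<lambda>F. trunc F f m) \<longlongrightarrow> f m) (finite_subsets_at_top UNIV)"
proof (rule tendsto_eventually)
  show "eventually (\<lambda>F. trunc F f m = f m) (finite_subsets_at_top UNIV)"
    unfolding eventually_finite_subsets_at_top
    by (intro exI[of _ "{m}"]) (auto simp: trunc_def)
qed

text \<open>The coordinate (V g)_m is the Riesz vector of the functional sending h to the pairing of
  U (single m h) with g. Boundedness of V on l^q follows by pairing with norming sequences from the
  conjugate space. A conjugate index is never \<infinity>, so V is bounded on l^infty as well
  although U is only controlled at the other indices.\<close>

lemma adjoint_exists:
  fixes U :: "(int ^ 'd::finite \<Rightarrow> 'a::chilbert_space) \<Rightarrow> (int ^ 'd \<Rightarrow> 'b::chilbert_space)"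
  assumes U: "\<And>q. q \<in> lp_index \<Longrightarrow> q \<noteq> \<infinity> \<Longrightarrow> lp_operator q U"
  shows "\<exists>V. (\<forall>q\<in>lp_index. lp_operator q V) \<and>
    (\<forall>f\<in>lp 1. \<forall>g\<in>lp \<infinity>. pairing (U f) g = pairing f (V g)) \<and>
    (\<forall>f\<in>lp 0. \<forall>g\<in>lp 1. pairing (U f) g = pairing f (V g))"
proof -
  have U1: "lp_operator 1 U" and U0: "lp_operator 0 U" using U by auto
  have s1: "single m h \<in> lp 1" for m and h :: 'a by (rule single_lp) simp
  have dp: "dual_pair (U f) g" if "f \<in> lp 1" "g \<in> lp \<infinity>" for f g
    using lp_operator_mem[OF U1 that(1)] that by (simp add: dual_pair_def)
  have "\<exists>v. \<forall>h. pairing (U (single m h)) g = cinner h v" if g: "g \<in> lp \<infinity>" for g m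
  proof (rule riesz_representation, unfold bounded_clinear_functional_def, intro conjI allI)
    obtain C where C: "0 \<le> C" "\<And>f. f \<in> lp 1 \<Longrightarrow> lp_norm 1 (U f) \<le> C * lp_norm 1 f"
      using lp_operator_bound[OF U1] by auto
    have sc: "pairing (U (single m (scaleC c h))) g = c * pairing (U (single m h)) g" for c h
    proof -
      have "single m (scaleC c h) = (\<lambda>n. scaleC c (single m h n))"
        by (auto simp: single_def)
      then show ?thesis by (simp add: lp_operator_scaleC[OF U1 s1] pairing_scaleC)
    qed
    then show "pairing (U (single m (scaleC c h))) g = c * pairing (U (single m h)) g" for c h .
    show "bounded_linear (\<lambda>h. pairing (U (single m h)) g)"
    proof (rule bounded_linear_intro[where K = "C * lp_norm \<infinity> g"])
      fix h h' :: 'a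
      have "single m (h + h') = (\<lambda>n. single m h n + single m h' n)"
        by (auto simp: single_def)
      then show "pairing (U (single m (h + h'))) g = pairing (U (single m h)) g + pairing (U (single m h')) g"
        by (simp add: lp_operator_add[OF U1 s1 s1] dual_pair_add(1)[OF dp[OF s1 g] dp[OF s1 g]])
    next
      fix r :: real and h :: 'a
      show "pairing (U (single m (scaleR r h))) g = scaleR r (pairing (U (single m h)) g)"
        using sc[of "of_real r" h] by (simp add: scaleC_of_real scaleR_conv_of_real)
    next
      fix h :: 'a
      have "cmod (pairing (U (single m h)) g) \<le> lp_norm 1 (U (single m h)) * lp_norm \<infinity> g"
        using Holder_pairing(2)[of \<infinity> "U (single m h)" g] g lp_operator_mem[OF U1 s1] by simp
      also have "\<dots> \<le> (C * norm h) * lp_norm \<infinity> g"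
        using C(2)[OF s1[of m h]] single_lp(2)[of 1 m h] lp_norm_nonneg[OF g]
        by (intro mult_right_mono) auto
      finally show "norm (pairing (U (single m h)) g) \<le> norm h * (C * lp_norm \<infinity> g)"
        by (simp add: mult_ac)
    qed
  qed
  then obtain V where V: "\<And>g m h. g \<in> lp \<infinity> \<Longrightarrow> pairing (U (single m h)) g = cinner h (V g m)"
    by metis
  have fin: "pairing (U f) g = (\<Sum>m\<in>F. cinner (f m) (V g m))"
    if F: "finite F" "\<And>m. m \<notin> F \<Longrightarrow> f m = 0" and g: "g \<in> lp \<infinity>" for F f g
  proof -
    have f: "f = trunc F f" using F(2) by (auto simp: trunc_def)
    have "pairing (\<lambda>m. \<Sum>n\<in>G. U (single n (f n)) m) g = (\<Sum>n\<in>G. cinner (f n) (V g n)) \<and>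
        (\<lambda>m. \<Sum>n\<in>G. U (single n (f n)) m) \<in> lp 1" if "finite G" for G
      using that
    proof (induction G)
      case empty
      then show ?case by (simp add: pairing_def lp_const_zero)
    next
      case (insert n G)
      have 1: "U (single n (f n)) \<in> lp 1" by (rule lp_operator_mem[OF U1 s1])
      have "dual_pair (U (single n (f n))) g" "dual_pair (\<lambda>m. \<Sum>n\<in>G. U (single n (f n)) m) g"
        using 1 insert g by (auto simp: dual_pair_def)
      then show ?case using insert lp_add(1)[OF _ 1] by (simp add: dual_pair_add V[OF g])
    qed
    from this[OF F(1)] have "pairing (U (trunc F f)) g = (\<Sum>n\<in>F. cinner (f n) (V g n))"
      by (simp add: lp_operator_trunc[OF U1 _ F(1)])
    then show ?thesis using f by simp
  qed
  have Vadd: "V (\<lambda>m. f m + g m) = (\<lambda>m. V f m + V g m)" if fg: "f \<in> lp \<infinity>" "g \<in> lp \<infinity>" for f g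
  proof (rule ext, rule cinner_extensionality)
    fix m and h :: 'a
    have "(\<lambda>m. f m + g m) \<in> lp \<infinity>" by (rule lp_add(1)[OF _ fg]) simp
    then show "cinner h (V (\<lambda>m. f m + g m) m) = cinner h (V f m + V g m)"
      by (simp add: V[symmetric] fg cinner_add_right dual_pair_add_right[OF dp[OF s1] dp[OF s1]])
  qed
  have Vscale: "V (\<lambda>m. scaleC c (g m)) = (\<lambda>m. scaleC c (V g m))" if g: "g \<in> lp \<infinity>" for c g
  proof (rule ext, rule cinner_extensionality)
    fix m and h :: 'a
    have "(\<lambda>m. scaleC c (g m)) \<in> lp \<infinity>" by (rule lp_scaleC(1)[OF _ g]) simp
    then show "cinner h (V (\<lambda>m. scaleC c (g m)) m) = cinner h (scaleC c (V g m))"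
      by (simp add: V[symmetric] g cinner_scaleC_right pairing_scaleC)
  qed
  have Vop: "lp_operator q V" if q: "q \<in> lp_index" "q \<noteq> 0" for q
  proof -
    note c = conj_index_mem[OF q]
    obtain C where C: "0 \<le> C" "\<And>f. f \<in> lp (conj_index q) \<Longrightarrow> lp_norm (conj_index q) (U f) \<le> C * lp_norm (conj_index q) f"
      using lp_operator_bound[OF U[OF c] c(1)] by blast
    have bd: "V g \<in> lp q \<and> lp_norm q (V g) \<le> C * lp_norm q g" if g: "g \<in> lp q" for g
    proof -
      have gi: "g \<in> lp \<infinity>" by (rule lp_imp_infty[OF q(1) g])
      have nn: "0 \<le> lp_norm q g" by (rule lp_norm_nonneg[OF g q(1)])
      \<comment> \<open>Membership of \<open>V g\<close> is not known yet, so its finite truncations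
        are estimated and Fatou recovers the whole sequence.\<close>
      have "trunc F (V g) \<in> lp q \<and> lp_norm q (trunc F (V g)) \<le> C * lp_norm q g" if F: "finite F" for F
      proof -
        obtain f where f: "\<And>m. m \<notin> F \<Longrightarrow> f m = 0" "lp_norm (conj_index q) f \<le> 1"
          "(\<Sum>m\<in>F. cinner (f m) (V g m)) = of_real (lp_norm q (trunc F (V g)))"
          using lp_norming_functional[OF q F, of "V g"] by blast
        have fl: "f \<in> lp (conj_index q)"
          by (rule lp_one_imp(1)[OF c(1) lp_one_finite_support(1)[OF F f(1)]])
        have tr: "trunc F (V g) \<in> lp q" using trunc_lp_one[OF F] lp_one_imp[OF q(1)] by blast
        have "lp_norm q (trunc F (V g)) = cmod (pairing (U f) g)"
          using fin[of F f g, OF F f(1) gi] f(3) lp_norm_nonneg[OF tr q(1)] by simp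
        also have "\<dots> \<le> lp_norm (conj_index q) (U f) * lp_norm q g"
          by (rule Holder_pairing(2)[OF q lp_operator_mem[OF U[OF c] fl] g])
        also have "\<dots> \<le> C * lp_norm q g"
          using C(2)[OF fl] mult_left_mono[OF f(2) C(1)] nn by (intro mult_right_mono) auto
        finally show ?thesis using tr by simp
      qed
      then have ev: "eventually (\<lambda>F. trunc F (V g) \<in> lp q \<and> lp_norm q (trunc F (V g)) \<le> C * lp_norm q g)
          (finite_subsets_at_top UNIV)"
        unfolding eventually_finite_subsets_at_top by blast
      show ?thesis
        using lp_Fatou[OF q finite_subsets_at_top_neq_bot _ trunc_tendsto_pointwise ev] nn C(1) by simp
    qed
    have sub: "g \<in> lp q \<Longrightarrow> g \<in> lp \<infinity>" for g by (rule lp_imp_infty[OF q(1)])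
    show ?thesis unfolding lp_operator_def using bd Vadd Vscale sub by blast
  qed
  have V0: "lp_operator 0 V"
  proof -
    obtain C where C: "0 \<le> C" "\<And>f. f \<in> lp \<infinity> \<Longrightarrow> lp_norm \<infinity> (V f) \<le> C * lp_norm \<infinity> f"
      using lp_operator_bound[OF Vop[of \<infinity>]] by auto
    \<comment> \<open>Index 0 is out of reach of the Fatou argument; instead \<open>V\<close> maps
      truncations into l^1 and is bounded in the sup norm.\<close>
    have "V g \<in> lp 0" if g: "g \<in> lp 0" for g
    proof (rule lp_zero_closed)
      fix e :: real assume e: "0 < e"
      obtain F where F: "finite F" "lp_norm 0 (\<lambda>m. g m - trunc F g m) < e / (C + 1)"
        by (rule trunc_approx[OF _ _ g, of "e / (C + 1)"]) (use e C in auto)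
      have t1: "trunc F g \<in> lp 1" by (rule trunc_lp_one[OF F(1)])
      have ti: "trunc F g \<in> lp \<infinity>" and gi: "g \<in> lp \<infinity>"
        using lp_imp_infty[OF _ t1] lp_zero_imp_infty[OF g] by auto
      have V0: "V (trunc F g) \<in> lp 0"
        using lp_operator_mem[OF Vop[of 1] t1] lp_one_imp(1)[of 0] by simp
      have di: "(\<lambda>m. g m - trunc F g m) \<in> lp \<infinity>" by (rule lp_diff(1)[OF _ gi ti]) simp
      have "norm (V g m - V (trunc F g) m) \<le> e" for m
      proof -
        have "V g m - V (trunc F g) m = V (\<lambda>m. g m - trunc F g m) m"
          using lp_operator_diff[OF Vop[of \<infinity>] _ gi ti] by simp
        also have "norm \<dots> \<le> lp_norm \<infinity> (V (\<lambda>m. g m - trunc F g m))"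
          by (rule lp_norm_infty_ge[OF lp_operator_mem[OF Vop[of \<infinity>] di]]) auto
        also have "\<dots> \<le> C * lp_norm \<infinity> (\<lambda>m. g m - trunc F g m)" by (rule C(2)[OF di])
        also have "\<dots> \<le> C * (e / (C + 1))"
          using F(2) C(1) by (intro mult_left_mono) (auto simp: lp_norm_zero_eq)
        also have "\<dots> \<le> e" using e C(1) by (simp add: field_simps)
        finally show ?thesis .
      qed
      with V0 show "\<exists>f\<in>lp 0. \<forall>m. norm (V g m - f m) \<le> e" by blast
    qed
    then show ?thesis
      using lp_operator_restrict[OF Vop[of \<infinity>], of 0 C] C(2)
      by (auto simp: lp_zero_imp_infty lp_norm_zero_eq)
  qed
  \<comment> \<open>The identity passes from truncations to \<open>f\<close> by norm continuity of
    \<open>U\<close> on one side and by convergence of the pairing on the other.\<close>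
  have lim: "pairing (U f) g = pairing f (V g)"
    if r: "r = 0 \<and> g \<in> lp 1 \<or> r = 1 \<and> g \<in> lp \<infinity>" and f: "f \<in> lp r" for r f g
  proof -
    have ri: "r \<in> lp_index" "r \<noteq> \<infinity>" using r by auto
    have gi: "g \<in> lp \<infinity>" using r lp_imp_infty[of 1] by auto
    have "\<exists>C. \<forall>h\<in>lp r. cmod (pairing h g) \<le> lp_norm r h * C"
      using r
    proof (elim disjE conjE)
      assume "r = 0" "g \<in> lp 1"
      then show ?thesis
        using pairing_bound_infty_one[of _ g] lp_zero_imp_infty
        by (intro exI[of _ "lp_norm 1 g"]) (auto simp: lp_norm_zero_eq)
    next
      assume "r = 1" "g \<in> lp \<infinity>"
      then show ?thesis using Holder_pairing(2)[of \<infinity> _ g] by auto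
    qed
    then obtain C where C: "\<And>h. h \<in> lp r \<Longrightarrow> cmod (pairing h g) \<le> lp_norm r h * C" by blast
    have dpU: "dual_pair (U h) g" if "h \<in> lp r" for h
      using r lp_operator_mem[OF U[OF ri] that] by (auto simp: dual_pair_def lp_zero_imp_infty)
    have tl: "trunc F f \<in> lp r" for F by (rule trunc_lp(1)[OF ri(1) f])
    have dl: "(\<lambda>m. U (trunc F f) m - U f m) \<in> lp r" for F
      by (rule lp_diff(1)[OF ri(1)]; rule lp_operator_mem[OF U[OF ri]]; fact)
    have "((\<lambda>F. lp_norm r (\<lambda>m. U (trunc F f) m - U f m) * C) \<longlongrightarrow> 0) (finite_subsets_at_top UNIV)"
      by (rule tendsto_mult_left_zero)
        (rule lp_operator_tendsto[OF U[OF ri] ri(1) tl f trunc_tendsto[OF ri f]])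
    then have "((\<lambda>F. pairing (U (trunc F f)) g - pairing (U f) g) \<longlongrightarrow> 0) (finite_subsets_at_top UNIV)"
    proof (rule Lim_null_comparison[rotated], intro always_eventually allI)
      fix F
      show "norm (pairing (U (trunc F f)) g - pairing (U f) g) \<le> lp_norm r (\<lambda>m. U (trunc F f) m - U f m) * C"
        using C[OF dl[of F]] dual_pair_add(2)[OF dpU[OF tl] dpU[OF f]] by simp
    qed
    then have 1: "((\<lambda>F. pairing (U (trunc F f)) g) \<longlongrightarrow> pairing (U f) g) (finite_subsets_at_top UNIV)"
      by (rule LIM_zero_cancel)
    have "dual_pair f (V g)"
      using r f lp_operator_mem[OF Vop[of 1], of g] lp_operator_mem[OF Vop[of \<infinity>], of g]
      by (auto simp: dual_pair_def lp_zero_imp_infty)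
    from pairing_trunc_tendsto[OF this]
    have "((\<lambda>F. pairing (U (trunc F f)) g) \<longlongrightarrow> pairing f (V g)) (finite_subsets_at_top UNIV)"
    proof (rule Lim_transform_eventually)
      have "pairing (trunc F f) (V g) = pairing (U (trunc F f)) g" if "finite F" for F
        using fin[OF that, of "trunc F f" g] gi pairing_trunc[OF that, of f "V g"] by (simp add: trunc_def)
      then show "eventually (\<lambda>F. pairing (trunc F f) (V g) = pairing (U (trunc F f)) g) (finite_subsets_at_top UNIV)"
        unfolding eventually_finite_subsets_at_top by blast
    qed
    with 1 show ?thesis
      using tendsto_unique[OF finite_subsets_at_top_neq_bot] by blast
  qed
  show ?thesis
  proof (intro exI[of _ V] conjI ballI)
    show "lp_operator q V" if "q \<in> lp_index" for q using Vop[OF that] V0 by (cases "q = 0") auto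
    show "pairing (U f) g = pairing f (V g)" if "f \<in> lp 1" "g \<in> lp \<infinity>" for f g
      by (rule lim[of 1]) (use that in auto)
    show "pairing (U f) g = pairing f (V g)" if "f \<in> lp 0" "g \<in> lp 1" for f g
      by (rule lim[of 0]) (use that in auto)
  qed
qed

text \<open>Adjointness for both orders of the l^1, l^infty pairing makes U and V weak-star
  continuous on l^infty. This separates them from arbitrary bounded operators there and lets them be
  compared on single entries.\<close>

definition adj_pair ::
  "((int ^ 'd::finite \<Rightarrow> 'a::chilbert_space) \<Rightarrow> (int ^ 'd \<Rightarrow> 'b::chilbert_space)) \<Rightarrow>
    ((int ^ 'd \<Rightarrow> 'b) \<Rightarrow> (int ^ 'd \<Rightarrow> 'a)) \<Rightarrow> bool"
  where "adj_pair U V \<longleftrightarrow>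
    (\<forall>q\<in>lp_index. lp_operator q U \<and> lp_operator q V) \<and>
    (\<forall>f g. dual_pair f g \<longrightarrow> pairing (U f) g = pairing f (V g))"

lemma adj_pair_operator:
  "adj_pair U V \<Longrightarrow> q \<in> lp_index \<Longrightarrow> lp_operator q U"
  "adj_pair U V \<Longrightarrow> q \<in> lp_index \<Longrightarrow> lp_operator q V"
  by (auto simp: adj_pair_def)

lemma adj_pair_pairing: "adj_pair U V \<Longrightarrow> dual_pair f g \<Longrightarrow> pairing (U f) g = pairing f (V g)"
  by (auto simp: adj_pair_def)

lemma adj_pair_sym: "adj_pair U V \<Longrightarrow> adj_pair V U"
  unfolding adj_pair_def by (metis dual_pair_commute pairing_commute)

lemma lp_operator_id: "lp_operator q (\<lambda>f. f)"
  unfolding lp_operator_def by (auto intro!: exI[of _ 1])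

lemma adj_pair_id: "adj_pair (\<lambda>f. f) (\<lambda>f. f)"
  by (simp add: adj_pair_def lp_operator_id)

lemma adj_pair_mem:
  "adj_pair U V \<Longrightarrow> q \<in> lp_index \<Longrightarrow> f \<in> lp q \<Longrightarrow> U f \<in> lp q"
  "adj_pair U V \<Longrightarrow> q \<in> lp_index \<Longrightarrow> g \<in> lp q \<Longrightarrow> V g \<in> lp q"
  by (meson adj_pair_operator lp_operator_mem)+

lemma adj_pair_comp:
  fixes U :: "(int ^ 'd::finite \<Rightarrow> 'a::chilbert_space) \<Rightarrow> (int ^ 'd \<Rightarrow> 'b::chilbert_space)"
    and W :: "(int ^ 'd \<Rightarrow> 'b) \<Rightarrow> (int ^ 'd \<Rightarrow> 'c::chilbert_space)"
  assumes U: "adj_pair U V" and W: "adj_pair W X"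
  shows "adj_pair (\<lambda>f. W (U f)) (\<lambda>g. V (X g))"
  unfolding adj_pair_def
proof (intro conjI ballI allI impI)
  show "lp_operator q (\<lambda>f. W (U f))" "lp_operator q (\<lambda>g. V (X g))" if "q \<in> lp_index" for q
    using lp_operator_comp that adj_pair_operator[OF U that] adj_pair_operator[OF W that] by auto
  fix f :: "int ^ 'd \<Rightarrow> 'a" and g :: "int ^ 'd \<Rightarrow> 'c"
  assume d: "dual_pair f g"
  have 1: "dual_pair (U f) g"
    using d adj_pair_mem(1)[OF U, of _ f] unfolding dual_pair_def by auto
  have 2: "dual_pair f (X g)"
    using d adj_pair_mem(2)[OF W, of _ g] unfolding dual_pair_def by auto
  show "pairing (W (U f)) g = pairing f (V (X g))"
    using adj_pair_pairing[OF W 1] adj_pair_pairing[OF U 2] by simp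
qed

lemma adj_pair_cong:
  fixes U :: "(int ^ 'd::finite \<Rightarrow> 'a::chilbert_space) \<Rightarrow> (int ^ 'd \<Rightarrow> 'b::chilbert_space)"
  assumes "adj_pair U V" and "\<And>f. f \<in> lp \<infinity> \<Longrightarrow> U' f = U f" and "\<And>g. g \<in> lp \<infinity> \<Longrightarrow> V' g = V g"
  shows "adj_pair U' V'"
  unfolding adj_pair_def
proof (intro conjI ballI allI impI)
  show "lp_operator q U'" if q: "q \<in> lp_index" for q
    by (rule lp_operator_cong[OF adj_pair_operator(1)[OF assms(1) q] q])
      (rule assms(2)[OF lp_imp_infty[OF q]])
  show "lp_operator q V'" if q: "q \<in> lp_index" for q
    by (rule lp_operator_cong[OF adj_pair_operator(2)[OF assms(1) q] q])
      (rule assms(3)[OF lp_imp_infty[OF q]])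
  fix f :: "int ^ 'd \<Rightarrow> 'a" and g :: "int ^ 'd \<Rightarrow> 'b"
  assume d: "dual_pair f g"
  then have "f \<in> lp \<infinity>" "g \<in> lp \<infinity>" using lp_imp_infty[of 1] by (auto simp: dual_pair_def)
  then show "pairing (U' f) g = pairing f (V' g)"
    using adj_pair_pairing[OF assms(1) d] assms(2,3) by simp
qed

lemma dual_pair_single:
  assumes "f \<in> lp \<infinity>"
  shows "dual_pair (single m h) f" "dual_pair f (single m h)"
  using assms single_lp(1)[of 1 m h] by (auto simp: dual_pair_def)

text \<open>Transposing twice replaces density: agreement of U and U' on single entries gives
  agreement of V and V' there, and these l^1 values are the functionals that yield the coordinates
  of U f.\<close>

lemma adj_pair_unique:
  fixes U :: "(int ^ 'd::finite \<Rightarrow> 'a::chilbert_space) \<Rightarrow> (int ^ 'd \<Rightarrow> 'b::chilbert_space)"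
  assumes U: "adj_pair U V" and U': "adj_pair U' V'"
    and eq: "\<And>m h. U (single m h) = U' (single m h)" and f: "f \<in> lp \<infinity>"
  shows "U f = U' f"
proof (rule pairing_extensionality)
  fix m h
  have V: "V (single m h) = V' (single m h)"
  proof (rule pairing_extensionality)
    fix n and h' :: 'a
    have "dual_pair (single n h') (single m h)"
      by (rule dual_pair_single(2)) (rule single_lp, simp)
    then show "pairing (single n h') (V (single m h)) = pairing (single n h') (V' (single m h))"
      using adj_pair_pairing[OF U] adj_pair_pairing[OF U'] eq by metis
  qed
  show "pairing (single m h) (U f) = pairing (single m h) (U' f)"
    using adj_pair_pairing[OF adj_pair_sym[OF U] dual_pair_single(1)[OF f], of m h]
      adj_pair_pairing[OF adj_pair_sym[OF U'] dual_pair_single(1)[OF f], of m h] V by simp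
qed

text \<open>The operator \<open>U'\<close> is the bidual of the restriction of \<open>U\<close> to \<open>c\<^sub>0\<close>.\<close>

lemma adj_pair_extension:
  fixes U :: "(int ^ 'd::finite \<Rightarrow> 'a::chilbert_space) \<Rightarrow> (int ^ 'd \<Rightarrow> 'b::chilbert_space)"
  assumes U: "\<And>q. q \<in> lp_index \<Longrightarrow> q \<noteq> \<infinity> \<Longrightarrow> lp_operator q U"
  obtains U' V where "adj_pair U' V" "\<And>f. f \<in> lp 0 \<Longrightarrow> U' f = U f"
proof -
  obtain V where V: "\<And>q. q \<in> lp_index \<Longrightarrow> lp_operator q V"
    "\<And>f g. f \<in> lp 1 \<Longrightarrow> g \<in> lp \<infinity> \<Longrightarrow> pairing (U f) g = pairing f (V g)"
    "\<And>f g. f \<in> lp 0 \<Longrightarrow> g \<in> lp 1 \<Longrightarrow> pairing (U f) g = pairing f (V g)"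
    using adjoint_exists[OF U] by blast
  obtain W where W: "\<And>q. q \<in> lp_index \<Longrightarrow> lp_operator q W"
    "\<And>f g. g \<in> lp 1 \<Longrightarrow> f \<in> lp \<infinity> \<Longrightarrow> pairing (V g) f = pairing g (W f)"
    using adjoint_exists[OF V(1)] by blast
  have eq: "W f = U f" if f: "f \<in> lp 0" for f
  proof (rule pairing_extensionality)
    fix m :: "int ^ 'd" and h :: 'b
    have 1: "single m h \<in> lp 1" by (rule single_lp) simp
    have "pairing (single m h) (W f) = pairing (V (single m h)) f"
      using W(2)[OF 1 lp_zero_imp_infty[OF f]] by simp
    also have "\<dots> = cnj (pairing (U f) (single m h))"
      using V(3)[OF f 1] pairing_commute[of "V (single m h)" f] by simp
    finally show "pairing (single m h) (W f) = pairing (single m h) (U f)"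
      using pairing_commute[of "single m h" "U f"] by simp
  qed
  have WV: "adj_pair W V" unfolding adj_pair_def
  proof (intro conjI ballI allI impI V(1) W(1))
    fix f :: "int ^ 'd \<Rightarrow> 'a" and g :: "int ^ 'd \<Rightarrow> 'b"
    assume "dual_pair f g"
    then show "pairing (W f) g = pairing f (V g)"
      unfolding dual_pair_def
    proof (elim disjE conjE)
      assume fg: "f \<in> lp \<infinity>" "g \<in> lp 1"
      have "pairing (W f) g = cnj (pairing g (W f))" by (rule pairing_commute)
      also have "\<dots> = pairing f (V g)"
        by (simp only: W(2)[OF fg(2,1), symmetric] pairing_commute[of f "V g"])
      finally show ?thesis .
    next
      assume fg: "f \<in> lp 1" "g \<in> lp \<infinity>"
      have "f \<in> lp 0" by (rule lp_one_imp(1)[OF _ fg(1)]) simp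
      then have "W f = U f" by (rule eq)
      then show ?thesis using V(2)[OF fg] by simp
    qed
  qed
  show ?thesis by (rule that[OF WV eq])
qed

section \<open>Uniform boundedness\<close>

text \<open>Successive perturbation: the centre moves by at most the current radius so that some A_i
  x has norm above n + 1, and the next radius is so small that all later moves change this norm by
  at most 1. The limit of the centres contradicts the pointwise bound.\<close>

lemma lp_Banach_Steinhaus:
  fixes A :: "'i \<Rightarrow> (int ^ 'd::finite \<Rightarrow> 'a::chilbert_space) \<Rightarrow> (int ^ 'd \<Rightarrow> 'b::chilbert_space)"
  assumes q: "q \<in> lp_index" and A: "\<And>i. i \<in> I \<Longrightarrow> lp_operator q (A i)"
    and ptw: "\<And>f. f \<in> lp q \<Longrightarrow> \<exists>B. \<forall>i\<in>I. lp_norm q (A i f) \<le> B"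
  shows "\<exists>C. \<forall>i\<in>I. \<forall>f\<in>lp q. lp_norm q (A i f) \<le> C * lp_norm q f"
proof (rule ccontr)
  assume "\<not> ?thesis"
  then have unb: "\<exists>i\<in>I. \<exists>f\<in>lp q. C * lp_norm q f < lp_norm q (A i f)" for C
    by (meson not_le)
  \<comment> \<open>A state consists of a centre and a radius.\<close>
  define P where "P = (\<lambda>(n::nat) s. fst s \<in> (lp q :: (int ^ 'd \<Rightarrow> 'a) set) \<and> (0::real) < snd s)"
  define Q where "Q = (\<lambda>n s s'. snd s' \<le> snd s / 2 \<and> lp_norm q (\<lambda>m. fst s' m - fst s m) \<le> snd s \<and>
    (\<exists>i\<in>I. real n + 1 < lp_norm q (A i (fst s')) \<and>
      (\<forall>f\<in>lp q. lp_norm q (A i f) \<le> 1 / (2 * snd s') * lp_norm q f)))"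
  have step: "\<exists>s'. P (Suc n) s' \<and> Q n s s'" if "P n s" for n s
  proof -
    obtain x \<delta> where s: "s = (x, \<delta>)" by (cases s)
    have x: "x \<in> lp q" and d: "0 < \<delta>" using that by (auto simp: P_def s)
    obtain i f where i: "i \<in> I" and f: "f \<in> lp q"
      and big: "(real n + 1) / \<delta> * lp_norm q f < lp_norm q (A i f)"
      using unb by blast
    obtain C where C: "0 \<le> C" "\<And>f. f \<in> lp q \<Longrightarrow> lp_norm q (A i f) \<le> C * lp_norm q f"
      using lp_operator_bound[OF A[OF i] q] by blast
    have nf: "0 < lp_norm q f"
      using big C(2)[OF f] lp_norm_nonneg[OF f q] by (cases "lp_norm q f = 0") auto
    define c where "c = \<delta> / lp_norm q f"
    have c: "0 < c" using d nf by (simp add: c_def)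
    define g where "g = (\<lambda>m. scaleC (of_real c) (f m))"
    have g: "g \<in> lp q" unfolding g_def by (rule lp_scaleC(1)[OF q f])
    have ng: "lp_norm q g = \<delta>"
    proof -
      have "cmod (of_real c) = c" using c by simp
      then show ?thesis unfolding g_def lp_scaleC(2)[OF q f] using nf by (simp add: c_def)
    qed
    have Ag: "real n + 1 < lp_norm q (A i g)"
    proof -
      have "lp_norm q (A i g) = c * lp_norm q (A i f)"
        unfolding g_def lp_operator_scaleC[OF A[OF i] f]
        using lp_scaleC(2)[OF q lp_operator_mem[OF A[OF i] f], of "of_real c"] c by simp
      moreover have "real n + 1 = c * ((real n + 1) / \<delta> * lp_norm q f)"
        using d nf by (simp add: c_def)
      ultimately show ?thesis using mult_strict_left_mono[OF big c] by simp
    qed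
    have xp: "(\<lambda>m. x m + g m) \<in> lp q" and xm: "(\<lambda>m. x m - g m) \<in> lp q"
      using lp_add(1)[OF q x g] lp_diff(1)[OF q x g] by auto
    \<comment> \<open>Since 2 A g = A (x + g) - A (x - g), one of the two perturbed centres has an
      image at least as large as that of \<open>g\<close>.\<close>
    have "2 * lp_norm q (A i g) \<le> lp_norm q (A i (\<lambda>m. x m + g m)) + lp_norm q (A i (\<lambda>m. x m - g m))"
    proof -
      have "A i (\<lambda>m. x m + g m) m - A i (\<lambda>m. x m - g m) m = scaleC 2 (A i g m)" for m
        using scaleC_add_left[of 1 1 "A i g m"]
        by (simp add: lp_operator_add[OF A[OF i] x g] lp_operator_diff[OF A[OF i] q x g])
      then have "lp_norm q (\<lambda>m. scaleC 2 (A i g m))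
          \<le> lp_norm q (A i (\<lambda>m. x m + g m)) + lp_norm q (A i (\<lambda>m. x m - g m))"
        using lp_diff(2)[OF q lp_operator_mem[OF A[OF i] xp] lp_operator_mem[OF A[OF i] xm]] by simp
      then show ?thesis using lp_scaleC(2)[OF q lp_operator_mem[OF A[OF i] g], of 2] by simp
    qed
    then have "real n + 1 < lp_norm q (A i (\<lambda>m. x m + g m)) \<or> real n + 1 < lp_norm q (A i (\<lambda>m. x m - g m))"
      using Ag by linarith
    then obtain x' where x': "x' \<in> lp q" "real n + 1 < lp_norm q (A i x')"
      "lp_norm q (\<lambda>m. x' m - x m) \<le> \<delta>"
    proof
      assume "real n + 1 < lp_norm q (A i (\<lambda>m. x m + g m))"
      then show thesis using that[OF xp] ng by simp
    next
      assume "real n + 1 < lp_norm q (A i (\<lambda>m. x m - g m))"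
      then show thesis using that[OF xm] ng lp_minus(2)[of q g] by simp
    qed
    \<comment> \<open>The limit stays within 2 \<delta>' of the new centre, so the operator bound
      1/(2 \<delta>') limits the change of the image to 1.\<close>
    define \<delta>' where "\<delta>' = min (\<delta> / 2) (1 / (2 * (C + 1)))"
    have d': "0 < \<delta>'" "\<delta>' \<le> \<delta> / 2" using d C(1) by (auto simp: \<delta>'_def)
    have "\<delta>' \<le> 1 / (2 * (C + 1))" by (simp add: \<delta>'_def)
    then have "C \<le> 1 / (2 * \<delta>')" using d' C(1) by (simp add: field_simps)
    then have "lp_norm q (A i h) \<le> 1 / (2 * \<delta>') * lp_norm q h" if "h \<in> lp q" for h
      using C(2)[OF that] mult_right_mono[OF _ lp_norm_nonneg[OF that q]] by (meson order_trans)
    then have "P (Suc n) (x', \<delta>') \<and> Q n s (x', \<delta>')"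
      using x' d' i by (auto simp: P_def Q_def s)
    then show ?thesis by blast
  qed
  have init: "P 0 (\<lambda>_. 0, 1)" by (simp add: P_def lp_const_zero(1)[OF q])
  obtain S where S: "\<And>n. P n (S n)" "\<And>n. Q n (S n) (S (Suc n))"
    using dependent_nat_choice[of P Q] init step by metis
  define x where "x n = fst (S n)" for n
  define d where "d n = snd (S n)" for n
  have x: "x n \<in> lp q" and d: "0 < d n" for n using S(1)[of n] by (auto simp: P_def x_def d_def)
  have dd: "d (Suc n) \<le> d n / 2" and xx: "lp_norm q (\<lambda>m. x (Suc n) m - x n m) \<le> d n" for n
    using S(2)[of n] by (auto simp: Q_def x_def d_def)
  have ex: "\<exists>i\<in>I. real n + 1 < lp_norm q (A i (x (Suc n))) \<and>
      (\<forall>f\<in>lp q. lp_norm q (A i f) \<le> 1 / (2 * d (Suc n)) * lp_norm q f)" for n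
    using S(2)[of n] by (auto simp: Q_def x_def d_def)
  have dpow: "d (k + n) \<le> d n * (1/2) ^ k" for k n
  proof (induction k)
    case (Suc k)
    have "d (Suc k + n) \<le> d (k + n) / 2" using dd[of "k + n"] by simp
    also have "\<dots> \<le> d n * (1/2) ^ k / 2" using Suc by simp
    finally show ?case by simp
  qed simp
  define g where "g k = (\<lambda>m. x (Suc k) m - x k m)" for k
  have g: "g k \<in> lp q" for k unfolding g_def by (rule lp_diff(1)[OF q x x])
  have gd: "lp_norm q (g (k + n)) \<le> d n * (1/2) ^ k" for k n
    using xx[of "k + n"] dpow[of k n] by (simp add: g_def)
  have sgeo: "summable (\<lambda>k. d n * (1/2) ^ k)" for n by (intro summable_mult summable_geometric) simp
  have nn: "0 \<le> lp_norm q (g k)" for k by (rule lp_norm_nonneg[OF g q])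
  have sg: "summable (\<lambda>k. lp_norm q (g (k + n)))" for n
    by (rule summable_comparison_test'[OF sgeo[of n], of 0]) (use gd nn in auto)
  obtain y where y: "y \<in> lp q"
    "\<And>n. lp_norm q (\<lambda>m. y m - (\<Sum>k<n. g k m)) \<le> (\<Sum>k. lp_norm q (g (k + n)))"
    using lp_series[of q g, OF q g] sg[of 0] by auto
  have tail: "(\<Sum>k. lp_norm q (g (k + n))) \<le> 2 * d n" for n
  proof -
    have "(\<Sum>k. lp_norm q (g (k + n))) \<le> (\<Sum>k. d n * (1/2) ^ k)"
      by (rule suminf_le[OF gd sg sgeo])
    also have "\<dots> = 2 * d n"
      by (subst suminf_mult) (auto simp: suminf_geometric summable_geometric)
    finally show ?thesis .
  qed
  have tel: "(\<Sum>k<n. g k m) = x n m - x 0 m" for n m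
    using sum_lessThan_telescope[of "\<lambda>k. x k m" n] by (simp add: g_def)
  define z where "z = (\<lambda>m. y m + x 0 m)"
  have z: "z \<in> lp q" unfolding z_def by (rule lp_add(1)[OF q y(1) x])
  have zx: "lp_norm q (\<lambda>m. z m - x n m) \<le> 2 * d n" for n
    using y(2)[of n] tail[of n] by (simp add: tel z_def algebra_simps)
  obtain B where B: "\<And>i. i \<in> I \<Longrightarrow> lp_norm q (A i z) \<le> B" using ptw[OF z] by blast
  obtain n where n: "B < real n" using reals_Archimedean2 by blast
  obtain i where i: "i \<in> I" "real n + 1 < lp_norm q (A i (x (Suc n)))"
    and bd: "\<And>f. f \<in> lp q \<Longrightarrow> lp_norm q (A i f) \<le> 1 / (2 * d (Suc n)) * lp_norm q f"
    using ex[of n] by blast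
  have zd: "(\<lambda>m. z m - x (Suc n) m) \<in> lp q" by (rule lp_diff(1)[OF q z x])
  have "A i (x (Suc n)) = (\<lambda>m. A i z m - A i (\<lambda>m. z m - x (Suc n) m) m)"
    by (simp add: lp_operator_diff[OF A[OF i(1)] q z x])
  then have "lp_norm q (A i (x (Suc n))) \<le> lp_norm q (A i z) + lp_norm q (A i (\<lambda>m. z m - x (Suc n) m))"
    using lp_diff(2)[OF q lp_operator_mem[OF A[OF i(1)] z] lp_operator_mem[OF A[OF i(1)] zd]] by simp
  also have "\<dots> \<le> B + 1 / (2 * d (Suc n)) * (2 * d (Suc n))"
  proof (rule add_mono[OF B[OF i(1)]])
    show "lp_norm q (A i (\<lambda>m. z m - x (Suc n) m)) \<le> 1 / (2 * d (Suc n)) * (2 * d (Suc n))"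
      by (rule order_trans[OF bd[OF zd] mult_left_mono[OF zx]]) (use d[of "Suc n"] in simp)
  qed
  also have "\<dots> = B + 1" using d[of "Suc n"] by simp
  finally show False using i(2) n by simp
qed

text \<open>
  This replaces the closed graph theorem: the finite truncations of \<open>J f\<close> are bounded on
  \<open>\<ell>\<^sup>q\<close> because \<open>J\<close> is bounded on \<open>\<ell>\<^sup>\<infinity>\<close>.
\<close>

lemma lp_operator_if_invariant:
  fixes J :: "(int ^ 'd::finite \<Rightarrow> 'a::chilbert_space) \<Rightarrow> (int ^ 'd \<Rightarrow> 'b::chilbert_space)"
  assumes q: "q \<in> lp_index" and J: "lp_operator \<infinity> J" and inv: "\<And>f. f \<in> lp q \<Longrightarrow> J f \<in> lp q"
  shows "lp_operator q J"
proof -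
  obtain C where C: "0 \<le> C" "\<And>f. f \<in> lp \<infinity> \<Longrightarrow> lp_norm \<infinity> (J f) \<le> C * lp_norm \<infinity> f"
    using lp_operator_bound[OF J] by auto
  show ?thesis
  proof (cases "q = 0")
    case True
    show ?thesis
      by (rule lp_operator_restrict[OF J, of _ C])
        (use inv C(2) True in \<open>auto simp: lp_norm_zero_eq lp_zero_imp_infty\<close>)
  next
    case q0: False
    define A where "A F f = trunc F (J f)" for F f
    have A: "lp_operator q (A F)" if F: "finite F" for F
    proof -
      have 1: "lp_operator \<infinity> (A F)"
        unfolding lp_operator_def
      proof (intro conjI ballI allI exI[of _ C])
        show "A F f \<in> lp \<infinity>" if "f \<in> lp \<infinity>" for f
          unfolding A_def by (rule trunc_lp(1)[OF _ lp_operator_mem[OF J that]]) simp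
        show "A F (\<lambda>m. f m + g m) = (\<lambda>m. A F f m + A F g m)" if "f \<in> lp \<infinity>" "g \<in> lp \<infinity>" for f g
          by (auto simp: A_def lp_operator_add[OF J that] trunc_def)
        show "A F (\<lambda>m. scaleC c (f m)) = (\<lambda>m. scaleC c (A F f m))" if "f \<in> lp \<infinity>" for c f
          by (auto simp: A_def lp_operator_scaleC[OF J that] trunc_def)
        show "lp_norm \<infinity> (A F f) \<le> C * lp_norm \<infinity> f" if "f \<in> lp \<infinity>" for f
          unfolding A_def using trunc_lp(2)[OF _ lp_operator_mem[OF J that], of F] C(2)[OF that] by simp
      qed
      show ?thesis
      \<comment> \<open>Passing from l^q to l^1 costs the size of \<open>F\<close>. This only shows
        that each truncated operator is bounded; the bound uniform in \<open>F\<close> comes from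
        uniform boundedness.\<close>
      proof (rule lp_operator_restrict[OF 1, of _ "real (card F) * C"])
        fix f :: "int ^ 'd \<Rightarrow> 'a" assume f: "f \<in> lp q"
        show fi: "f \<in> lp \<infinity>" by (rule lp_imp_infty[OF q f])
        have t1: "A F f \<in> lp 1" unfolding A_def by (rule trunc_lp_one[OF F])
        have "lp_norm q (A F f) \<le> lp_norm 1 (A F f)" by (rule lp_one_imp(2)[OF q t1])
        also have "\<dots> = (\<Sum>m\<in>F. norm (J f m))"
          using lp_one_finite_support(2)[OF F, of "A F f"] by (simp add: A_def trunc_def)
        also have "\<dots> \<le> (\<Sum>m\<in>F. C * lp_norm q f)"
        proof (rule sum_mono)
          fix m
          have "norm (J f m) \<le> lp_norm \<infinity> (J f)" by (rule lp_norm_infty_ge[OF lp_operator_mem[OF J fi]])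
          also have "\<dots> \<le> C * lp_norm \<infinity> f" by (rule C(2)[OF fi])
          also have "\<dots> \<le> C * lp_norm q f" by (rule mult_left_mono[OF lp_norm_infty_le[OF q f] C(1)])
          finally show "norm (J f m) \<le> C * lp_norm q f" .
        qed
        finally show "A F f \<in> lp q \<and> lp_norm q (A F f) \<le> real (card F) * C * lp_norm q f"
          using lp_one_imp(1)[OF q t1] by (simp add: mult.assoc)
      qed
    qed
    have "\<exists>B. \<forall>F\<in>Collect finite. lp_norm q (A F f) \<le> B" if "f \<in> lp q" for f
      unfolding A_def using trunc_lp(2)[OF q inv[OF that]] by blast
    then have "\<exists>D. \<forall>F\<in>Collect finite. \<forall>f\<in>lp q. lp_norm q (A F f) \<le> D * lp_norm q f"
      by (intro lp_Banach_Steinhaus[OF q]) (auto simp: A)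
    then obtain D where D: "\<And>F f. finite F \<Longrightarrow> f \<in> lp q \<Longrightarrow> lp_norm q (A F f) \<le> D * lp_norm q f"
      by blast
    show ?thesis
    proof (rule lp_operator_restrict[OF J, of _ "\<bar>D\<bar>"])
      fix f :: "int ^ 'd \<Rightarrow> 'a" assume f: "f \<in> lp q"
      show "f \<in> lp \<infinity>" by (rule lp_imp_infty[OF q f])
      have nn: "0 \<le> lp_norm q f" by (rule lp_norm_nonneg[OF f q])
      have "trunc F (J f) \<in> lp q \<and> lp_norm q (trunc F (J f)) \<le> \<bar>D\<bar> * lp_norm q f" if "finite F" for F
        using D[OF that f] mult_right_mono[OF abs_ge_self[of D] nn] trunc_lp(1)[OF q inv[OF f]]
        unfolding A_def by fastforce
      then have ev: "eventually (\<lambda>F. trunc F (J f) \<in> lp q \<and> lp_norm q (trunc F (J f)) \<le> \<bar>D\<bar> * lp_norm q f)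
          (finite_subsets_at_top UNIV)"
        unfolding eventually_finite_subsets_at_top by blast
      show "J f \<in> lp q \<and> lp_norm q (J f) \<le> \<bar>D\<bar> * lp_norm q f"
        using lp_Fatou(2)[OF q q0 finite_subsets_at_top_neq_bot _ trunc_tendsto_pointwise ev] inv[OF f] nn
        by simp
    qed
  qed
qed

section \<open>Stability of localized operators\<close>

abbreviation zweight :: "int ^ 'd::finite \<Rightarrow> real"
  where "zweight j \<equiv> 1 + real_of_int (znorm j)"

text \<open>Off-diagonal decay is expressed through the operator instead of its entries. With r m =
  floor(\<alpha> m) it describes a slanted matrix, with r m = m the Gram operator, whose entries are
  never written out.\<close>

definition row_dominated ::
  "(int ^ 'd::finite \<Rightarrow> int ^ 'd) \<Rightarrow> (int ^ 'd \<Rightarrow> real) \<Rightarrow>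
    ((int ^ 'd \<Rightarrow> 'a::chilbert_space) \<Rightarrow> (int ^ 'd \<Rightarrow> 'b::chilbert_space)) \<Rightarrow> bool"
  where "row_dominated r w U \<longleftrightarrow>
    (\<forall>x\<in>lp \<infinity>. \<forall>m. norm (U x m) \<le> (\<Sum>\<^sub>\<infinity>n. w (r m - n) * norm (x n)))"

lemma zweight_ge_one: "1 \<le> zweight j"
  by simp

lemma zweight_triangle: "zweight (i - j) \<le> zweight i * zweight j"
proof -
  have "real_of_int (znorm (i - j)) \<le> real_of_int (znorm i) + real_of_int (znorm j)"
    using znorm_triangle[of i "- j"] by (simp flip: of_int_add)
  moreover have "0 \<le> real_of_int (znorm i) * real_of_int (znorm j)" by simp
  ultimately show ?thesis
    unfolding distrib_left distrib_right mult_1_left mult_1_right by linarith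
qed

text \<open>With z = (1+a)/(1+b) the difference equals (1+a)^(-t) (1 - z^t), and |1 - z| <=
  \<delta>. Keeping the factor (1+a)^(-t) makes the error relative to the weight itself, so that it
  can be absorbed.\<close>

lemma inverse_power_perturbation:
  fixes a b \<delta> :: real
  assumes a: "0 \<le> a" and b: "0 \<le> b" and d: "\<bar>a - b\<bar> \<le> \<delta>"
  shows "\<bar>1 / (1 + a) ^ t - 1 / (1 + b) ^ t\<bar> \<le> 1 / (1 + a) ^ t * (real t * \<delta> * (1 + \<delta>) ^ t)"
proof -
  define z where "z = (1 + a) / (1 + b)"
  have d0: "0 \<le> \<delta>" using d by simp
  have z0: "0 \<le> z" using a b by (simp add: z_def)
  have "1 - z = (b - a) / (1 + b)" using b by (simp add: z_def field_simps)
  then have "\<bar>1 - z\<bar> = \<bar>b - a\<bar> / (1 + b)" using b by simp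
  also have "\<dots> \<le> \<bar>b - a\<bar> / 1" using b by (intro divide_left_mono) auto
  finally have z1: "\<bar>1 - z\<bar> \<le> \<delta>" using d by simp
  have "\<bar>1 - z ^ t\<bar> = \<bar>1 - z\<bar> * \<bar>\<Sum>i<t. z ^ i\<bar>"
    by (simp add: one_diff_power_eq abs_mult)
  also have "\<dots> \<le> \<delta> * (\<Sum>i<t. (1 + \<delta>) ^ t)"
  proof (rule mult_mono[OF z1])
    have "z ^ i \<le> (1 + \<delta>) ^ t" if "i < t" for i
    proof -
      have "z ^ i \<le> (1 + \<delta>) ^ i" using z1 z0 by (intro power_mono) auto
      also have "\<dots> \<le> (1 + \<delta>) ^ t" using d0 that by (intro power_increasing) auto
      finally show ?thesis .
    qed
    then show "\<bar>\<Sum>i<t. z ^ i\<bar> \<le> (\<Sum>i<t. (1 + \<delta>) ^ t)"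
      using z0 by (simp add: abs_of_nonneg sum_nonneg) (rule sum_bounded_above[of "{..<t}", simplified], simp)
  qed (use d0 in auto)
  finally have *: "\<bar>1 - z ^ t\<bar> \<le> real t * \<delta> * (1 + \<delta>) ^ t" by (simp add: mult_ac)
  have "1 / (1 + a) ^ t - 1 / (1 + b) ^ t = 1 / (1 + a) ^ t * (1 - z ^ t)"
    using a b by (simp add: z_def power_divide field_simps)
  then have "\<bar>1 / (1 + a) ^ t - 1 / (1 + b) ^ t\<bar> = 1 / (1 + a) ^ t * \<bar>1 - z ^ t\<bar>"
    using a by (simp add: abs_mult)
  also have "\<dots> \<le> 1 / (1 + a) ^ t * (real t * \<delta> * (1 + \<delta>) ^ t)"
    using * a by (intro mult_left_mono) auto
  finally show ?thesis .
qed

text \<open>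
  The lower bound is applied to \<open>x\<close> multiplied by the slowly varying weight
  \<open>\<theta>\<^sub>k(n) = (1 + |n - k|/N)\<^sup>-\<^sup>t\<close>. The commutator of the operator with \<open>\<theta>\<^sub>k\<close> is \<open>O(1/N)\<close> relative to
  \<open>\<theta>\<^sub>k x\<close>, so for large \<open>N\<close> it can be absorbed. The resulting estimate no longer depends on
  the exponent \<open>q\<close>.
\<close>

lemma lower_bound_localizes:
  fixes U :: "(int ^ 'd::finite \<Rightarrow> 'a::chilbert_space) \<Rightarrow> (int ^ 'd \<Rightarrow> 'b::chilbert_space)"
    and r :: "int ^ 'd \<Rightarrow> int ^ 'd"
  assumes U: "lp_operator \<infinity> U" and dom: "row_dominated r w U" and w: "\<And>j. 0 \<le> w j"
    and s: "(\<lambda>j. w j * zweight j ^ (2 * CARD('d) + 1)) summable_on UNIV"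
    and r: "fibers_le K r" "1 \<le> K"
    and q: "q \<in> lp_index" and c: "0 < c"
    and below: "\<And>z. z \<in> lp q \<Longrightarrow> c * lp_norm q z \<le> lp_norm q (U z)"
  obtains \<kappa> where "\<And>j. 0 \<le> \<kappa> j" "\<kappa> summable_on UNIV"
    "\<And>x k. x \<in> lp \<infinity> \<Longrightarrow> norm (x k) \<le> (\<Sum>\<^sub>\<infinity>m. \<kappa> (r m - k) * norm (U x m))"
proof -
  \<comment> \<open>An exponent for which the weight is summable over the lattice, by comparison
    with products of inverse squares.\<close>
  define t where "t = 2 * CARD('d)"
  define v where "v j = w j * zweight j ^ (t + 1)" for j
  have v: "\<And>j. 0 \<le> v j" "v summable_on UNIV" using w s by (auto simp: v_def[abs_def] t_def)
  define V where "V = (\<Sum>\<^sub>\<infinity>j. v j)"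
  have V0: "0 \<le> V" unfolding V_def by (rule infsum_nonneg) (rule v)
  \<comment> \<open>Chosen so that the convolution bound for the commutator is at most c/2, half of
    the lower bound; the summand 1 keeps N >= 1.\<close>
  define N where "N = 2 * real t * real K * V / c + 1"
  have N1: "1 \<le> N" using V0 c by (simp add: N_def)
  have N: "real K * (real t / N * V) \<le> c / 2"
  proof -
    have "2 * real t * real K * V \<le> N * c" using c by (simp add: N_def field_simps)
    then show ?thesis using N1 by (simp add: field_simps)
  qed
  define \<theta> where "\<theta> j = 1 / (1 + real_of_int (znorm j) / N) ^ t" for j :: "int ^ 'd"
  have th0: "0 \<le> \<theta> j" for j
    using N1 by (simp add: \<theta>_def)
  have ths: "\<theta> summable_on UNIV"
  proof (rule summable_on_comparison_test)
    show "(\<lambda>j :: int ^ 'd. N ^ t * (1 / zweight j ^ t)) summable_on UNIV"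
      unfolding t_def by (rule summable_on_cmult_right[OF summable_on_inverse_znorm])
    show "\<theta> j \<le> N ^ t * (1 / zweight j ^ t)" for j
    proof -
      have "zweight j \<le> N * (1 + real_of_int (znorm j) / N)" using N1 by (simp add: distrib_left)
      then have "zweight j ^ t \<le> N ^ t * (1 + real_of_int (znorm j) / N) ^ t"
        unfolding power_mult_distrib[symmetric] by (intro power_mono) auto
      moreover have "0 < 1 + real_of_int (znorm j) / N" "0 < zweight j"
        using N1 by (auto intro!: add_pos_nonneg)
      then have "0 < (1 + real_of_int (znorm j) / N) ^ t" "0 < zweight j ^ t"
        by (auto simp only: zero_less_power)
      ultimately show ?thesis unfolding \<theta>_def by (simp add: field_simps)
    qed
  qed (rule th0)
  \<comment> \<open>The growth in l - n is (1 + \<delta>)^t, from the ratio of the weights, times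
    \<delta> itself: t + 1 powers of \<open>zweight\<close> are spent to gain the factor
    1/N.\<close>
  have comm: "\<bar>\<theta> (n - k) - \<theta> (l - k)\<bar> \<le> \<theta> (n - k) * (real t / N * zweight (l - n) ^ (t + 1))" for n k l
  proof -
    define \<delta> where "\<delta> = real_of_int (znorm (l - n)) / N"
    have tri: "real_of_int (znorm (x + y)) \<le> real_of_int (znorm x) + real_of_int (znorm y)" for x y :: "int ^ 'd"
      using znorm_triangle[of x y] by (simp flip: of_int_add)
    have "znorm (n - l) = znorm (l - n)" using znorm_minus[of "l - n"] by simp
    then have "\<bar>real_of_int (znorm (n - k)) - real_of_int (znorm (l - k))\<bar> \<le> real_of_int (znorm (l - n))"
      using tri[of "n - l" "l - k"] tri[of "l - n" "n - k"] by simp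
    then have d: "\<bar>real_of_int (znorm (n - k)) / N - real_of_int (znorm (l - k)) / N\<bar> \<le> \<delta>"
      using N1 by (simp add: \<delta>_def flip: diff_divide_distrib) (simp add: divide_right_mono)
    have "\<bar>\<theta> (n - k) - \<theta> (l - k)\<bar> \<le> \<theta> (n - k) * (real t * \<delta> * (1 + \<delta>) ^ t)"
      unfolding \<theta>_def by (rule inverse_power_perturbation[OF _ _ d]) (use N1 in auto)
    also have "\<dots> \<le> \<theta> (n - k) * (real t / N * zweight (l - n) ^ (t + 1))"
    proof (rule mult_left_mono[OF _ th0])
      have "real_of_int (znorm (l - n)) \<le> zweight (l - n)" by simp
      moreover have "\<delta> \<le> real_of_int (znorm (l - n))"
        unfolding \<delta>_def using N1 mult_left_mono[OF N1, of "real_of_int (znorm (l - n))"]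
        by (simp add: divide_le_eq)
      then have "(1 + \<delta>) ^ t \<le> zweight (l - n) ^ t"
        using N1 by (intro power_mono add_left_mono) (auto simp: \<delta>_def)
      ultimately have "real_of_int (znorm (l - n)) * (1 + \<delta>) ^ t \<le> zweight (l - n) * zweight (l - n) ^ t"
        using N1 by (intro mult_mono) (auto simp: \<delta>_def)
      then have "real t / N * (real_of_int (znorm (l - n)) * (1 + \<delta>) ^ t)
          \<le> real t / N * (zweight (l - n) * zweight (l - n) ^ t)"
        using N1 by (intro mult_left_mono) auto
      then show "real t * \<delta> * (1 + \<delta>) ^ t \<le> real t / N * zweight (l - n) ^ (t + 1)"
        by (simp add: \<delta>_def mult_ac)
    qed
    finally show ?thesis .
  qed
  have est: "norm (x k) \<le> (\<Sum>\<^sub>\<infinity>m. (2 / c * \<theta> (r m - k)) * norm (U x m))" if x: "x \<in> lp \<infinity>" for x k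
  proof -
    define z where "z n = scaleC (of_real (\<theta> (n - k))) (x n)" for n
    have nz: "norm (z n) = \<theta> (n - k) * norm (x n)" for n using th0 by (simp add: z_def norm_scaleC)
    have Ux: "U x \<in> lp \<infinity>" by (rule lp_operator_mem[OF U x])
    \<comment> \<open>\<open>x\<close> is only bounded, but the summable weight puts
      \<open>z\<close> into l^1 and hence into l^q, whatever q is.\<close>
    have z1: "z \<in> lp 1"
    proof -
      have "(\<lambda>n. \<theta> (n - k) * norm (x n)) summable_on UNIV"
        by (rule summable_mult_bounded(1)[OF _ _ _ lp_norm_infty_ge[OF x]])
          (use th0 ths infsum_fibers_le(1)[OF fibers_le_diff[OF fibers_le_id], of \<theta>] in auto)
      then show ?thesis by (simp add: lp_one_iff nz)
    qed
    have zq: "z \<in> lp q" and zi: "z \<in> lp \<infinity>" using lp_one_imp(1)[OF _ z1] q by auto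
    define y where "y m = scaleC (of_real (\<theta> (r m - k))) (U x m)" for m
    have ny: "norm (y m) = \<theta> (r m - k) * norm (U x m)" for m using th0 by (simp add: y_def norm_scaleC)
    have sy: "(\<lambda>m. \<theta> (r m - k) * norm (U x m)) summable_on UNIV"
      by (rule summable_mult_bounded(1)[OF _ _ _ lp_norm_infty_ge[OF Ux]])
        (use th0 ths infsum_fibers_le(1)[OF fibers_le_diff[OF r(1)], of \<theta>] in auto)
    have y1: "y \<in> lp 1" using sy by (simp add: lp_one_iff ny)
    define Y where "Y m = (\<Sum>\<^sub>\<infinity>n. (real t / N * v (r m - n)) * norm (z n))" for m
    have v': "\<And>j. 0 \<le> real t / N * v j" "(\<lambda>j. real t / N * v j) summable_on UNIV"
      using N1 v(1) summable_on_cmult_right[OF v(2), of "real t / N"] by auto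
    have Yq: "Y \<in> lp q" and nY: "lp_norm q Y \<le> c / 2 * lp_norm q z"
    proof -
      have *: "lp_norm q Y \<le> real K * (\<Sum>\<^sub>\<infinity>j. real t / N * v j) * lp_norm q z"
        unfolding Y_def by (rule Young_convolution(2)[OF v' r q zq])
      also have "\<dots> \<le> c / 2 * lp_norm q z"
      proof (rule mult_right_mono[OF _ lp_norm_nonneg[OF zq q]])
        show "real K * (\<Sum>\<^sub>\<infinity>j. real t / N * v j) \<le> c / 2"
          using N by (simp only: infsum_cmult_right' V_def)
      qed
      finally show "lp_norm q Y \<le> c / 2 * lp_norm q z" .
      show "Y \<in> lp q" unfolding Y_def by (rule Young_convolution(1)[OF v' r q zq])
    qed
    define h where "h m = U z m - y m" for m
    have hY: "norm (h m) \<le> norm (Y m)" for m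
    proof -
      \<comment> \<open>For the fixed row m the weight is frozen at r m. Then y m = U u m, and the
        commutator in this row is U applied to z - u.\<close>
      define u where "u n = scaleC (of_real (\<theta> (r m - k))) (x n)" for n
      have u: "u \<in> lp \<infinity>" unfolding u_def by (rule lp_scaleC(1)[OF _ x]) simp
      have zu: "(\<lambda>n. z n - u n) \<in> lp \<infinity>" by (rule lp_diff(1)[OF _ zi u]) simp
      have Uu: "U u = (\<lambda>m'. scaleC (of_real (\<theta> (r m - k))) (U x m'))"
        unfolding u_def by (rule lp_operator_scaleC[OF U x])
      have "h m = U (\<lambda>n. z n - u n) m"
        unfolding lp_operator_diff[OF U _ zi u, simplified] by (simp add: h_def y_def Uu)
      then have "norm (h m) \<le> (\<Sum>\<^sub>\<infinity>n. w (r m - n) * norm (z n - u n))"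
        using dom zu unfolding row_dominated_def by simp
      also have "\<dots> \<le> (\<Sum>\<^sub>\<infinity>n. (real t / N * v (r m - n)) * norm (z n))"
      proof (rule infsum_mono)
        have ws: "w summable_on UNIV"
        proof (rule summable_on_comparison_test[OF v(2)])
          show "w j \<le> v j" for j
            unfolding v_def using mult_left_mono[OF one_le_power[OF zweight_ge_one] w] by (metis mult.right_neutral)
        qed (rule w)
        show "(\<lambda>n. w (r m - n) * norm (z n - u n)) summable_on UNIV"
          by (rule summable_convolution[OF w ws zu])
        show "(\<lambda>n. real t / N * v (r m - n) * norm (z n)) summable_on UNIV"
          by (rule summable_convolution[OF v' zi])
        fix n
        have "z n - u n = scaleC (of_real (\<theta> (n - k) - \<theta> (r m - k))) (x n)"
          using scaleC_add_left[of "of_real (\<theta> (n - k) - \<theta> (r m - k))" "of_real (\<theta> (r m - k))" "x n"]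
          by (simp add: z_def u_def)
        then have "norm (z n - u n) = \<bar>\<theta> (n - k) - \<theta> (r m - k)\<bar> * norm (x n)"
          by (simp add: norm_scaleC flip: of_real_diff)
        also have "\<dots> \<le> (\<theta> (n - k) * (real t / N * zweight (r m - n) ^ (t + 1))) * norm (x n)"
          by (rule mult_right_mono[OF comm]) simp
        also have "\<dots> = real t / N * zweight (r m - n) ^ (t + 1) * norm (z n)" by (simp add: nz)
        finally have "w (r m - n) * norm (z n - u n)
            \<le> w (r m - n) * (real t / N * zweight (r m - n) ^ (t + 1) * norm (z n))"
          by (rule mult_left_mono[OF _ w])
        then show "w (r m - n) * norm (z n - u n) \<le> real t / N * v (r m - n) * norm (z n)"
          by (simp add: v_def mult_ac)
      qed
      finally show ?thesis by (simp add: Y_def)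
    qed
    have hq: "h \<in> lp q" and nh: "lp_norm q h \<le> lp_norm q Y" by (rule lp_solid[OF q Yq hY])+
    \<comment> \<open>Estimating \<open>y\<close> in l^1 removes q from the right-hand side.\<close>
    have yq: "y \<in> lp q" and nyq: "lp_norm q y \<le> lp_norm 1 y" using lp_one_imp[OF q y1] by auto
    have "c * lp_norm q z \<le> lp_norm q (U z)" by (rule below[OF zq])
    also have "U z = (\<lambda>m. h m + y m)" by (simp add: h_def)
    also have "lp_norm q (\<lambda>m. h m + y m) \<le> lp_norm q h + lp_norm q y" by (rule lp_add(2)[OF q hq yq])
    also have "\<dots> \<le> c / 2 * lp_norm q z + lp_norm 1 y" using nh nY nyq by linarith
    finally have "lp_norm q z \<le> 2 / c * lp_norm 1 y" using c by (simp add: field_simps)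
    moreover have "norm (x k) \<le> lp_norm q z" using lp_norm_ge[OF q zq, of k] nz[of k] by (simp add: \<theta>_def)
    ultimately have "norm (x k) \<le> 2 / c * lp_norm 1 y" by linarith
    also have "\<dots> = (\<Sum>\<^sub>\<infinity>m. (2 / c * \<theta> (r m - k)) * norm (U x m))"
      by (simp only: lp_norm_one ny infsum_cmult_right' mult.assoc)
    finally show ?thesis .
  qed
  show ?thesis
  proof (rule that)
    show "0 \<le> 2 / c * \<theta> j" for j using c th0 by simp
    show "(\<lambda>j. 2 / c * \<theta> j) summable_on UNIV" by (rule summable_on_cmult_right[OF ths])
  qed (rule est)
qed

text \<open>The transposed convolution is bounded because it is an adjoint.\<close>

lemma Young_transposed:
  fixes \<kappa> :: "int ^ 'd::finite \<Rightarrow> real" and r :: "int ^ 'd \<Rightarrow> int ^ 'd"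
  assumes k: "\<And>j. 0 \<le> \<kappa> j" "\<kappa> summable_on UNIV" and r: "fibers_le K r" "1 \<le> K" and q: "q \<in> lp_index"
  obtains C where "0 \<le> C"
    "\<And>g :: int ^ 'd \<Rightarrow> 'a::real_normed_vector. g \<in> lp q \<Longrightarrow>
      (\<lambda>k. \<Sum>\<^sub>\<infinity>m. \<kappa> (r m - k) * norm (g m)) \<in> lp q \<and>
      lp_norm q (\<lambda>k. \<Sum>\<^sub>\<infinity>m. \<kappa> (r m - k) * norm (g m)) \<le> C * lp_norm q g"
proof -
  define E where "E x = (\<lambda>m. \<Sum>\<^sub>\<infinity>n. of_real (\<kappa> (r m - n)) * x n)" for x :: "int ^ 'd \<Rightarrow> complex"
  have as: "(\<lambda>n. norm (of_real (\<kappa> (r m - n)) * x n)) summable_on UNIV" if "x \<in> lp \<infinity>"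
    for x :: "int ^ 'd \<Rightarrow> complex" and m
    using summable_convolution[OF k that, of "r m"] by (simp add: norm_mult k(1))
  note sm = abs_summable_summable[OF as]
  have Eop: "lp_operator q E" if q: "q \<in> lp_index" for q
    unfolding lp_operator_def
  proof (intro conjI ballI allI exI[of _ "real K * (\<Sum>\<^sub>\<infinity>j. \<kappa> j)"])
    fix f g :: "int ^ 'd \<Rightarrow> complex" and c assume f: "f \<in> lp q"
    note fi = lp_imp_infty[OF q f]
    have le: "norm (E f m) \<le> norm (\<Sum>\<^sub>\<infinity>n. \<kappa> (r m - n) * norm (f n))" for m
      using norm_infsum_bound[OF as[OF fi, of m]] k(1) by (simp add: E_def norm_mult)
    note Y = Young_convolution[OF k r q f]
    show "E f \<in> lp q" by (rule lp_solid(1)[OF q Y(1) le])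
    show "lp_norm q (E f) \<le> real K * (\<Sum>\<^sub>\<infinity>j. \<kappa> j) * lp_norm q f"
      using lp_solid(2)[OF q Y(1) le] Y(2) by linarith
    show "E (\<lambda>m. scaleC c (f m)) = (\<lambda>m. scaleC c (E f m))"
      by (simp add: E_def mult.left_commute[of _ c] infsum_cmult_right')
    assume g: "g \<in> lp q"
    show "E (\<lambda>m. f m + g m) = (\<lambda>m. E f m + E g m)"
      using infsum_add[OF sm[OF fi] sm[OF lp_imp_infty[OF q g]]] by (simp add: E_def distrib_left)
  qed
  obtain V where V: "\<And>q. q \<in> lp_index \<Longrightarrow> lp_operator q V"
    "\<And>f g. f \<in> lp 1 \<Longrightarrow> g \<in> lp \<infinity> \<Longrightarrow> pairing (E f) g = pairing f (V g)"
    using adjoint_exists[OF Eop] by blast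
  have Veq: "V (\<lambda>m. of_real (norm (g m))) = (\<lambda>k. of_real (\<Sum>\<^sub>\<infinity>m. \<kappa> (r m - k) * norm (g m)))"
    if g: "g \<in> lp \<infinity>" for g :: "int ^ 'd \<Rightarrow> 'a"
  proof
    fix k0
    have gi: "(\<lambda>m. complex_of_real (norm (g m))) \<in> lp \<infinity>"
      by (rule lp_solid(1)[OF _ g]) auto
    \<comment> \<open>Testing the adjoint on a unit entry reads off its kernel, which is the
      transposed one.\<close>
    have E1: "E (single k0 1) m = of_real (\<kappa> (r m - k0))" for m
      unfolding E_def
      by (rule infsumI, rule has_sum_finite_neutralI[of "{k0}"]) (auto simp: single_def)
    have "cnj (V (\<lambda>m. of_real (norm (g m))) k0) = pairing (E (single k0 1)) (\<lambda>m. of_real (norm (g m)))"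
      using V(2)[OF single_lp(1)[of 1 k0 "1 :: complex"] gi] by simp
    also have "\<dots> = (\<Sum>\<^sub>\<infinity>m. of_real (\<kappa> (r m - k0) * norm (g m)))"
      by (simp add: pairing_def E1)
    also have "\<dots> = of_real (\<Sum>\<^sub>\<infinity>m. \<kappa> (r m - k0) * norm (g m))"
    proof (rule infsumI, rule has_sum_of_real, rule has_sum_infsum)
      show "(\<lambda>m. \<kappa> (r m - k0) * norm (g m)) summable_on UNIV"
        by (rule summable_mult_bounded(1)[OF _ _ _ lp_norm_infty_ge[OF g]])
          (use k infsum_fibers_le(1)[OF fibers_le_diff[OF r(1)], of \<kappa>] in auto)
    qed
    finally show "V (\<lambda>m. of_real (norm (g m))) k0 = of_real (\<Sum>\<^sub>\<infinity>m. \<kappa> (r m - k0) * norm (g m))"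
      by (metis complex_cnj_cnj complex_cnj_complex_of_real)
  qed
  obtain C where C: "0 \<le> C" "\<And>f. f \<in> lp q \<Longrightarrow> lp_norm q (V f) \<le> C * lp_norm q f"
    using lp_operator_bound[OF V(1)[OF q] q] by blast
  show ?thesis
  proof (rule that[OF C(1)])
    fix g :: "int ^ 'd \<Rightarrow> 'a" assume g: "g \<in> lp q"
    let ?n = "\<lambda>m. complex_of_real (norm (g m))"
    have n: "?n \<in> lp q" "lp_norm q ?n = lp_norm q g"
      using lp_norm_cong[of ?n g q] g by auto
    define S where "S k = (\<Sum>\<^sub>\<infinity>m. \<kappa> (r m - k) * norm (g m))" for k
    have "V ?n \<in> lp q" "lp_norm q (V ?n) \<le> C * lp_norm q g"
      using lp_operator_mem[OF V(1)[OF q] n(1)] C(2)[OF n(1)] n(2) by auto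
    moreover have "V ?n = (\<lambda>k. of_real (S k))"
      unfolding S_def by (rule Veq[OF lp_imp_infty[OF q g]])
    moreover have "(\<lambda>k. complex_of_real (S k)) \<in> lp q \<longleftrightarrow> S \<in> lp q"
      "lp_norm q (\<lambda>k. complex_of_real (S k)) = lp_norm q S"
      by (rule lp_norm_cong; simp)+
    ultimately have "S \<in> lp q \<and> lp_norm q S \<le> C * lp_norm q g" by simp
    then show "(\<lambda>k. \<Sum>\<^sub>\<infinity>m. \<kappa> (r m - k) * norm (g m)) \<in> lp q \<and>
      lp_norm q (\<lambda>k. \<Sum>\<^sub>\<infinity>m. \<kappa> (r m - k) * norm (g m)) \<le> C * lp_norm q g"
      unfolding S_def[abs_def] .
  qed
qed

text \<open>The conclusion includes regularity: a bounded \<open>x\<close> whose image lies in l^q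
  lies in l^q itself. This later moves solutions of an equation from one space to another.\<close>

lemma lower_bound_all_indices:
  fixes U :: "(int ^ 'd::finite \<Rightarrow> 'a::chilbert_space) \<Rightarrow> (int ^ 'd \<Rightarrow> 'b::chilbert_space)"
    and r :: "int ^ 'd \<Rightarrow> int ^ 'd"
  assumes "lp_operator \<infinity> U" "row_dominated r w U" "\<And>j. 0 \<le> w j"
    and "(\<lambda>j. w j * zweight j ^ (2 * CARD('d) + 1)) summable_on UNIV"
    and r: "fibers_le K r" "1 \<le> K"
    and "p \<in> lp_index" "0 < c" "\<And>z. z \<in> lp p \<Longrightarrow> c * lp_norm p z \<le> lp_norm p (U z)"
    and q: "q \<in> lp_index"
  obtains C where "0 < C" "\<And>x. x \<in> lp \<infinity> \<Longrightarrow> U x \<in> lp q \<Longrightarrow> x \<in> lp q \<and> lp_norm q x \<le> C * lp_norm q (U x)"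
proof -
  obtain \<kappa> where k: "\<And>j. 0 \<le> \<kappa> j" "\<kappa> summable_on UNIV"
    and est: "\<And>x k. x \<in> lp \<infinity> \<Longrightarrow> norm (x k) \<le> (\<Sum>\<^sub>\<infinity>m. \<kappa> (r m - k) * norm (U x m))"
    by (rule lower_bound_localizes[OF assms(1-9)]) (assumption, rule that)
  obtain C where C: "0 \<le> C" "\<And>g :: int ^ 'd \<Rightarrow> 'b. g \<in> lp q \<Longrightarrow>
      (\<lambda>k. \<Sum>\<^sub>\<infinity>m. \<kappa> (r m - k) * norm (g m)) \<in> lp q \<and>
      lp_norm q (\<lambda>k. \<Sum>\<^sub>\<infinity>m. \<kappa> (r m - k) * norm (g m)) \<le> C * lp_norm q g"
    by (rule Young_transposed[OF k r q, where 'a = 'b]) (rule that)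
  show ?thesis
  proof (rule that[of "C + 1"])
    show "0 < C + 1" using C(1) by simp
    fix x assume x: "x \<in> lp \<infinity>" and Ux: "U x \<in> lp q"
    have le: "norm (x k) \<le> norm (\<Sum>\<^sub>\<infinity>m. \<kappa> (r m - k) * norm (U x m))" for k
      using est[OF x, of k] by simp
    have "x \<in> lp q" "lp_norm q x \<le> lp_norm q (\<lambda>k. \<Sum>\<^sub>\<infinity>m. \<kappa> (r m - k) * norm (U x m))"
      using lp_solid[OF q conjunct1[OF C(2)[OF Ux]] le] by auto
    then show "x \<in> lp q \<and> lp_norm q x \<le> (C + 1) * lp_norm q (U x)"
      using C(2)[OF Ux] lp_norm_nonneg[OF Ux q] by (auto simp: distrib_right)
  qed
qed

section \<open>Inverting the Gram operator\<close>

lemma nonneg_iterated_infsum: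
  fixes f :: "'i \<Rightarrow> 'j \<Rightarrow> real"
  assumes nn: "\<And>m n. 0 \<le> f m n" and s: "\<And>m. f m summable_on UNIV"
    and ss: "(\<lambda>m. \<Sum>\<^sub>\<infinity>n. f m n) summable_on UNIV"
  shows "\<And>n. (\<lambda>m. f m n) summable_on UNIV"
    "(\<lambda>n. \<Sum>\<^sub>\<infinity>m. f m n) summable_on UNIV"
    "(\<Sum>\<^sub>\<infinity>m. \<Sum>\<^sub>\<infinity>n. f m n) = (\<Sum>\<^sub>\<infinity>n. \<Sum>\<^sub>\<infinity>m. f m n)"
proof -
  have 1: "(\<lambda>(m, n). f m n) summable_on UNIV \<times> UNIV"
    by (rule summable_on_SigmaI[where g = "\<lambda>m. \<Sum>\<^sub>\<infinity>n. f m n"])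
      (use s ss nn in \<open>auto intro!: has_sum_infsum\<close>)
  then have 2: "(\<lambda>(n, m). f m n) summable_on UNIV \<times> UNIV"
    by (subst (asm) summable_on_swap) simp
  show "(\<lambda>m. f m n) summable_on UNIV" for n
    by (rule summable_on_SigmaD1[OF 2]) simp
  show "(\<lambda>n. \<Sum>\<^sub>\<infinity>m. f m n) summable_on UNIV"
    by (rule summable_on_Sigma_banach[OF 2])
  show "(\<Sum>\<^sub>\<infinity>m. \<Sum>\<^sub>\<infinity>n. f m n) = (\<Sum>\<^sub>\<infinity>n. \<Sum>\<^sub>\<infinity>m. f m n)"
    by (rule infsum_swap_banach[OF 1])
qed

text \<open>As in the open mapping theorem, the residual is solved approximately over and over,
  shrinks like \<rho>^k, and the corrections form an absolutely convergent series. It serves both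
  for a contraction on l^2 and for approximation by finite sequences on c_0.\<close>

lemma approximately_surjective_imp_surjective:
  fixes B :: "(int ^ 'd::finite \<Rightarrow> 'a::chilbert_space) \<Rightarrow> (int ^ 'd \<Rightarrow> 'b::chilbert_space)"
  assumes q: "q \<in> lp_index" and B: "lp_operator q B" and \<rho>: "0 \<le> \<rho>" "\<rho> < 1" and C: "0 \<le> C"
    and approx: "\<And>y. y \<in> lp q \<Longrightarrow>
      \<exists>x\<in>lp q. lp_norm q x \<le> C * lp_norm q y \<and> lp_norm q (\<lambda>m. y m - B x m) \<le> \<rho> * lp_norm q y"
    and y: "y \<in> lp q"
  shows "\<exists>x\<in>lp q. B x = y"
proof -
  obtain X where X: "\<And>y. y \<in> lp q \<Longrightarrow> X y \<in> lp q"
    "\<And>y. y \<in> lp q \<Longrightarrow> lp_norm q (X y) \<le> C * lp_norm q y"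
    "\<And>y. y \<in> lp q \<Longrightarrow> lp_norm q (\<lambda>m. y m - B (X y) m) \<le> \<rho> * lp_norm q y"
    using approx by metis
  define Y where "Y k = ((\<lambda>y m. y m - B (X y) m) ^^ k) y" for k
  have Y0: "Y 0 = y" and YS: "Y (Suc k) = (\<lambda>m. Y k m - B (X (Y k)) m)" for k
    by (simp_all add: Y_def)
  have Y: "Y k \<in> lp q \<and> lp_norm q (Y k) \<le> \<rho> ^ k * lp_norm q y" for k
  proof (induction k)
    case (Suc k)
    then have Yk: "Y k \<in> lp q" by simp
    have "lp_norm q (Y (Suc k)) \<le> \<rho> * lp_norm q (Y k)" unfolding YS by (rule X(3)[OF Yk])
    also have "\<dots> \<le> \<rho> * (\<rho> ^ k * lp_norm q y)" using Suc \<rho>(1) by (intro mult_left_mono) auto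
    finally show ?case
      using lp_diff(1)[OF q Yk lp_operator_mem[OF B X(1)[OF Yk]]] by (simp add: YS mult_ac)
  qed (simp add: Y0 y)
  define g where "g k = X (Y k)" for k
  have g: "g k \<in> lp q" for k unfolding g_def using X(1) Y by blast
  have gn: "lp_norm q (g k) \<le> C * lp_norm q y * \<rho> ^ k" for k
  proof -
    have "lp_norm q (g k) \<le> C * lp_norm q (Y k)" unfolding g_def using X(2) Y by blast
    also have "\<dots> \<le> C * (\<rho> ^ k * lp_norm q y)" using Y C by (intro mult_left_mono) auto
    finally show ?thesis by (simp add: mult_ac)
  qed
  have sg: "summable (\<lambda>k. lp_norm q (g k))"
  proof (rule summable_comparison_test'[of _ 0])
    show "summable (\<lambda>k. C * lp_norm q y * \<rho> ^ k)" using \<rho> by (intro summable_mult summable_geometric) simp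
    show "norm (lp_norm q (g k)) \<le> C * lp_norm q y * \<rho> ^ k" for k
      using gn lp_norm_nonneg[OF g q] by simp
  qed
  obtain x where x: "x \<in> lp q"
    "\<And>n. lp_norm q (\<lambda>m. x m - (\<Sum>k<n. g k m)) \<le> (\<Sum>k. lp_norm q (g (k + n)))"
    using lp_series[of q g, OF q g sg] by blast
  define S where "S n = (\<lambda>m. \<Sum>k<n. g k m)" for n
  have S: "S n \<in> lp q" for n unfolding S_def using lp_sum[OF q, of "{..<n}" g] g by simp
  have BS: "B (S n) = (\<lambda>m. y m - Y n m)" for n
  proof (induction n)
    case 0
    then show ?case by (simp add: S_def Y0 lp_operator_zero[OF B q])
  next
    case (Suc n)
    have "B (S (Suc n)) = (\<lambda>m. B (S n) m + B (g n) m)"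
      using lp_operator_add[OF B S g, of n n] by (simp add: S_def)
    then show ?case using Suc by (simp add: YS g_def fun_eq_iff)
  qed
  obtain D where D: "0 \<le> D" "\<And>f. f \<in> lp q \<Longrightarrow> lp_norm q (B f) \<le> D * lp_norm q f"
    using lp_operator_bound[OF B q] by blast
  have Bx: "B x \<in> lp q" by (rule lp_operator_mem[OF B x(1)])
  have dxy: "(\<lambda>m. B x m - y m) \<in> lp q" by (rule lp_diff(1)[OF q Bx y])
  have le: "lp_norm q (\<lambda>m. B x m - y m) \<le> D * (\<Sum>k. lp_norm q (g (k + n))) + \<rho> ^ n * lp_norm q y" for n
  proof -
    have d: "(\<lambda>m. x m - S n m) \<in> lp q" by (rule lp_diff(1)[OF q x(1) S])
    have "(\<lambda>m. B x m - y m) = (\<lambda>m. B (\<lambda>m. x m - S n m) m - Y n m)"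
      by (simp add: lp_operator_diff[OF B q x(1) S] BS)
    then have "lp_norm q (\<lambda>m. B x m - y m) \<le> lp_norm q (B (\<lambda>m. x m - S n m)) + lp_norm q (Y n)"
      using lp_diff(2)[OF q lp_operator_mem[OF B d]] Y by simp
    also have "\<dots> \<le> D * lp_norm q (\<lambda>m. x m - S n m) + \<rho> ^ n * lp_norm q y"
      using D(2)[OF d] Y by (intro add_mono) auto
    also have "\<dots> \<le> D * (\<Sum>k. lp_norm q (g (k + n))) + \<rho> ^ n * lp_norm q y"
      using x(2)[of n] D(1) by (intro add_right_mono mult_left_mono) (auto simp: S_def)
    finally show ?thesis .
  qed
  have "(\<lambda>n. D * (\<Sum>k. lp_norm q (g (k + n))) + \<rho> ^ n * lp_norm q y) \<longlonglongrightarrow> D * 0 + 0 * lp_norm q y"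
    using \<rho> by (intro tendsto_intros suminf_exist_split2[OF sg] LIMSEQ_power_zero) auto
  then have "lp_norm q (\<lambda>m. B x m - y m) \<le> D * 0 + 0 * lp_norm q y"
    by (rule LIMSEQ_le_const) (use le in blast)
  then have "lp_norm q (\<lambda>m. B x m - y m) \<le> 0" by simp
  then have "norm (B x m - y m) \<le> 0" for m by (rule order_trans[OF lp_norm_ge[OF q dxy]])
  then show ?thesis using x(1) by (intro bexI[of _ x]) auto
qed

section \<open>Decay and coercivity of the Gram operator\<close>

lemma pairing_self:
  assumes "f \<in> lp (ereal 2)"
  shows "pairing f f = of_real ((lp_norm (ereal 2) f)\<^sup>2)"
proof -
  have s: "(\<lambda>m. (norm (f m))\<^sup>2) summable_on UNIV"
    using assms by (simp add: lp_ereal_iff)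
  have "pairing f f = (\<Sum>\<^sub>\<infinity>m. of_real ((norm (f m))\<^sup>2))"
    by (simp add: pairing_def cinner_self)
  also have "\<dots> = of_real (\<Sum>\<^sub>\<infinity>m. (norm (f m))\<^sup>2)"
    by (rule infsumI, rule has_sum_of_real, rule has_sum_infsum, rule s)
  also have "(\<Sum>\<^sub>\<infinity>m. (norm (f m))\<^sup>2) = (lp_norm (ereal 2) f)\<^sup>2"
    using lp_norm_ereal_powr[of 2 f] lp_norm_nonneg[OF assms] by simp
  finally show ?thesis .
qed

lemma dual_pair_diff_right:
  assumes "dual_pair f g" "dual_pair f g'"
  shows "pairing f (\<lambda>m. g m - g' m) = pairing f g - pairing f g'"
  using infsum_diff[OF dual_pair_summable[OF assms(1)] dual_pair_summable[OF assms(2)]]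
  by (simp add: pairing_def cinner_diff_right)

lemma dual_pair_one: "f \<in> lp 1 \<Longrightarrow> g \<in> lp 1 \<Longrightarrow> dual_pair f g"
  using lp_imp_infty[of 1 f] by (simp add: dual_pair_def)

text \<open>The sum over i is the autocorrelation of \<open>w\<close>, which dominates A^*A. It
  inherits the moment of order \<open>e\<close>, because zweight j <= zweight (i + j) zweight i
  distributes the weight over the two factors.\<close>

lemma gram_weight_summable:
  fixes w :: "int ^ 'd::finite \<Rightarrow> real"
  assumes w: "\<And>j. 0 \<le> w j" and s: "(\<lambda>j. w j * zweight j ^ e) summable_on UNIV"
  shows "(\<lambda>j. (real K * (\<Sum>\<^sub>\<infinity>i. w i * w (i + j))) * zweight j ^ e) summable_on UNIV"
proof -
  define W where "W j = w j * zweight j ^ e" for j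
  have W: "0 \<le> W j" for j by (simp add: W_def w)
  have wW: "w j \<le> W j" for j
    unfolding W_def using mult_left_mono[OF one_le_power[OF zweight_ge_one] w] by (metis mult.right_neutral)
  have sW: "W summable_on UNIV" using s by (simp add: W_def[abs_def])
  have bW: "W j \<le> (\<Sum>\<^sub>\<infinity>j. W j)" for j
    using finite_sum_le_infsum[OF sW, of "{j}"] W by simp
  have sh: "(\<lambda>j. W (i + j)) summable_on UNIV" for i
    using summable_on_reindex_bij_betw[of "\<lambda>j. i + j" UNIV UNIV W] sW by (simp add: bij_plus_right add.commute)
  have si: "(\<Sum>\<^sub>\<infinity>j. W (i + j)) = (\<Sum>\<^sub>\<infinity>j. W j)" for i
    using infsum_reindex_bij_betw[of "\<lambda>j. i + j" UNIV UNIV W] by (simp add: bij_plus_right add.commute)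
  have sWW: "(\<lambda>i. W i * W (i + j)) summable_on UNIV" for j
    by (rule summable_mult_bounded(1)[OF W sW _ bW]) (rule W)
  have sww: "(\<lambda>i. w i * w (i + j)) summable_on UNIV" for j
    by (rule summable_on_comparison_test[OF sWW[of j]]) (simp_all add: mult_mono wW w W)
  have "(\<lambda>j. \<Sum>\<^sub>\<infinity>i. W i * W (i + j)) summable_on UNIV"
  proof (rule nonneg_iterated_infsum(2))
    show "(\<lambda>j. W i * W (i + j)) summable_on UNIV" for i by (rule summable_on_cmult_right[OF sh])
    show "(\<lambda>i. \<Sum>\<^sub>\<infinity>j. W i * W (i + j)) summable_on UNIV"
      unfolding infsum_cmult_right' si by (rule summable_on_cmult_left[OF sW])
  qed (simp add: W)
  then have "(\<lambda>j. real K * (\<Sum>\<^sub>\<infinity>i. W i * W (i + j))) summable_on UNIV"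
    by (rule summable_on_cmult_right)
  then show ?thesis
  proof (rule summable_on_comparison_test)
    fix j
    have "(\<Sum>\<^sub>\<infinity>i. w i * w (i + j)) * zweight j ^ e = (\<Sum>\<^sub>\<infinity>i. w i * w (i + j) * zweight j ^ e)"
      by (rule infsum_cmult_left'[symmetric])
    also have "\<dots> \<le> (\<Sum>\<^sub>\<infinity>i. W i * W (i + j))"
    proof (rule infsum_mono[OF summable_on_cmult_left[OF sww] sWW])
      fix i
      have "zweight j \<le> zweight (i + j) * zweight i" using zweight_triangle[of "i + j" i] by simp
      then have "zweight j ^ e \<le> (zweight (i + j) * zweight i) ^ e" by (intro power_mono) auto
      then have "w i * w (i + j) * zweight j ^ e \<le> w i * w (i + j) * (zweight (i + j) * zweight i) ^ e"
        by (intro mult_left_mono) (auto simp: w)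
      then show "w i * w (i + j) * zweight j ^ e \<le> W i * W (i + j)"
        by (simp add: W_def power_mult_distrib mult_ac)
    qed
    finally show "real K * (\<Sum>\<^sub>\<infinity>i. w i * w (i + j)) * zweight j ^ e \<le> real K * (\<Sum>\<^sub>\<infinity>i. W i * W (i + j))"
      by (simp add: mult.assoc mult_left_mono)
    show "0 \<le> real K * (\<Sum>\<^sub>\<infinity>i. w i * w (i + j)) * zweight j ^ e"
      by (intro mult_nonneg_nonneg infsum_nonneg) (auto simp: w)
  qed
qed

text \<open>Testing (A^* y)_n against itself leads to A (single n h), whose entries are bounded by w
  (r m - n) |h|. With the row bound inserted for y = A x, the sum over m meets each value of
  \<open>r\<close> at most K times, which leaves K times the autocorrelation at n - l.\<close>

lemma gram_row_dominated:
  fixes A :: "(int ^ 'd::finite \<Rightarrow> 'a::chilbert_space) \<Rightarrow> (int ^ 'd \<Rightarrow> 'b::chilbert_space)"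
    and r :: "int ^ 'd \<Rightarrow> int ^ 'd"
  assumes adj: "adj_pair A As" and dom: "row_dominated r w A" and w: "\<And>j. 0 \<le> w j"
    and s: "w summable_on UNIV" and r: "fibers_le K r"
  shows "row_dominated (\<lambda>m. m) (\<lambda>j. real K * (\<Sum>\<^sub>\<infinity>i. w i * w (i + j))) (\<lambda>x. As (A x))"
  unfolding row_dominated_def
proof (intro ballI allI)
  fix x :: "int ^ 'd \<Rightarrow> 'a" and n assume x: "x \<in> lp \<infinity>"
  define y where "y = A x"
  have y: "y \<in> lp \<infinity>" unfolding y_def by (rule adj_pair_mem(1)[OF adj _ x]) simp
  have sw: "(\<lambda>m. w (r m - n)) summable_on UNIV" for n
    by (rule infsum_fibers_le(1)[OF fibers_le_diff[OF r] w s])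
  have swy: "(\<lambda>m. w (r m - n) * norm (y m)) summable_on UNIV"
    by (rule summable_mult_bounded(1)[OF w sw _ lp_norm_infty_ge[OF y]]) simp
  have 1: "norm (As y n) \<le> (\<Sum>\<^sub>\<infinity>m. w (r m - n) * norm (y m))"
  proof (rule norm_le_cinnerI)
    define h where "h = As y n"
    have sh: "single n h \<in> lp 1" by (rule single_lp) simp
    have Ah: "norm (A (single n h) m) \<le> w (r m - n) * norm h" for m
    proof -
      have "norm (A (single n h) m) \<le> (\<Sum>\<^sub>\<infinity>l. w (r m - l) * norm (single n h l))"
        using dom single_lp(1)[of \<infinity> n h] by (simp add: row_dominated_def)
      also have "\<dots> = w (r m - n) * norm h"
        by (rule infsumI, rule has_sum_finite_neutralI[of "{n}"]) (auto simp: single_def)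
      finally show ?thesis .
    qed
    have dp: "dual_pair (A (single n h)) y"
      using adj_pair_mem(1)[OF adj _ sh] y by (simp add: dual_pair_def)
    have "cinner h h = pairing (A (single n h)) y"
      using adj_pair_pairing[OF adj dual_pair_single(1)[OF y], of n h] by (simp add: h_def)
    also have "norm \<dots> \<le> (\<Sum>\<^sub>\<infinity>m. w (r m - n) * norm (y m)) * norm h"
    proof (rule norm_infsum_le)
      show "((\<lambda>m. cinner (A (single n h) m) (y m)) has_sum pairing (A (single n h)) y) UNIV"
        unfolding pairing_def by (rule has_sum_infsum[OF dual_pair_summable[OF dp]])
      show "((\<lambda>m. w (r m - n) * norm (y m) * norm h) has_sum
          (\<Sum>\<^sub>\<infinity>m. w (r m - n) * norm (y m)) * norm h) UNIV"
        by (rule has_sum_cmult_left[OF has_sum_infsum[OF swy]])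
      fix m
      have "norm (cinner (A (single n h) m) (y m)) \<le> norm (A (single n h) m) * norm (y m)"
        by (rule cinner_Cauchy_Schwarz)
      also have "\<dots> \<le> w (r m - n) * norm h * norm (y m)" by (rule mult_right_mono[OF Ah]) simp
      finally show "norm (cinner (A (single n h) m) (y m)) \<le> w (r m - n) * norm (y m) * norm h"
        by (simp add: mult_ac)
    qed
    finally show "cmod (cinner (As y n) (As y n)) \<le> (\<Sum>\<^sub>\<infinity>m. w (r m - n) * norm (y m)) * norm (As y n)"
      by (simp add: h_def)
    show "0 \<le> (\<Sum>\<^sub>\<infinity>m. w (r m - n) * norm (y m))" by (rule infsum_nonneg) (simp add: w)
  qed
  define F where "F m l = w (r m - n) * (w (r m - l) * norm (x l))" for m l
  have F0: "0 \<le> F m l" for m l by (simp add: F_def w)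
  have sx: "(\<lambda>l. w (r m - l) * norm (x l)) summable_on UNIV" for m
    by (rule summable_convolution[OF w s x])
  have sF: "F m summable_on UNIV" for m
    unfolding F_def[abs_def] by (rule summable_on_cmult_right[OF sx])
  have Feq: "(\<Sum>\<^sub>\<infinity>l. F m l) = w (r m - n) * (\<Sum>\<^sub>\<infinity>l. w (r m - l) * norm (x l))" for m
    by (simp add: F_def infsum_cmult_right')
  have bd: "(\<Sum>\<^sub>\<infinity>l. w (r m - l) * norm (x l)) \<le> (\<Sum>\<^sub>\<infinity>j. w j) * lp_norm \<infinity> x" for m
    using summable_mult_bounded(2)[of "\<lambda>l. w (r m - l)" "\<lambda>l. norm (x l)" "lp_norm \<infinity> x"]
      lp_norm_infty_ge[OF x] w s by (simp add: summable_on_reflect infsum_reflect)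
  have ssF: "(\<lambda>m. \<Sum>\<^sub>\<infinity>l. F m l) summable_on UNIV"
    unfolding Feq by (rule summable_mult_bounded(1)[OF w sw _ bd]) (rule infsum_nonneg, simp add: w)
  note it = nonneg_iterated_infsum[of F, OF F0 sF ssF]
  have sv: "(\<lambda>i. w (i - n) * w (i - l)) summable_on UNIV" for l
  proof (rule summable_mult_bounded(1)[OF w _ w])
    show "(\<lambda>i. w (i - n)) summable_on UNIV"
      by (rule infsum_fibers_le(1)[OF fibers_le_diff[OF fibers_le_id] w s])
    show "w (i - l) \<le> (\<Sum>\<^sub>\<infinity>j. w j)" for i
      using finite_sum_le_infsum[OF s, of "{i - l}"] w by simp
  qed
  have veq: "(\<Sum>\<^sub>\<infinity>i. w (i - n) * w (i - l)) = (\<Sum>\<^sub>\<infinity>i. w i * w (i + (n - l)))" for l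
    using infsum_reindex_bij_betw[of "\<lambda>i. i + n" UNIV UNIV "\<lambda>i. w (i - n) * w (i - l)"]
    by (simp add: bij_plus_right algebra_simps)
  have "norm (As (A x) n) \<le> (\<Sum>\<^sub>\<infinity>m. w (r m - n) * norm (y m))" using 1 by (simp add: y_def)
  also have "\<dots> \<le> (\<Sum>\<^sub>\<infinity>m. \<Sum>\<^sub>\<infinity>l. F m l)"
  proof (rule infsum_mono[OF swy ssF])
    fix m
    have "norm (y m) \<le> (\<Sum>\<^sub>\<infinity>l. w (r m - l) * norm (x l))"
      using dom x by (simp add: row_dominated_def y_def)
    then show "w (r m - n) * norm (y m) \<le> (\<Sum>\<^sub>\<infinity>l. F m l)"
      unfolding Feq by (rule mult_left_mono[OF _ w])
  qed
  also have "\<dots> = (\<Sum>\<^sub>\<infinity>l. \<Sum>\<^sub>\<infinity>m. F m l)" by (rule it(3))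
  also have "\<dots> \<le> (\<Sum>\<^sub>\<infinity>l. real K * (\<Sum>\<^sub>\<infinity>i. w i * w (i + (n - l))) * norm (x l))"
  proof (rule infsum_mono[OF it(2)])
    define v where "v j = real K * (\<Sum>\<^sub>\<infinity>i. w i * w (i + j))" for j
    have v0: "0 \<le> v j" for j unfolding v_def by (intro mult_nonneg_nonneg infsum_nonneg) (auto simp: w)
    have "v summable_on UNIV"
      using gram_weight_summable[of w 0 K] w s by (simp add: v_def[abs_def])
    then show "(\<lambda>l. real K * (\<Sum>\<^sub>\<infinity>i. w i * w (i + (n - l))) * norm (x l)) summable_on UNIV"
      using summable_convolution[of v x n, OF v0 _ x] by (simp add: v_def)
    fix l
    have "(\<Sum>\<^sub>\<infinity>m. F m l) = (\<Sum>\<^sub>\<infinity>m. (\<lambda>i. w (i - n) * w (i - l)) (r m)) * norm (x l)"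
      by (simp add: F_def infsum_cmult_left' flip: mult.assoc)
    also have "\<dots> \<le> real K * (\<Sum>\<^sub>\<infinity>i. w i * w (i + (n - l))) * norm (x l)"
      unfolding veq[symmetric]
      by (intro mult_right_mono infsum_fibers_le(2)[OF r _ sv]) (auto simp: w)
    finally show "(\<Sum>\<^sub>\<infinity>m. F m l) \<le> real K * (\<Sum>\<^sub>\<infinity>i. w i * w (i + (n - l))) * norm (x l)" .
  qed
  finally show "norm (As (A x) n) \<le> (\<Sum>\<^sub>\<infinity>l. real K * (\<Sum>\<^sub>\<infinity>i. w i * w (i + (n - l))) * norm (x l))" .
qed

text \<open>
  Expand \<open>\<parallel>y - \<tau> A\<^sup>*A y\<parallel>\<^sup>2 = \<parallel>y\<parallel>\<^sup>2 - 2 \<tau> \<parallel>A y\<parallel>\<^sup>2 + \<tau>\<^sup>2 \<parallel>A\<^sup>*A y\<parallel>\<^sup>2\<close> and take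
  \<open>\<tau> = (c/M)\<^sup>2\<close>, where \<open>M\<close> bounds \<open>A\<^sup>*A\<close>.
\<close>

lemma gram_contraction:
  fixes A :: "(int ^ 'd::finite \<Rightarrow> 'a::chilbert_space) \<Rightarrow> (int ^ 'd \<Rightarrow> 'b::chilbert_space)"
  assumes adj: "adj_pair A As" and c: "0 < c"
    and below: "\<And>z. z \<in> lp (ereal 2) \<Longrightarrow> c * lp_norm (ereal 2) z \<le> lp_norm (ereal 2) (A z)"
  obtains \<tau> \<rho> where "0 < \<tau>" "0 \<le> \<rho>" "\<rho> < 1"
    "\<And>y. y \<in> lp (ereal 2) \<Longrightarrow>
      lp_norm (ereal 2) (\<lambda>m. y m - scaleC (of_real \<tau>) (As (A y) m)) \<le> \<rho> * lp_norm (ereal 2) y"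
proof -
  have i2: "ereal 2 \<in> lp_index" "ereal 2 \<noteq> \<infinity>" by auto
  let ?n = "lp_norm (ereal 2)"
  define B where "B x = As (A x)" for x
  have BB: "adj_pair B B"
    unfolding B_def[abs_def] by (rule adj_pair_comp[OF adj adj_pair_sym[OF adj]])
  note B2 = adj_pair_operator(1)[OF BB i2(1)]
  obtain M0 where M0: "0 \<le> M0" "\<And>f. f \<in> lp (ereal 2) \<Longrightarrow> ?n (B f) \<le> M0 * ?n f"
    using lp_operator_bound[OF B2 i2(1)] by blast
  \<comment> \<open>Adding c^2 makes \<open>M\<close> positive and at least c^2, so that \<rho>2
    below is nonnegative.\<close>
  define M where "M = M0 + c\<^sup>2"
  have M: "0 < M" "c\<^sup>2 \<le> M" using M0(1) c by (auto simp: M_def add_nonneg_pos)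
  have MB: "?n (B f) \<le> M * ?n f" if "f \<in> lp (ereal 2)" for f
  proof -
    have "M0 * ?n f \<le> M * ?n f"
      by (rule mult_right_mono) (use lp_norm_nonneg[OF that i2(1)] in \<open>auto simp: M_def\<close>)
    then show ?thesis using M0(2)[OF that] by linarith
  qed
  define \<tau> where "\<tau> = c\<^sup>2 / M\<^sup>2"
  have t: "0 < \<tau>" using c M by (simp add: \<tau>_def)
  \<comment> \<open>The minimum of 1 - 2 \<tau> c^2 + \<tau>^2 M^2 over \<tau>, attained at the
    chosen \<tau>.\<close>
  define \<rho>2 where "\<rho>2 = 1 - (c\<^sup>2)\<^sup>2 / M\<^sup>2"
  have r2: "0 \<le> \<rho>2" "\<rho>2 < 1"
  proof -
    have "(c\<^sup>2)\<^sup>2 \<le> M\<^sup>2" using M by (intro power_mono) auto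
    then show "0 \<le> \<rho>2" using M by (simp add: \<rho>2_def)
    show "\<rho>2 < 1" using M c by (simp add: \<rho>2_def)
  qed
  define D where "D y = (\<lambda>m. y m - scaleC (of_real \<tau>) (B y m))" for y
  \<comment> \<open>Adjointness is available for the l^1, l^infty pairing, so the square is expanded
    on l^1 and the estimate extended to l^2 by density.\<close>
  have D1: "?n (D y) \<le> sqrt \<rho>2 * ?n y" if y: "y \<in> lp 1" for y
  proof -
    have By: "B y \<in> lp 1" by (rule adj_pair_mem(1)[OF BB _ y]) simp
    have Ay: "A y \<in> lp 1" by (rule adj_pair_mem(1)[OF adj _ y]) simp
    define z where "z = (\<lambda>m. scaleC (of_real \<tau>) (B y m))"
    have z: "z \<in> lp 1" unfolding z_def by (rule lp_scaleC(1)[OF _ By]) simp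
    note d = dual_pair_one
    have y2: "y \<in> lp (ereal 2)" and D2: "D y \<in> lp (ereal 2)" and By2: "B y \<in> lp (ereal 2)"
      and Ay2: "A y \<in> lp (ereal 2)"
      using lp_one_imp(1)[OF i2(1)] y By Ay lp_diff(1)[OF _ y z] by (auto simp: D_def z_def)
    have Dz: "D y = (\<lambda>m. y m - z m)" by (simp add: D_def z_def)
    have D1: "D y \<in> lp 1" unfolding Dz by (rule lp_diff(1)[OF _ y z]) simp
    have yB: "pairing y (B y) = of_real ((?n (A y))\<^sup>2)"
      using adj_pair_pairing[OF adj d[OF y Ay]] pairing_self[OF Ay2] by (simp add: B_def)
    then have By': "pairing (B y) y = of_real ((?n (A y))\<^sup>2)"
      using pairing_commute[of "B y" y] by simp
    have "of_real ((?n (D y))\<^sup>2) = pairing (D y) (D y)" by (rule pairing_self[OF D2, symmetric])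
    also have "\<dots> = pairing y (D y) - pairing z (D y)"
      unfolding Dz using dual_pair_add(2)[OF d[OF y D1] d[OF z D1]] by (simp add: Dz)
    also have "\<dots> = pairing y y - pairing y z - (pairing z y - pairing z z)"
      unfolding Dz by (simp add: dual_pair_diff_right d y z)
    also have "\<dots> = of_real ((?n y)\<^sup>2 - 2 * \<tau> * (?n (A y))\<^sup>2 + \<tau>\<^sup>2 * (?n (B y))\<^sup>2)"
      by (simp add: z_def pairing_scaleC yB By' pairing_self[OF y2] pairing_self[OF By2] power2_eq_square algebra_simps)
    finally have "(?n (D y))\<^sup>2 = (?n y)\<^sup>2 - 2 * \<tau> * (?n (A y))\<^sup>2 + \<tau>\<^sup>2 * (?n (B y))\<^sup>2"
      using of_real_eq_iff by blast
    also have "\<dots> \<le> (?n y)\<^sup>2 - 2 * \<tau> * (c * ?n y)\<^sup>2 + \<tau>\<^sup>2 * (M * ?n y)\<^sup>2"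
    proof -
      have "(c * ?n y)\<^sup>2 \<le> (?n (A y))\<^sup>2"
        using below[OF y2] c lp_norm_nonneg[OF y2 i2(1)] by (intro power_mono) auto
      moreover have "(?n (B y))\<^sup>2 \<le> (M * ?n y)\<^sup>2"
        using MB[OF y2] lp_norm_nonneg[OF By2 i2(1)] by (intro power_mono) auto
      ultimately show ?thesis using t
        by (intro add_mono diff_mono mult_left_mono) auto
    qed
    also have "\<dots> = \<rho>2 * (?n y)\<^sup>2"
      using M by (simp add: \<tau>_def \<rho>2_def field_simps power2_eq_square)
    also have "\<dots> = (sqrt \<rho>2 * ?n y)\<^sup>2" using r2 by (simp add: power_mult_distrib)
    finally show ?thesis
      by (rule power2_le_imp_le) (use r2 lp_norm_nonneg[OF y2 i2(1)] in simp)
  qed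
  have "?n (D y) \<le> sqrt \<rho>2 * ?n y" if y: "y \<in> lp (ereal 2)" for y
  proof (rule field_le_epsilon)
    fix e :: real assume e: "0 < e"
    \<comment> \<open>1 + \<tau> M bounds the norm of \<open>D\<close>, so the discarded part of
      \<open>y\<close> contributes at most e.\<close>
    define e' where "e' = e / (1 + \<tau> * M)"
    have tM: "0 < 1 + \<tau> * M" using t M by (simp add: add_pos_pos)
    have e': "0 < e'" using e tM by (simp add: e'_def)
    obtain F where F: "finite F" "?n (\<lambda>m. y m - trunc F y m) < e'"
      by (rule trunc_approx[OF i2 y e'])
    define u where "u = (\<lambda>m. y m - trunc F y m)"
    have t1: "trunc F y \<in> lp 1" by (rule trunc_lp_one[OF F(1)])
    have t2: "trunc F y \<in> lp (ereal 2)" by (rule trunc_lp(1)[OF i2(1) y])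
    have u: "u \<in> lp (ereal 2)" unfolding u_def by (rule lp_diff(1)[OF i2(1) y t2])
    have Dm: "D f \<in> lp (ereal 2)" "?n (D f) \<le> (1 + \<tau> * M) * ?n f" if f: "f \<in> lp (ereal 2)" for f
    proof -
      have Bf: "B f \<in> lp (ereal 2)" by (rule lp_operator_mem[OF B2 f])
      note sB = lp_scaleC[OF i2(1) Bf, of "of_real \<tau>"]
      show "D f \<in> lp (ereal 2)" unfolding D_def by (rule lp_diff(1)[OF i2(1) f sB(1)])
      have "?n (D f) \<le> ?n f + \<tau> * ?n (B f)"
        unfolding D_def using lp_diff(2)[OF i2(1) f sB(1)] sB(2) t by simp
      also have "\<dots> \<le> ?n f + \<tau> * (M * ?n f)" using MB[OF f] t by simp
      finally show "?n (D f) \<le> (1 + \<tau> * M) * ?n f" by (simp add: algebra_simps)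
    qed
    have "D y = (\<lambda>m. D (trunc F y) m + D u m)"
      by (simp add: D_def u_def lp_operator_diff[OF B2 i2(1) y t2] scaleC_diff_right)
    then have "?n (D y) \<le> ?n (D (trunc F y)) + ?n (D u)"
      using lp_add(2)[OF i2(1) Dm(1)[OF t2] Dm(1)[OF u]] by simp
    also have "\<dots> \<le> sqrt \<rho>2 * ?n (trunc F y) + (1 + \<tau> * M) * ?n u"
      by (rule add_mono[OF D1[OF t1] Dm(2)[OF u]])
    also have "\<dots> \<le> sqrt \<rho>2 * ?n y + (1 + \<tau> * M) * e'"
      using trunc_lp(2)[OF i2(1) y, of F] F(2) tM r2 by (intro add_mono mult_left_mono) (auto simp: u_def)
    also have "(1 + \<tau> * M) * e' = e" using tM by (simp add: e'_def)
    finally show "?n (D y) \<le> sqrt \<rho>2 * ?n y + e" .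
  qed
  then show ?thesis
    using that[of \<tau> "sqrt \<rho>2"] t r2 by (simp add: D_def B_def)
qed

text \<open>On l^2 a multiple of A^*A differs from the identity by a contraction, and regularity
  places the solutions found there in the other spaces. Since c_0 contains every l^q with q finite,
  the one map \<open>G0\<close> inverts A^*A on all of them, and its bidual is the inverse on
  l^infty.\<close>

lemma gram_inverse:
  fixes A :: "(int ^ 'd::finite \<Rightarrow> 'a::chilbert_space) \<Rightarrow> (int ^ 'd \<Rightarrow> 'b::chilbert_space)"
    and r :: "int ^ 'd \<Rightarrow> int ^ 'd"
  assumes adj: "adj_pair A As" and dom: "row_dominated r w A" and w: "\<And>j. 0 \<le> w j"
    and s: "(\<lambda>j. w j * zweight j ^ (2 * CARD('d) + 1)) summable_on UNIV"
    and r: "fibers_le K r" "1 \<le> K"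
    and p: "p \<in> lp_index" and c: "0 < c" and below: "\<And>z. z \<in> lp p \<Longrightarrow> c * lp_norm p z \<le> lp_norm p (A z)"
  obtains G Gs where "adj_pair G Gs" "\<And>f. f \<in> lp \<infinity> \<Longrightarrow> G (As (A f)) = f"
    "\<And>f. f \<in> lp \<infinity> \<Longrightarrow> As (A (G f)) = f"
proof -
  have i2: "ereal 2 \<in> lp_index" "ereal 2 \<noteq> \<infinity>" by auto
  let ?n = "lp_norm (ereal 2)"
  define B where "B x = As (A x)" for x
  have BB: "adj_pair B B"
    unfolding B_def[abs_def] by (rule adj_pair_comp[OF adj adj_pair_sym[OF adj]])
  note Bq = adj_pair_operator(1)[OF BB]
  obtain C where C: "0 < C" "\<And>x. x \<in> lp \<infinity> \<Longrightarrow> A x \<in> lp (ereal 2) \<Longrightarrow> x \<in> lp (ereal 2) \<and> ?n x \<le> C * ?n (A x)"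
    by (rule lower_bound_all_indices[OF adj_pair_operator(1)[OF adj] dom w s r p c below i2(1)]) auto
  have below2: "1 / C * ?n z \<le> ?n (A z)" if "z \<in> lp (ereal 2)" for z
    using C(2)[OF lp_imp_infty[OF i2(1) that] adj_pair_mem(1)[OF adj i2(1) that]] C(1)
    by (simp add: field_simps)
  obtain \<tau> \<rho> where \<tau>: "0 < \<tau>" and \<rho>: "0 \<le> \<rho>" "\<rho> < 1"
    and contr: "\<And>y. y \<in> lp (ereal 2) \<Longrightarrow> ?n (\<lambda>m. y m - scaleC (of_real \<tau>) (B y m)) \<le> \<rho> * ?n y"
    using gram_contraction[OF adj _ below2] C(1) unfolding B_def by auto
  \<comment> \<open>From y = (y - \<tau> B y) + \<tau> B y the contraction gives a lower bound for
    \<open>B\<close> on l^2, so that the localization estimate applies to \<open>B\<close>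
    itself.\<close>
  have belowB: "(1 - \<rho>) / \<tau> * ?n y \<le> ?n (B y)" if y: "y \<in> lp (ereal 2)" for y
  proof -
    have By: "B y \<in> lp (ereal 2)" by (rule lp_operator_mem[OF Bq[OF i2(1)] y])
    note sB = lp_scaleC[OF i2(1) By, of "of_real \<tau>"]
    have "?n y = ?n (\<lambda>m. (y m - scaleC (of_real \<tau>) (B y m)) + scaleC (of_real \<tau>) (B y m))" by simp
    also have "\<dots> \<le> \<rho> * ?n y + \<tau> * ?n (B y)"
      using lp_add(2)[OF i2(1) lp_diff(1)[OF i2(1) y sB(1)] sB(1)] contr[OF y] sB(2) \<tau> by simp
    finally show ?thesis using \<tau> by (simp add: field_simps)
  qed
  define v where "v j = real K * (\<Sum>\<^sub>\<infinity>i. w i * w (i + j))" for j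
  have ws: "w summable_on UNIV"
  proof (rule summable_on_comparison_test[OF s])
    show "w j \<le> w j * zweight j ^ (2 * CARD('d) + 1)" for j
      using mult_left_mono[OF one_le_power[OF zweight_ge_one] w] by (metis mult.right_neutral)
  qed (rule w)
  have v0: "0 \<le> v j" for j unfolding v_def by (intro mult_nonneg_nonneg infsum_nonneg) (auto simp: w)
  have vs: "(\<lambda>j. v j * zweight j ^ (2 * CARD('d) + 1)) summable_on UNIV"
    unfolding v_def by (rule gram_weight_summable[OF w s])
  have domB: "row_dominated (\<lambda>m. m) v B"
    unfolding v_def[abs_def] B_def[abs_def] by (rule gram_row_dominated[OF adj dom w ws r(1)])
  have cB: "0 < (1 - \<rho>) / \<tau>" using \<rho> \<tau> by simp
  have reg: "\<exists>C>0. \<forall>x\<in>lp \<infinity>. B x \<in> lp q \<longrightarrow> x \<in> lp q \<and> lp_norm q x \<le> C * lp_norm q (B x)"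
    if q: "q \<in> lp_index" for q
    by (rule lower_bound_all_indices[OF Bq domB v0 vs fibers_le_id _ i2(1) cB belowB q]) auto
  have inj: "x = y" if "x \<in> lp \<infinity>" "y \<in> lp \<infinity>" "B x = B y" for x y
  proof -
    have d: "(\<lambda>m. x m - y m) \<in> lp \<infinity>" by (rule lp_diff(1)[OF _ that(1,2)]) simp
    have "B (\<lambda>m. x m - y m) = (\<lambda>_. 0)"
      using lp_operator_diff[OF Bq _ that(1,2)] that(3) by simp
    then obtain C where "lp_norm \<infinity> (\<lambda>m. x m - y m) \<le> C * lp_norm \<infinity> (\<lambda>_ :: int ^ 'd. 0 :: 'a)"
      using reg[of \<infinity>] d lp_const_zero(1)[of \<infinity>, where 'a = 'a] by auto
    then have "lp_norm \<infinity> (\<lambda>m. x m - y m) \<le> 0" by (simp add: lp_const_zero(2))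
    then have "norm (x m - y m) \<le> 0" for m by (rule order_trans[OF lp_norm_infty_ge[OF d]])
    then show ?thesis by auto
  qed
  have surj2: "\<exists>x\<in>lp (ereal 2). B x = y" if y: "y \<in> lp (ereal 2)" for y
  proof (rule approximately_surjective_imp_surjective[OF i2(1) Bq[OF i2(1)] \<rho> _ _ y])
    show "0 \<le> \<tau>" using \<tau> by simp
    fix y :: "int ^ 'd \<Rightarrow> 'a" assume y: "y \<in> lp (ereal 2)"
    show "\<exists>x\<in>lp (ereal 2). ?n x \<le> \<tau> * ?n y \<and> ?n (\<lambda>m. y m - B x m) \<le> \<rho> * ?n y"
      using lp_scaleC[OF i2(1) y, of "of_real \<tau>"] \<tau> contr[OF y]
      by (intro bexI[of _ "\<lambda>m. scaleC (of_real \<tau>) (y m)"])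
        (auto simp: lp_operator_scaleC[OF Bq[OF i2(1)] y])
  qed
  obtain C0 where C0: "0 < C0" "\<And>x. x \<in> lp \<infinity> \<Longrightarrow> B x \<in> lp 0 \<Longrightarrow> x \<in> lp 0 \<and> lp_norm 0 x \<le> C0 * lp_norm 0 (B x)"
    using reg[of 0] by auto
  \<comment> \<open>No contraction is known on c_0. A truncation within half the norm of
    \<open>y\<close> is solved exactly in l^2, and regularity bounds that solution in the sup
    norm.\<close>
  have surj0: "\<exists>x\<in>lp 0. B x = y" if y: "y \<in> lp 0" for y
  proof (rule approximately_surjective_imp_surjective[where \<rho> = "1 / 2" and C = C0, OF _ Bq _ _ _ _ y])
    show "0 \<le> C0" using C0 by simp
    show "0 \<le> 1 / (2 :: real)" "1 / 2 < (1 :: real)" by auto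
    fix y :: "int ^ 'd \<Rightarrow> 'a" assume y: "y \<in> lp 0"
    have nn: "0 \<le> lp_norm 0 y" by (rule lp_norm_nonneg[OF y]) simp
    show "\<exists>x\<in>lp 0. lp_norm 0 x \<le> C0 * lp_norm 0 y \<and> lp_norm 0 (\<lambda>m. y m - B x m) \<le> 1 / 2 * lp_norm 0 y"
    proof (cases "lp_norm 0 y = 0")
      case True
      then have "y = (\<lambda>_. 0)" using lp_norm_ge[OF _ y] by (auto simp: fun_eq_iff)
      then show ?thesis
        using lp_operator_zero[OF Bq[of 0]] by (intro bexI[of _ y]) (simp_all add: lp_const_zero)
    next
      case False
      then have e: "0 < lp_norm 0 y / 2" using nn by simp
      obtain F where F: "finite F" "lp_norm 0 (\<lambda>m. y m - trunc F y m) < lp_norm 0 y / 2"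
        by (rule trunc_approx[OF _ _ y e]) auto
      have t2: "trunc F y \<in> lp (ereal 2)" by (rule lp_one_imp(1)[OF i2(1) trunc_lp_one[OF F(1)]])
      obtain x where x: "x \<in> lp (ereal 2)" "B x = trunc F y" using surj2[OF t2] by blast
      have t0: "trunc F y \<in> lp 0" "lp_norm 0 (trunc F y) \<le> lp_norm 0 y" using trunc_lp[OF _ y] by auto
      have x0: "x \<in> lp 0 \<and> lp_norm 0 x \<le> C0 * lp_norm 0 (trunc F y)"
        using C0(2)[OF lp_imp_infty[OF i2(1) x(1)]] x(2) t0(1) by simp
      have "C0 * lp_norm 0 (trunc F y) \<le> C0 * lp_norm 0 y"
        using C0(1) t0(2) by (intro mult_left_mono) auto
      with x0 have "lp_norm 0 x \<le> C0 * lp_norm 0 y" by linarith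
      then show ?thesis
        using F(2) x(2) x0 by (intro bexI[of _ x]) auto
    qed
  qed auto
  define G0 where "G0 = inv_into (lp 0) B"
  have G0: "G0 y \<in> lp 0" "B (G0 y) = y" if "y \<in> lp 0" for y
  proof -
    have y: "y \<in> B ` lp 0" using surj0[OF that] by blast
    show "G0 y \<in> lp 0" unfolding G0_def by (rule inv_into_into[OF y])
    show "B (G0 y) = y" unfolding G0_def by (rule f_inv_into_f[OF y])
  qed
  have G0q: "lp_operator q G0" if q: "q \<in> lp_index" "q \<noteq> \<infinity>" for q
  proof -
    obtain C where C: "\<And>x. x \<in> lp \<infinity> \<Longrightarrow> B x \<in> lp q \<Longrightarrow> x \<in> lp q \<and> lp_norm q x \<le> C * lp_norm q (B x)"
      using reg[OF q(1)] by blast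
    have G: "G0 y \<in> lp \<infinity>" "B (G0 y) = y" "G0 y \<in> lp q" "lp_norm q (G0 y) \<le> C * lp_norm q y"
      if y: "y \<in> lp q" for y
    proof -
      note y0 = lp_imp_zero[OF q y]
      show 1: "G0 y \<in> lp \<infinity>" "B (G0 y) = y" using G0[OF y0] lp_zero_imp_infty by auto
      then show "G0 y \<in> lp q" "lp_norm q (G0 y) \<le> C * lp_norm q y" using C[OF 1(1)] y by auto
    qed
    show ?thesis unfolding lp_operator_def
    proof (intro conjI ballI allI exI[of _ C])
      show "G0 f \<in> lp q" "lp_norm q (G0 f) \<le> C * lp_norm q f" if "f \<in> lp q" for f using G[OF that] by auto
      show "G0 (\<lambda>m. f m + g m) = (\<lambda>m. G0 f m + G0 g m)" if f: "f \<in> lp q" and g: "g \<in> lp q" for f g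
      proof (rule inj)
        have "(\<lambda>m. f m + g m) \<in> lp q" by (rule lp_add(1)[OF q(1) f g])
        note H = G[OF this]
        show "G0 (\<lambda>m. f m + g m) \<in> lp \<infinity>" by (rule H)
        show "(\<lambda>m. G0 f m + G0 g m) \<in> lp \<infinity>" by (rule lp_add(1)) (auto simp: G f g)
        show "B (G0 (\<lambda>m. f m + g m)) = B (\<lambda>m. G0 f m + G0 g m)"
          using H(2) lp_operator_add[OF Bq G(1)[OF f] G(1)[OF g]] G(2)[OF f] G(2)[OF g] by simp
      qed
      show "G0 (\<lambda>m. scaleC c (f m)) = (\<lambda>m. scaleC c (G0 f m))" if f: "f \<in> lp q" for c f
      proof (rule inj)
        have "(\<lambda>m. scaleC c (f m)) \<in> lp q" by (rule lp_scaleC(1)[OF q(1) f])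
        note H = G[OF this]
        show "G0 (\<lambda>m. scaleC c (f m)) \<in> lp \<infinity>" by (rule H)
        show "(\<lambda>m. scaleC c (G0 f m)) \<in> lp \<infinity>" by (rule lp_scaleC(1)) (auto simp: G f)
        show "B (G0 (\<lambda>m. scaleC c (f m))) = B (\<lambda>m. scaleC c (G0 f m))"
          using H(2) lp_operator_scaleC[OF Bq G(1)[OF f]] G(2)[OF f] by simp
      qed
    qed
  qed
  \<comment> \<open>On l^infty the bidual of \<open>G0\<close> is taken; comparison with the
    identity on single entries shows that it is a two-sided inverse.\<close>
  obtain G Gs where G: "adj_pair G Gs" "\<And>f. f \<in> lp 0 \<Longrightarrow> G f = G0 f"
    using adj_pair_extension[OF G0q] by blast
  have s0: "single m h \<in> lp 0" for m and h :: 'a by (rule single_lp) simp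
  have B0: "B f \<in> lp 0" if "f \<in> lp 0" for f using adj_pair_mem(1)[OF BB _ that] by simp
  have GB0: "G0 (B f) = f" if f: "f \<in> lp 0" for f
    by (rule inj) (use G0[OF B0[OF f]] f lp_zero_imp_infty in auto)
  show ?thesis
  proof (rule that[OF G(1)])
    show "G (As (A f)) = f" if "f \<in> lp \<infinity>" for f
      using adj_pair_unique[OF adj_pair_comp[OF BB G(1)] adj_pair_id _ that]
      by (simp add: G(2) B0 s0 GB0 flip: B_def)
    show "As (A (G f)) = f" if "f \<in> lp \<infinity>" for f
      using adj_pair_unique[OF adj_pair_comp[OF G(1) BB] adj_pair_id _ that]
      by (simp add: G(2) G0 s0 flip: B_def)
  qed
qed

section \<open>Slanted matrices\<close>

text \<open>Points with equal floors differ by less than 1/|\<alpha>| in each coordinate, so every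
  fibre lies in a translate of one lattice ball, whose cardinality serves as
  \<open>K\<close>.\<close>

lemma fibers_le_floor_scale:
  fixes \<alpha> :: real
  assumes "\<alpha> \<noteq> 0"
  obtains K where "1 \<le> K" "fibers_le K (\<lambda>m :: int ^ 'd::finite. \<chi> k. \<lfloor>\<alpha> * real_of_int (m $ k)\<rfloor>)"
proof -
  define N where "N = \<lceil>1 / \<bar>\<alpha>\<bar>\<rceil>"
  define Z where "Z = {j :: int ^ 'd. znorm j \<le> N}"
  define r where "r = (\<lambda>m :: int ^ 'd. \<chi> k. \<lfloor>\<alpha> * real_of_int (m $ k)\<rfloor>)"
  have Z: "finite Z" unfolding Z_def by (rule finite_znorm_le)
  have "0 \<le> 1 / \<bar>\<alpha>\<bar>" by simp
  then have "0 \<le> N" unfolding N_def by linarith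
  then have "0 \<in> Z" by (simp add: Z_def)
  then have "1 \<le> card Z" using Z by (metis One_nat_def Suc_leI card_gt_0_iff empty_iff)
  moreover have "fibers_le (card Z) r"
    unfolding fibers_le_def
  proof
    fix y
    have *: "finite {m. r m = y} \<and> card {m. r m = y} \<le> card Z" if m0: "r m0 = y" for m0
    proof -
      have "{m. r m = y} \<subseteq> (\<lambda>j. m0 + j) ` Z"
      proof
        fix m assume "m \<in> {m. r m = y}"
        then have "r m = r m0" using m0 by simp
        have "\<bar>(m - m0) $ k\<bar> \<le> N" for k
        proof -
          have "\<lfloor>\<alpha> * real_of_int (m $ k)\<rfloor> = \<lfloor>\<alpha> * real_of_int (m0 $ k)\<rfloor>"
            using arg_cong[OF \<open>r m = r m0\<close>, of "\<lambda>v. v $ k"] by (simp add: r_def)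
          then have "\<bar>\<alpha> * real_of_int (m $ k) - \<alpha> * real_of_int (m0 $ k)\<bar> < 1" by linarith
          then have "\<bar>\<alpha>\<bar> * \<bar>real_of_int ((m - m0) $ k)\<bar> < 1"
            by (simp add: abs_mult[symmetric] right_diff_distrib)
          then have "\<bar>real_of_int ((m - m0) $ k)\<bar> < 1 / \<bar>\<alpha>\<bar>"
            using assms by (simp add: field_simps)
          then have "real_of_int \<bar>(m - m0) $ k\<bar> \<le> real_of_int N" unfolding N_def by linarith
          then show ?thesis by linarith
        qed
        then have "m - m0 \<in> Z" by (simp add: Z_def znorm_le_iff)
        then show "m \<in> (\<lambda>j. m0 + j) ` Z" by (intro image_eqI[of _ _ "m - m0"]) auto
      qed
      then show ?thesis
        using Z by (meson card_image_le card_mono finite_imageI finite_subset le_trans)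
    qed
    show "finite {m. r m = y} \<and> card {m. r m = y} \<le> card Z"
    proof (cases "\<exists>m0. r m0 = y")
      case False
      then have "{m. r m = y} = {}" by auto
      then show ?thesis by simp
    qed (use * in blast)
  qed
  ultimately show ?thesis using that unfolding r_def by blast
qed

text \<open>The factors of a slant are indicators of unit intervals, so the entry (m, n) survives
  only in the slant with j = floor(\<alpha> m) - n. The sup norm of that slant is the decay weight
  at j.\<close>

lemma slanted_class_bounds:
  fixes A :: "int ^ 'd::finite \<Rightarrow> int ^ 'd \<Rightarrow> 'a::chilbert_space \<Rightarrow> complex"
  assumes A: "A \<in> slanted_class \<alpha> \<omega>" and \<alpha>: "\<alpha> \<noteq> 0" and \<omega>: "\<And>j. 1 \<le> \<omega> j"
  obtains w where "\<And>j. 0 \<le> w j" "(\<lambda>j. w j * \<omega> j) summable_on UNIV"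
    "\<And>m n h. norm (A m n h) \<le> w ((\<chi> k. \<lfloor>\<alpha> * real_of_int (m $ k)\<rfloor>) - n) * norm h"
proof -
  define S where "S = (\<Sum>\<^sub>\<infinity>j. matrix_sup_norm (slant \<alpha> j A) * ennreal (\<omega> j))"
  define w where "w j = enn2real (matrix_sup_norm (slant \<alpha> j A))" for j
  have bl: "bounded_linear (A m n)" for m n
    using A by (auto simp: slanted_class_def bounded_clinear_functional_def)
  \<comment> \<open>For nonzero \<alpha> the ceiling is positive; a factor 0 would make the product
    finite whatever the sum is.\<close>
  define c where "c = real_of_int \<lceil>inverse \<bar>\<alpha>\<bar>\<rceil> ^ CARD('d)"
  have "0 < c" unfolding c_def using \<alpha> by (intro zero_less_power) simp
  then have "ennreal c \<noteq> 0" by simp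
  moreover have "ennreal c * S < \<infinity>"
    using A by (simp add: slanted_class_def S_def c_def)
  ultimately have S: "S < \<infinity>" by (auto simp: ennreal_mult_less_top)
  have part: "(\<Sum>j\<in>F. matrix_sup_norm (slant \<alpha> j A) * ennreal (\<omega> j)) \<le> S" if "finite F" for F :: "(int ^ 'd) set"
    unfolding S_def by (subst nonneg_infsum_complete) (use that in \<open>auto intro!: SUP_upper\<close>)
  have fin: "matrix_sup_norm (slant \<alpha> j A) < \<infinity>" for j
  proof -
    have "matrix_sup_norm (slant \<alpha> j A) * ennreal (\<omega> j) < \<infinity>"
      using part[of "{j}"] S by (simp add: le_less_trans)
    moreover have "ennreal (\<omega> j) \<noteq> 0" using \<omega>[of j] by simp
    ultimately show ?thesis by (auto simp: ennreal_mult_less_top)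
  qed
  have wS: "ennreal (w j) = matrix_sup_norm (slant \<alpha> j A)" for j
    using fin[of j] by (simp add: w_def)
  have w0: "0 \<le> w j" for j by (simp add: w_def)
  have \<omega>0: "0 \<le> \<omega> j" for j using \<omega>[of j] by simp
  show ?thesis
  proof (rule that[of w])
    show "(\<lambda>j. w j * \<omega> j) summable_on UNIV"
    proof (rule nonneg_bdd_above_summable_on)
      have "(\<Sum>j\<in>F. w j * \<omega> j) \<le> enn2real S" if "finite F" for F :: "(int ^ 'd) set"
      proof -
        have "ennreal (\<Sum>j\<in>F. w j * \<omega> j) = (\<Sum>j\<in>F. matrix_sup_norm (slant \<alpha> j A) * ennreal (\<omega> j))"
          using w0 \<omega>0 by (simp add: sum_ennreal[symmetric] ennreal_mult wS)
        also have "\<dots> \<le> S" by (rule part[OF that])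
        also have "S = ennreal (enn2real S)" using S by simp
        finally show ?thesis by simp
      qed
      then show "bdd_above (sum (\<lambda>j. w j * \<omega> j) ` {F. F \<subseteq> UNIV \<and> finite F})"
        by (auto intro!: bdd_aboveI2)
    qed (use w0 \<omega>0 in auto)
    fix m n :: "int ^ 'd" and h :: 'a
    define j where "j = (\<chi> k. \<lfloor>\<alpha> * real_of_int (m $ k)\<rfloor>) - n"
    have "slant \<alpha> j A m n = A m n"
    proof -
      have "indicator {real_of_int (j $ k)..<real_of_int (j $ k) + 1}
          (\<alpha> * real_of_int (m $ k) - real_of_int (n $ k)) = (1 :: complex)" for k
        by (simp add: j_def indicator_def)
      then show ?thesis by (simp add: slant_def)
    qed
    then have "ennreal (onorm (A m n)) \<le> matrix_sup_norm (slant \<alpha> j A)"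
      unfolding matrix_sup_norm_def by (metis SUP_upper2 UNIV_I order_refl)
    then have "onorm (A m n) \<le> w j" using w0 by (simp flip: wS)
    then show "norm (A m n h) \<le> w ((\<chi> k. \<lfloor>\<alpha> * real_of_int (m $ k)\<rfloor>) - n) * norm h"
      using onorm[OF bl, of m n h] mult_right_mono[of "onorm (A m n)" "w j" "norm h"] by (simp add: j_def)
  qed (rule w0)
qed

text \<open>On l^infty the matrix sum and the bidual of its restriction to c_0 could differ a
  priori. The m-th coordinate of the bidual is the pairing with the l^1 sequence
  \<open>V (single m 1)\<close>, hence a limit over truncations, and this limit is the row
  sum.\<close>

lemma matrix_operator_adj_pair:
  fixes a :: "int ^ 'd::finite \<Rightarrow> int ^ 'd \<Rightarrow> 'a::chilbert_space \<Rightarrow> complex"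
    and r :: "int ^ 'd \<Rightarrow> int ^ 'd"
  assumes a: "\<And>m n. bounded_clinear_functional (a m n)"
    and w: "\<And>j. 0 \<le> w j" "w summable_on UNIV" and r: "fibers_le K r" "1 \<le> K"
    and bd: "\<And>m n h. norm (a m n h) \<le> w (r m - n) * norm h"
  defines "U \<equiv> \<lambda>x m. \<Sum>\<^sub>\<infinity>n. a m n (x n)"
  obtains V where "adj_pair U V" "row_dominated r w U"
    "\<And>x m. x \<in> lp \<infinity> \<Longrightarrow> ((\<lambda>n. a m n (x n)) has_sum U x m) UNIV"
proof -
  have add: "a m n (x + y) = a m n x + a m n y" and sc: "a m n (scaleC c x) = c * a m n x"
    and zero: "a m n 0 = 0" for m n x y c
    using a[of m n] linear_add[OF bounded_linear.linear] linear_0[OF bounded_linear.linear]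
    by (auto simp: bounded_clinear_functional_def)
  have sm: "(\<lambda>n. a m n (x n)) summable_on UNIV" if "x \<in> lp \<infinity>" for x m
    by (rule abs_summable_summable,
        rule summable_on_comparison_test[OF summable_convolution[OF w that, of "r m"]])
      (simp_all add: bd)
  have hs: "((\<lambda>n. a m n (x n)) has_sum U x m) UNIV" if "x \<in> lp \<infinity>" for x m
    unfolding U_def by (rule has_sum_infsum[OF sm[OF that]])
  have nU: "norm (U x m) \<le> (\<Sum>\<^sub>\<infinity>n. w (r m - n) * norm (x n))" if x: "x \<in> lp \<infinity>" for x m
    by (rule norm_infsum_le[OF hs[OF x] has_sum_infsum[OF summable_convolution[OF w x]] bd])
  have Uq: "lp_operator q U" if q: "q \<in> lp_index" for q
    unfolding lp_operator_def
  proof (intro conjI ballI allI exI[of _ "real K * (\<Sum>\<^sub>\<infinity>j. w j)"])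
    fix f g :: "int ^ 'd \<Rightarrow> 'a" and c assume f: "f \<in> lp q"
    note fi = lp_imp_infty[OF q f]
    have le: "norm (U f m) \<le> norm (\<Sum>\<^sub>\<infinity>n. w (r m - n) * norm (f n))" for m
      using nU[OF fi, of m] by simp
    note Y = Young_convolution[OF w r q f]
    show "U f \<in> lp q" by (rule lp_solid(1)[OF q Y(1) le])
    show "lp_norm q (U f) \<le> real K * (\<Sum>\<^sub>\<infinity>j. w j) * lp_norm q f"
      using lp_solid(2)[OF q Y(1) le] Y(2) by linarith
    show "U (\<lambda>m. scaleC c (f m)) = (\<lambda>m. scaleC c (U f m))"
      by (simp add: U_def sc infsum_cmult_right')
    assume g: "g \<in> lp q"
    show "U (\<lambda>m. f m + g m) = (\<lambda>m. U f m + U g m)"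
      using infsum_add[OF sm[OF fi] sm[OF lp_imp_infty[OF q g]]] by (simp add: U_def add)
  qed
  obtain U' V where V: "adj_pair U' V" "\<And>f. f \<in> lp 0 \<Longrightarrow> U' f = U f"
    using adj_pair_extension[OF Uq] by blast
  have "U f = U' f" if f: "f \<in> lp \<infinity>" for f
  proof
    fix m :: "int ^ 'd"
    let ?s = "single m (1 :: complex)"
    have s1: "?s \<in> lp 1" by (rule single_lp) simp
    have Vs: "V ?s \<in> lp 1" by (rule adj_pair_mem(2)[OF V(1) _ s1]) simp
    have dp: "dual_pair f (V ?s)" using f Vs by (simp add: dual_pair_def)
    have coord: "pairing h (V ?s) = U' h m" if "h \<in> lp \<infinity>" for h
      using adj_pair_pairing[OF V(1), of h ?s] that s1 by (simp add: dual_pair_def)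
    have "((\<lambda>F. \<Sum>n\<in>F. a m n (f n)) \<longlongrightarrow> U' f m) (finite_subsets_at_top UNIV)"
      using pairing_trunc_tendsto[OF dp] unfolding coord[OF f]
    proof (rule Lim_transform_eventually)
      have "pairing (trunc F f) (V ?s) = (\<Sum>n\<in>F. a m n (f n))" if F: "finite F" for F
      proof -
        have t: "trunc F f \<in> lp 1" by (rule trunc_lp_one[OF F])
        have "pairing (trunc F f) (V ?s) = U' (trunc F f) m" by (rule coord, rule lp_imp_infty[OF _ t]) simp
        also have "\<dots> = U (trunc F f) m" using V(2)[OF lp_one_imp(1)[OF _ t]] by simp
        also have "\<dots> = (\<Sum>n\<in>F. a m n (f n))"
          unfolding U_def by (rule infsumI, rule has_sum_finite_neutralI[OF F]) (auto simp: trunc_def zero)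
        finally show ?thesis .
      qed
      then show "eventually (\<lambda>F. pairing (trunc F f) (V ?s) = (\<Sum>n\<in>F. a m n (f n))) (finite_subsets_at_top UNIV)"
        unfolding eventually_finite_subsets_at_top by blast
    qed
    moreover have "((\<lambda>F. \<Sum>n\<in>F. a m n (f n)) \<longlongrightarrow> U f m) (finite_subsets_at_top UNIV)"
      using hs[OF f, of m] by (simp add: has_sum_def)
    ultimately show "U f m = U' f m"
      using tendsto_unique[OF finite_subsets_at_top_neq_bot] by blast
  qed
  then have "adj_pair U V" by (rule adj_pair_cong[OF V(1)]) simp_all
  moreover have "row_dominated r w U" unfolding row_dominated_def using nU by blast
  ultimately show ?thesis using that hs by blast
qed

section \<open>Analysis and synthesis\<close>

text \<open>The series over n need not converge absolutely in norm. Boundedness of T on l^1, tested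
  on single entries, makes the scalars <h, \<phi>^n_m> absolutely summable in n with sum at most C
  |h|; in a Hilbert space this weak condition already gives unconditional convergence.\<close>

lemma analysis_adj_eq_adjoint:
  fixes \<phi> :: "int ^ 'd::finite \<Rightarrow> int ^ 'd \<Rightarrow> 'a::chilbert_space"
  assumes V: "adj_pair (analysis \<phi>) V" and c: "c \<in> lp \<infinity>"
  shows "(\<lambda>n. scaleC (c n) (\<phi> n m)) summable_on UNIV" "analysis_adj \<phi> c = V c"
proof -
  have T1: "lp_operator 1 (analysis \<phi>)" by (rule adj_pair_operator(1)[OF V]) simp
  obtain C where C: "0 \<le> C" "\<And>f. f \<in> lp 1 \<Longrightarrow> lp_norm 1 (analysis \<phi> f) \<le> C * lp_norm 1 f"
    using lp_operator_bound[OF T1] by auto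
  have Ts: "analysis \<phi> (single m h) = (\<lambda>n. cinner h (\<phi> n m))" for m h by (simp add: analysis_def)
  have c0: "0 \<le> lp_norm \<infinity> c" by (rule lp_norm_nonneg[OF c]) simp
  have s: "(\<lambda>n. scaleC (c n) (\<phi> n m)) summable_on UNIV" for m
  proof (rule weakly_summable_imp_summable)
    fix h :: 'a and F :: "(int ^ 'd) set" assume F: "finite F"
    have s1: "single m h \<in> lp 1" by (rule single_lp) simp
    have "(\<Sum>n\<in>F. cmod (cinner h (scaleC (c n) (\<phi> n m)))) = (\<Sum>n\<in>F. cmod (c n) * cmod (cinner h (\<phi> n m)))"
      by (simp add: cinner_scaleC_right norm_mult)
    also have "\<dots> \<le> (\<Sum>n\<in>F. lp_norm \<infinity> c * cmod (cinner h (\<phi> n m)))"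
      by (intro sum_mono mult_right_mono lp_norm_infty_ge[OF c]) simp
    also have "\<dots> = lp_norm \<infinity> c * (\<Sum>n\<in>F. cmod (cinner h (\<phi> n m)))" by (simp add: sum_distrib_left)
    also have "\<dots> \<le> lp_norm \<infinity> c * (C * norm h)"
    proof (rule mult_left_mono[OF _ c0])
      have T: "analysis \<phi> (single m h) \<in> lp 1" by (rule lp_operator_mem[OF T1 s1])
      then have "(\<Sum>n\<in>F. cmod (cinner h (\<phi> n m))) \<le> lp_norm 1 (analysis \<phi> (single m h))"
        using F by (simp add: lp_one_iff lp_norm_one Ts finite_sum_le_infsum)
      also have "\<dots> \<le> C * norm h" using C(2)[OF s1] by (simp add: single_lp(2))
      finally show "(\<Sum>n\<in>F. cmod (cinner h (\<phi> n m))) \<le> C * norm h" .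
    qed
    finally show "(\<Sum>n\<in>F. cmod (cinner h (scaleC (c n) (\<phi> n m)))) \<le> lp_norm \<infinity> c * C * norm h" by simp
  qed
  then show "(\<lambda>n. scaleC (c n) (\<phi> n m)) summable_on UNIV" .
  show "analysis_adj \<phi> c = V c"
  proof (rule pairing_extensionality)
    fix m h
    have "cinner h (analysis_adj \<phi> c m) = (\<Sum>\<^sub>\<infinity>n. cinner h (scaleC (c n) (\<phi> n m)))"
      unfolding analysis_adj_def
      by (rule infsumI[OF has_sum_bounded_linear[OF bounded_linear_cinner_right has_sum_infsum[OF s]], symmetric])
    also have "\<dots> = pairing (analysis \<phi> (single m h)) c"
      by (simp add: pairing_def Ts cinner_scaleC_right mult.commute)
    also have "\<dots> = pairing (single m h) (V c)"
      by (rule adj_pair_pairing[OF V dual_pair_single(1)[OF c]])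
    finally show "pairing (single m h) (analysis_adj \<phi> c) = pairing (single m h) (V c)" by simp
  qed
qed

section \<open>Norm and weak-star convergence of synthesis series\<close>

lemma lp_operator_trunc_scaleC:
  fixes W :: "(int ^ 'd::finite \<Rightarrow> complex) \<Rightarrow> int ^ 'd \<Rightarrow> 'a::chilbert_space"
  assumes W: "lp_operator q W" "q \<in> lp_index" and F: "finite F"
  shows "W (trunc F c) = (\<lambda>m. \<Sum>n\<in>F. scaleC (c n) (W (single n 1) m))"
proof -
  have "W (single n (c n)) = (\<lambda>m. scaleC (c n) (W (single n 1) m))" for n
  proof -
    have "single n (c n) = (\<lambda>m. scaleC (c n) (single n (1 :: complex) m))"
      by (auto simp: single_def)
    then show ?thesis using lp_operator_scaleC[OF W(1) single_lp(1)[OF W(2)], of "c n" n 1] by simp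
  qed
  then show ?thesis by (simp add: lp_operator_trunc[OF W F])
qed

lemma lp_has_sum_operator:
  fixes W :: "(int ^ 'd::finite \<Rightarrow> complex) \<Rightarrow> int ^ 'd \<Rightarrow> 'a::chilbert_space"
  assumes W: "lp_operator q W" and q: "q \<in> lp_index" "q \<noteq> \<infinity>" and c: "c \<in> lp q"
  shows "lp_has_sum q (\<lambda>n m. scaleC (c n) (W (single n 1) m)) (W c)"
  unfolding lp_has_sum_def
proof (intro conjI allI)
  show "W c \<in> lp q" by (rule lp_operator_mem[OF W c])
  show "(\<lambda>m. scaleC (c n) (W (single n 1) m)) \<in> lp q" for n
    by (rule lp_scaleC(1)[OF q(1) lp_operator_mem[OF W single_lp(1)[OF q(1)]]])
  have "((\<lambda>F. lp_norm q (\<lambda>m. W (trunc F c) m - W c m)) \<longlongrightarrow> 0) (finite_subsets_at_top UNIV)"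
    by (rule lp_operator_tendsto[OF W q(1) trunc_lp(1)[OF q(1) c] c trunc_tendsto[OF q c]])
  then show "((\<lambda>F. lp_norm q (\<lambda>m. (\<Sum>n\<in>F. scaleC (c n) (W (single n 1) m)) - W c m)) \<longlongrightarrow> 0)
      (finite_subsets_at_top UNIV)"
  proof (rule Lim_transform_eventually)
    show "eventually (\<lambda>F. lp_norm q (\<lambda>m. W (trunc F c) m - W c m)
        = lp_norm q (\<lambda>m. (\<Sum>n\<in>F. scaleC (c n) (W (single n 1) m)) - W c m)) (finite_subsets_at_top UNIV)"
      unfolding eventually_finite_subsets_at_top
      by (auto simp: lp_operator_trunc_scaleC[OF W q(1)])
  qed
qed

lemma limitin_weak_star:
  fixes f :: "int ^ 'd::finite \<Rightarrow> 'a::chilbert_space"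
  assumes f: "f \<in> lp \<infinity>" and u: "eventually (\<lambda>i. u i \<in> lp \<infinity>) F"
    and lim: "\<And>\<psi>. \<psi> \<in> lp 1 \<Longrightarrow> ((\<lambda>i. pairing (u i) \<psi>) \<longlongrightarrow> pairing f \<psi>) F"
  shows "limitin weak_star_topology u f F"
  unfolding limitin_def
proof (intro conjI allI impI)
  let ?S = "{{f \<in> lp \<infinity>. pairing f \<psi> \<in> U} | \<psi> U. \<psi> \<in> lp 1 \<and> open U} :: (int ^ 'd \<Rightarrow> 'a) set set"
  \<comment> \<open>The zero functional yields all of l^infty as a subbasic set, so \<open>f\<close>
    belongs to the underlying space.\<close>
  have "{f \<in> lp \<infinity>. pairing f (\<lambda>_. 0) \<in> UNIV} \<in> ?S"
    using lp_const_zero(1)[of 1] by (intro CollectI exI[of _ "\<lambda>_. 0"] exI[of _ UNIV]) auto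
  then have "f \<in> \<Union>?S" using f by blast
  then show "f \<in> topspace weak_star_topology"
    by (simp only: weak_star_topology_def topology_generated_by_topspace)
  fix U assume "openin weak_star_topology U \<and> f \<in> U"
  then have "generate_topology_on ?S U" "f \<in> U"
    by (auto simp: weak_star_topology_def openin_topology_generated_by_iff)
  then show "eventually (\<lambda>i. u i \<in> U) F"
  proof (induction rule: generate_topology_on.induct)
    case (Int a b)
    then show ?case by (auto intro: eventually_conj)
  next
    case (UN K)
    then obtain k where "k \<in> K" "f \<in> k" by blast
    with UN have "eventually (\<lambda>i. u i \<in> k) F" by blast
    then show ?case by eventually_elim (use \<open>k \<in> K\<close> in blast)
  next
    case (Basis s)
    then obtain \<psi> V where s: "s = {f \<in> lp \<infinity>. pairing f \<psi> \<in> V}" "\<psi> \<in> lp 1" "open V" by blast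
    have "eventually (\<lambda>i. pairing (u i) \<psi> \<in> V) F"
      by (rule topological_tendstoD[OF lim[OF s(2)] s(3)]) (use Basis s in auto)
    with u show ?case by eventually_elim (simp add: s)
  qed simp
qed

lemma weak_star_has_sum_operator:
  fixes W :: "(int ^ 'd::finite \<Rightarrow> complex) \<Rightarrow> int ^ 'd \<Rightarrow> 'a::chilbert_space"
  assumes W: "adj_pair W W'" and c: "c \<in> lp \<infinity>"
  shows "weak_star_has_sum (\<lambda>n m. scaleC (c n) (W (single n 1) m)) (W c)"
  unfolding weak_star_has_sum_def
proof (rule limitin_weak_star)
  have i: "\<infinity> \<in> lp_index" by simp
  have W1: "lp_operator \<infinity> W" by (rule adj_pair_operator(1)[OF W i])
  have eq: "(\<lambda>m. \<Sum>n\<in>F. scaleC (c n) (W (single n 1) m)) = W (trunc F c)" if "finite F" for F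
    using lp_operator_trunc_scaleC[OF W1 i that] by simp
  show "W c \<in> lp \<infinity>" by (rule lp_operator_mem[OF W1 c])
  have t: "trunc F c \<in> lp \<infinity>" for F by (rule trunc_lp(1)[OF i c])
  show "eventually (\<lambda>F. (\<lambda>m. \<Sum>n\<in>F. scaleC (c n) (W (single n 1) m)) \<in> lp \<infinity>) (finite_subsets_at_top UNIV)"
    unfolding eventually_finite_subsets_at_top using lp_operator_mem[OF W1 t] by (auto simp: eq)
  fix \<psi> :: "int ^ 'd \<Rightarrow> 'a" assume \<psi>: "\<psi> \<in> lp 1"
  \<comment> \<open>Moving \<open>W\<close> to the l^1 side reduces weak-star convergence of the
    images to that of the truncations of \<open>c\<close>.\<close>
  have W\<psi>: "W' \<psi> \<in> lp 1" by (rule adj_pair_mem(2)[OF W _ \<psi>]) simp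
  have p: "pairing (W h) \<psi> = pairing h (W' \<psi>)" if "h \<in> lp \<infinity>" for h
    by (rule adj_pair_pairing[OF W]) (use that \<psi> in \<open>simp add: dual_pair_def\<close>)
  have "((\<lambda>F. pairing (trunc F c) (W' \<psi>)) \<longlongrightarrow> pairing c (W' \<psi>)) (finite_subsets_at_top UNIV)"
    by (rule pairing_trunc_tendsto) (use c W\<psi> in \<open>simp add: dual_pair_def\<close>)
  then show "((\<lambda>F. pairing (\<lambda>m. \<Sum>n\<in>F. scaleC (c n) (W (single n 1) m)) \<psi>) \<longlongrightarrow> pairing (W c) \<psi>)
      (finite_subsets_at_top UNIV)"
    unfolding p[OF c]
  proof (rule Lim_transform_eventually)
    show "eventually (\<lambda>F. pairing (trunc F c) (W' \<psi>)
        = pairing (\<lambda>m. \<Sum>n\<in>F. scaleC (c n) (W (single n 1) m)) \<psi>) (finite_subsets_at_top UNIV)"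
      unfolding eventually_finite_subsets_at_top by (auto simp: eq p[OF t])
  qed
qed

section \<open>Frame inequalities as operator bounds\<close>

lemma is_frame_lower_bound:
  fixes \<phi> :: "int ^ 'd::finite \<Rightarrow> int ^ 'd \<Rightarrow> 'a::chilbert_space"
  assumes fr: "is_frame p \<phi>" and p: "p \<in> lp_index"
  obtains c where "0 < c" "\<And>f. f \<in> lp p \<Longrightarrow> c * lp_norm p f \<le> lp_norm p (analysis \<phi> f)"
  using p
proof (cases rule: lp_index_cases)
  case (finite t)
  then have t0: "p \<noteq> 0" "p \<noteq> \<infinity>" "real_of_ereal p = t" by auto
  obtain a where a: "0 < a" "\<And>f :: int ^ 'd \<Rightarrow> 'a. f \<in> lp p \<Longrightarrow>
      a * lp_norm p f powr t \<le> (\<Sum>\<^sub>\<infinity>n. norm (pairing f (\<phi> n)) powr t)"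
    using fr t0 unfolding is_frame_def by auto
  show ?thesis
  \<comment> \<open>The frame inequality compares t-th powers; the root turns it into a bound
    between norms.\<close>
  proof (rule that[of "a powr (1 / t)"])
    fix f :: "int ^ 'd \<Rightarrow> 'a" assume f: "f \<in> lp p"
    have "a powr (1 / t) * lp_norm p f = (a * lp_norm p f powr t) powr (1 / t)"
      using finite a(1) lp_norm_nonneg[OF f p] by (simp add: powr_mult powr_powr)
    also have "\<dots> \<le> (\<Sum>\<^sub>\<infinity>n. norm (pairing f (\<phi> n)) powr t) powr (1 / t)"
      using a f finite by (intro powr_mono2) auto
    also have "\<dots> = lp_norm p (analysis \<phi> f)"
      unfolding finite(1) lp_norm_ereal[OF finite(2)] by (simp add: analysis_def)
    finally show "a powr (1 / t) * lp_norm p f \<le> lp_norm p (analysis \<phi> f)" .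
  qed (use a in simp)
qed (use fr that in \<open>auto simp: is_frame_def lp_norm_sup analysis_def\<close>)

text \<open>Boundedness of the analysis operator is the upper frame bound, and boundedness of a left
  inverse gives the lower one.\<close>

lemma is_frameI:
  fixes \<phi> :: "int ^ 'd::finite \<Rightarrow> int ^ 'd \<Rightarrow> 'a::chilbert_space"
  assumes q: "q \<in> lp_index" and \<phi>: "\<And>n. \<phi> n \<in> lp 1" and T: "lp_operator q (analysis \<phi>)"
    and L: "lp_operator q L" "\<And>f. f \<in> lp q \<Longrightarrow> L (analysis \<phi> f) = f"
  shows "is_frame q \<phi>"
proof -
  obtain b0 where b0: "0 \<le> b0" "\<And>f. f \<in> lp q \<Longrightarrow> lp_norm q (analysis \<phi> f) \<le> b0 * lp_norm q f"
    using lp_operator_bound[OF T q] by blast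
  obtain C0 where C0: "0 \<le> C0" "\<And>f. f \<in> lp q \<Longrightarrow> lp_norm q (L f) \<le> C0 * lp_norm q f"
    using lp_operator_bound[OF L(1) q] by blast
  \<comment> \<open>The added ones keep a positive and ensure a <= 1 <= b, an order that survives
    taking t-th powers.\<close>
  define a where "a = 1 / (C0 + 1)"
  define b where "b = b0 + 1"
  have ab: "0 < a" "a \<le> 1" "1 \<le> b" using b0 C0 by (auto simp: a_def b_def)
  have Tq: "analysis \<phi> f \<in> lp q" if "f \<in> lp q" for f by (rule lp_operator_mem[OF T that])
  have up: "lp_norm q (analysis \<phi> f) \<le> b * lp_norm q f" if f: "f \<in> lp q" for f
    using b0(2)[OF f] lp_norm_nonneg[OF f q] by (simp add: b_def distrib_right)
  have lo: "a * lp_norm q f \<le> lp_norm q (analysis \<phi> f)" if f: "f \<in> lp q" for f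
  proof -
    have "lp_norm q f \<le> C0 * lp_norm q (analysis \<phi> f)" using C0(2)[OF Tq[OF f]] L(2)[OF f] by simp
    also have "\<dots> \<le> (C0 + 1) * lp_norm q (analysis \<phi> f)"
      using lp_norm_nonneg[OF Tq[OF f] q] by (simp add: distrib_right)
    finally show ?thesis using C0(1) by (simp add: a_def field_simps)
  qed
  show ?thesis
    using q
  proof (cases rule: lp_index_cases)
    case (finite t)
    then have t0: "q \<noteq> 0" "q \<noteq> \<infinity>" "real_of_ereal q = t" by auto
    have eq: "(\<Sum>\<^sub>\<infinity>n. norm (pairing f (\<phi> n)) powr t) = lp_norm q (analysis \<phi> f) powr t" for f
      unfolding finite(1) lp_norm_ereal_powr[OF finite(2)] by (simp add: analysis_def)
    have "(\<lambda>n. norm (pairing f (\<phi> n)) powr t) summable_on UNIV \<and>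
          a powr t * lp_norm q f powr t \<le> (\<Sum>\<^sub>\<infinity>n. norm (pairing f (\<phi> n)) powr t) \<and>
          (\<Sum>\<^sub>\<infinity>n. norm (pairing f (\<phi> n)) powr t) \<le> b powr t * lp_norm q f powr t"
      if f: "f \<in> lp q" for f
    proof (intro conjI)
      show "(\<lambda>n. norm (pairing f (\<phi> n)) powr t) summable_on UNIV"
        using Tq[OF f] unfolding finite(1) lp_ereal_iff[OF finite(2)] by (simp add: analysis_def)
      show "a powr t * lp_norm q f powr t \<le> (\<Sum>\<^sub>\<infinity>n. norm (pairing f (\<phi> n)) powr t)"
        unfolding eq powr_mult[symmetric]
        using lo[OF f] ab finite lp_norm_nonneg[OF f q] by (intro powr_mono2) auto
      show "(\<Sum>\<^sub>\<infinity>n. norm (pairing f (\<phi> n)) powr t) \<le> b powr t * lp_norm q f powr t"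
        unfolding eq powr_mult[symmetric]
        using up[OF f] finite lp_norm_nonneg[OF Tq[OF f] q] by (intro powr_mono2) auto
    qed
    moreover have "a powr t \<le> b powr t" using ab finite by (intro powr_mono2) auto
    moreover have "0 < a powr t" using ab by simp
    ultimately show ?thesis
      unfolding is_frame_def using \<phi> t0 by (intro conjI allI exI[of _ "a powr t"] exI[of _ "b powr t"]) auto
  next
    case zero
    have "bdd_above (range (\<lambda>n. norm (pairing f (\<phi> n))))" if "f \<in> lp 0" for f
      using lp_sup_bdd[OF lp_imp_infty[OF q Tq[of f]]] that zero by (simp add: analysis_def)
    moreover have "lp_norm q (analysis \<phi> f) = (SUP n. norm (pairing f (\<phi> n)))" for f
      by (simp add: zero lp_norm_sup analysis_def)
    ultimately show ?thesis
      unfolding is_frame_def using \<phi> ab zero lo up by (intro conjI allI exI[of _ a] exI[of _ b]) auto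
  next
    case infty
    have "bdd_above (range (\<lambda>n. norm (pairing f (\<phi> n))))" if "f \<in> lp \<infinity>" for f
      using lp_sup_bdd[OF lp_imp_infty[OF q Tq[of f]]] that infty by (simp add: analysis_def)
    moreover have "lp_norm q (analysis \<phi> f) = (SUP n. norm (pairing f (\<phi> n)))" for f
      by (simp add: infty lp_norm_sup analysis_def)
    ultimately show ?thesis
      unfolding is_frame_def using \<phi> ab infty lo up by (intro conjI allI exI[of _ a] exI[of _ b]) auto
  qed
qed

section \<open>Inverses and adjoints of isomorphisms\<close>

lemma mutually_inverse_on_lp:
  fixes U W :: "(int ^ 'd::finite \<Rightarrow> 'a::chilbert_space) \<Rightarrow> (int ^ 'd \<Rightarrow> 'a)"
  assumes U: "adj_pair U U'" and W: "adj_pair W W'"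
    and WU: "\<And>f. f \<in> lp \<infinity> \<Longrightarrow> W (U f) = f" and UW: "\<And>f. f \<in> lp \<infinity> \<Longrightarrow> U (W f) = f"
    and q: "q \<in> lp_index"
  shows "bij_betw U (lp q) (lp q)" "\<And>f. f \<in> lp q \<Longrightarrow> inv_into (lp q) U f = W f"
proof -
  note i = lp_imp_infty[OF q]
  show b: "bij_betw U (lp q) (lp q)"
    by (rule bij_betw_byWitness[where f' = W])
      (use WU UW i adj_pair_mem(1)[OF U q] adj_pair_mem(1)[OF W q] in auto)
  show "inv_into (lp q) U f = W f" if "f \<in> lp q" for f
    by (rule inv_into_f_eq) (use b UW i adj_pair_mem(1)[OF W q] that in \<open>auto simp: bij_betw_def\<close>)
qed

lemma linf_isomorphism_adj_pair:
  fixes U W :: "(int ^ 'd::finite \<Rightarrow> 'a::chilbert_space) \<Rightarrow> (int ^ 'd \<Rightarrow> 'a)"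
  assumes U: "adj_pair U U'" and W: "adj_pair W W'"
    and WU: "\<And>f. f \<in> lp \<infinity> \<Longrightarrow> W (U f) = f" and UW: "\<And>f. f \<in> lp \<infinity> \<Longrightarrow> U (W f) = f"
  shows "linf_isomorphism U" "\<And>q. q \<in> lp_index \<Longrightarrow> U ` lp q = lp q"
proof -
  have bij: "bij_betw U (lp q) (lp q)" and inv: "\<And>f. f \<in> lp q \<Longrightarrow> inv_into (lp q) U f = W f"
    if "q \<in> lp_index" for q
    by (rule mutually_inverse_on_lp[OF U W]; use WU UW that in auto)+
  show "linf_isomorphism U"
    unfolding linf_isomorphism_def
    using bij[of \<infinity>] inv[of \<infinity>] adj_pair_operator(1)[OF U, of \<infinity>]
      lp_operator_cong[OF adj_pair_operator(1)[OF W, of \<infinity>]] by auto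
  show "U ` lp q = lp q" if "q \<in> lp_index" for q
    using bij[OF that] by (simp add: bij_betw_def)
qed

lemma adj_pair_left_inverse_adjoint:
  fixes U :: "(int ^ 'd::finite \<Rightarrow> 'a::chilbert_space) \<Rightarrow> (int ^ 'd \<Rightarrow> 'b::chilbert_space)"
  assumes U: "adj_pair U U'" and W: "adj_pair W W'"
    and WU: "\<And>f. f \<in> lp \<infinity> \<Longrightarrow> W (U f) = f" and g: "g \<in> lp \<infinity>"
  shows "U' (W' g) = g"
proof (rule pairing_extensionality)
  fix m and h :: 'a
  have d: "dual_pair (single m h) g" by (rule dual_pair_single(1)[OF g])
  have s: "single m h \<in> lp \<infinity>" by (rule single_lp) simp
  show "pairing (single m h) (U' (W' g)) = pairing (single m h) g"
    using adj_pair_pairing[OF adj_pair_comp[OF U W] d] WU[OF s] by simp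
qed

text \<open>Inserting S R on either side: <R f, g> = <R f, S R g> = <S R f, R g> = <f, R g>.\<close>

lemma adj_pair_inverse_selfadjoint:
  fixes S :: "(int ^ 'd::finite \<Rightarrow> 'a::chilbert_space) \<Rightarrow> (int ^ 'd \<Rightarrow> 'a)"
  assumes S: "adj_pair S S" and R: "adj_pair R R'"
    and SR: "\<And>f. f \<in> lp \<infinity> \<Longrightarrow> S (R f) = f"
  shows "adj_pair R R"
  unfolding adj_pair_def
proof (intro conjI ballI allI impI adj_pair_operator(1)[OF R])
  fix f g :: "int ^ 'd \<Rightarrow> 'a" assume d: "dual_pair f g"
  then have fg: "f \<in> lp \<infinity>" "g \<in> lp \<infinity>" using lp_imp_infty[of 1] by (auto simp: dual_pair_def)
  have "dual_pair (R f) (R g)"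
    using d adj_pair_mem(1)[OF R, of 1] adj_pair_mem(1)[OF R, of \<infinity>] by (auto simp: dual_pair_def)
  from adj_pair_pairing[OF S this] show "pairing (R f) g = pairing f (R g)" by (simp add: SR fg)
qed

section \<open>Localized frames\<close>

text \<open>\<open>J1\<close> is only known to agree with \<open>J\<close> on c_0, so the matrix of
  T J does not describe T on l^infty directly. The factorization is recovered as T = U I1, because
  each \<phi>^n lies in l^1 and is determined by the values of T on single entries.\<close>

lemma localized_frame_structure:
  fixes \<phi> :: "int ^ 'd::finite \<Rightarrow> int ^ 'd \<Rightarrow> 'h::chilbert_space"
  assumes \<alpha>: "\<alpha> \<noteq> 0" and s: "s > (real CARD('d) + 1)\<^sup>2" and p: "p \<in> lp_index"
    and loc: "localized_frame s \<alpha> p \<phi>"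
  obtains R J1 J1s I1 I1s :: "(int ^ 'd \<Rightarrow> 'h) \<Rightarrow> int ^ 'd \<Rightarrow> 'h" and A where
    "adj_pair (analysis \<phi>) (analysis_adj \<phi>)"
    "adj_pair R R" "\<And>f. f \<in> lp \<infinity> \<Longrightarrow> R (frame_op \<phi> f) = f" "\<And>f. f \<in> lp \<infinity> \<Longrightarrow> frame_op \<phi> (R f) = f"
    "adj_pair J1 J1s" "adj_pair I1 I1s"
    "\<And>f. f \<in> lp \<infinity> \<Longrightarrow> J1 (I1 f) = f" "\<And>f. f \<in> lp \<infinity> \<Longrightarrow> I1 (J1 f) = f"
    "A \<in> slanted_class \<alpha> (poly_weight s)"
    "\<And>x m. x \<in> lp \<infinity> \<Longrightarrow> ((\<lambda>n. A m n (x n)) has_sum analysis \<phi> (J1 x) m) UNIV"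
proof -
  obtain J A where iso: "linf_isomorphism J" and inv: "\<And>q. q \<in> lp_index \<Longrightarrow> J ` lp q = lp q"
    and A: "A \<in> slanted_class \<alpha> (poly_weight s)"
    and AJ: "\<And>x m. x \<in> lp p \<Longrightarrow> ((\<lambda>n. A m n (x n)) has_sum analysis \<phi> (J x) m) UNIV"
    using loc unfolding localized_frame_def in_slanted_class_def by blast
  have fr: "is_frame p \<phi>" using loc by (simp add: localized_frame_def)
  have \<phi>1: "\<phi> n \<in> lp 1" for n using fr by (simp add: is_frame_def)
  define Ji where "Ji = inv_into (lp \<infinity>) J"
  have Jop: "lp_operator \<infinity> J" and Jiop: "lp_operator \<infinity> Ji" and Jbij: "bij_betw J (lp \<infinity>) (lp \<infinity>)"
    using iso by (auto simp: linf_isomorphism_def Ji_def)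
  have JiJ: "Ji (J f) = f" if "f \<in> lp \<infinity>" for f
    unfolding Ji_def by (rule bij_betw_inv_into_left[OF Jbij that])
  have JJi: "J (Ji f) = f" if "f \<in> lp \<infinity>" for f
    unfolding Ji_def by (rule bij_betw_inv_into_right[OF Jbij that])
  have Jq: "lp_operator q J" if q: "q \<in> lp_index" for q
    by (rule lp_operator_if_invariant[OF q Jop]) (use inv[OF q] in blast)
  \<comment> \<open>Invariance as equality of image and space makes the inverse preserve l^q
    too.\<close>
  have Jiq: "lp_operator q Ji" if q: "q \<in> lp_index" for q
  proof (rule lp_operator_if_invariant[OF q Jiop])
    fix f :: "int ^ 'd \<Rightarrow> 'h" assume "f \<in> lp q"
    then obtain g where "g \<in> lp q" "f = J g" using inv[OF q] by blast
    then show "Ji f \<in> lp q" using JiJ[OF lp_imp_infty[OF q]] by simp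
  qed
  obtain J1 J1s where J1: "adj_pair J1 J1s" "\<And>f. f \<in> lp 0 \<Longrightarrow> J1 f = J f"
    using adj_pair_extension[OF Jq] by blast
  obtain I1 I1s where I1: "adj_pair I1 I1s" "\<And>f. f \<in> lp 0 \<Longrightarrow> I1 f = Ji f"
    using adj_pair_extension[OF Jiq] by blast
  have s0: "single m h \<in> lp 0" for m and h :: 'h by (rule single_lp) simp
  have z0: "f \<in> lp 0 \<Longrightarrow> f \<in> lp \<infinity>" for f :: "int ^ 'd \<Rightarrow> 'h" by (rule lp_zero_imp_infty)
  have Jz: "J f \<in> lp 0" and Jiz: "Ji f \<in> lp 0" if "f \<in> lp 0" for f
    using lp_operator_mem[OF Jq that] lp_operator_mem[OF Jiq that] by auto
  have JI: "J1 (I1 f) = f" if f: "f \<in> lp \<infinity>" for f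
    by (rule adj_pair_unique[OF adj_pair_comp[OF I1(1) J1(1)] adj_pair_id _ f])
      (simp add: I1(2) J1(2) s0 Jiz JJi z0)
  have IJ: "I1 (J1 f) = f" if f: "f \<in> lp \<infinity>" for f
    by (rule adj_pair_unique[OF adj_pair_comp[OF J1(1) I1(1)] adj_pair_id _ f])
      (simp add: I1(2) J1(2) s0 Jz JiJ z0)

  \<comment> \<open>2d + 1 <= (d + 1)^2, so the weight of order s dominates the moment of order
    \<open>e\<close> that the lower bound consumes.\<close>
  define e where "e = 2 * CARD('d) + 1"
  have es: "real e \<le> s"
  proof -
    have "real e \<le> (real CARD('d) + 1)\<^sup>2" by (simp add: e_def power2_eq_square algebra_simps)
    then show ?thesis using s by simp
  qed
  have w1: "1 \<le> poly_weight s j" for j :: "int ^ 'd"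
    unfolding poly_weight_def using es by (intro ge_one_powr_ge_zero) auto
  obtain w where w: "\<And>j. 0 \<le> w j" "(\<lambda>j. w j * poly_weight s j) summable_on UNIV"
    and Aw: "\<And>m n h. norm (A m n h) \<le> w ((\<chi> k. \<lfloor>\<alpha> * real_of_int (m $ k)\<rfloor>) - n) * norm h"
    using slanted_class_bounds[OF A \<alpha> w1] by blast
  have we: "(\<lambda>j. w j * zweight j ^ e) summable_on UNIV"
  proof (rule summable_on_comparison_test[OF w(2)])
    show "w j * zweight j ^ e \<le> w j * poly_weight s j" for j
    proof (rule mult_left_mono[OF _ w(1)])
      have "zweight j ^ e = zweight j powr real e" by (rule powr_realpow[symmetric]) (simp add: add_pos_nonneg)
      also have "\<dots> \<le> poly_weight s j" unfolding poly_weight_def by (rule powr_mono[OF es]) simp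
      finally show "zweight j ^ e \<le> poly_weight s j" .
    qed
  qed (simp add: w)
  have ws: "w summable_on UNIV"
  proof (rule summable_on_comparison_test[OF we])
    show "w j \<le> w j * zweight j ^ e" for j
      using mult_left_mono[OF one_le_power[OF zweight_ge_one] w(1)] by (metis mult.right_neutral)
  qed (rule w)
  define r where "r = (\<lambda>m :: int ^ 'd. \<chi> k. \<lfloor>\<alpha> * real_of_int (m $ k)\<rfloor>)"
  obtain K where K: "1 \<le> K" "fibers_le K r"
    by (rule fibers_le_floor_scale[OF \<alpha>]) (rule that[unfolded r_def])
  have bcf: "bounded_clinear_functional (A m n)" for m n using A by (simp add: slanted_class_def)
  have Aw': "norm (A m n h) \<le> w (r m - n) * norm h" for m n h unfolding r_def by (rule Aw)
  define U where "U x m = (\<Sum>\<^sub>\<infinity>n. A m n (x n))" for x m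
  obtain Us where U: "adj_pair U Us" "row_dominated r w U"
    and hs: "\<And>x m. x \<in> lp \<infinity> \<Longrightarrow> ((\<lambda>n. A m n (x n)) has_sum U x m) UNIV"
    using matrix_operator_adj_pair[OF bcf w(1) ws K(2,1) Aw'] unfolding U_def[abs_def] by blast
  have UJ: "U x = analysis \<phi> (J x)" if "x \<in> lp p" for x
    unfolding U_def using infsumI[OF AJ[OF that]] by auto

  obtain c where c: "0 < c" "\<And>f. f \<in> lp p \<Longrightarrow> c * lp_norm p f \<le> lp_norm p (analysis \<phi> f)"
    by (rule is_frame_lower_bound[OF fr p]) (rule that)
  obtain C where C: "0 \<le> C" "\<And>f. f \<in> lp p \<Longrightarrow> lp_norm p (Ji f) \<le> C * lp_norm p f"
    using lp_operator_bound[OF Jiq[OF p] p] by blast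
  \<comment> \<open>The frame bound applies at J z, and boundedness of the inverse of
    \<open>J\<close> leads back to z; C + 1 keeps the denominator positive.\<close>
  have below: "c / (C + 1) * lp_norm p z \<le> lp_norm p (U z)" if z: "z \<in> lp p" for z
  proof -
    have Jz: "J z \<in> lp p" by (rule lp_operator_mem[OF Jq[OF p] z])
    have "lp_norm p z \<le> C * lp_norm p (J z)"
      using C(2)[OF Jz] JiJ[OF lp_imp_infty[OF p z]] by simp
    also have "\<dots> \<le> (C + 1) * lp_norm p (J z)"
      using lp_norm_nonneg[OF Jz p] by (simp add: distrib_right)
    finally have "c / (C + 1) * lp_norm p z \<le> c / (C + 1) * ((C + 1) * lp_norm p (J z))"
      using c C(1) by (intro mult_left_mono) auto
    also have "\<dots> = c * lp_norm p (J z)" using C(1) by simp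
    also have "\<dots> \<le> lp_norm p (U z)" using c(2)[OF Jz] UJ[OF z] by simp
    finally show ?thesis .
  qed
  have "0 < c / (C + 1)" using c C(1) by simp
  then obtain G Gs where G: "adj_pair G Gs" "\<And>f. f \<in> lp \<infinity> \<Longrightarrow> G (Us (U f)) = f"
    "\<And>f. f \<in> lp \<infinity> \<Longrightarrow> Us (U (G f)) = f"
    using gram_inverse[OF U w(1) we[unfolded e_def] K(2,1) p _ below] by metis

  have i: "\<infinity> \<in> lp_index" by simp
  note UI = adj_pair_comp[OF I1(1) U(1)]
  have c1: "single n (1 :: complex) \<in> lp 1" for n :: "int ^ 'd" by (rule single_lp) simp
  have dp1: "dual_pair f (single n (1 :: complex))" if "f \<in> lp \<infinity>" for n and f :: "int ^ 'd \<Rightarrow> 'h"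
    using that c1 by (simp add: dual_pair_def)
  \<comment> \<open>A single entry lies in c_0, where \<open>I1\<close> is the inverse of
    \<open>J\<close>; its image lies in l^1, hence in l^p, where the matrix represents T J.\<close>
  have \<phi>eq: "\<phi> n = I1s (Us (single n 1))" for n
  proof (rule pairing_extensionality)
    fix m :: "int ^ 'd" and h :: 'h
    have s1: "single m h \<in> lp 1" and si: "single m h \<in> lp \<infinity>" by (simp_all add: single_lp(1))
    have "Ji (single m h) \<in> lp 1" by (rule lp_operator_mem[OF Jiq s1]) simp
    then have Jp: "Ji (single m h) \<in> lp p" by (rule lp_one_imp(1)[OF p])
    have "pairing (single m h) (\<phi> n) = analysis \<phi> (J (Ji (single m h))) n"
      by (simp add: analysis_def JJi[OF si])
    also have "\<dots> = U (I1 (single m h)) n" by (simp add: UJ[OF Jp, symmetric] I1(2)[OF s0])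
    also have "\<dots> = pairing (U (I1 (single m h))) (single n 1)" by simp
    also have "\<dots> = pairing (single m h) (I1s (Us (single n 1)))"
      by (rule adj_pair_pairing[OF UI dp1[OF si]])
    finally show "pairing (single m h) (\<phi> n) = pairing (single m h) (I1s (Us (single n 1)))" .
  qed
  have T: "analysis \<phi> f = U (I1 f)" if f: "f \<in> lp \<infinity>" for f
  proof
    fix n
    have "analysis \<phi> f n = pairing f (I1s (Us (single n 1)))" by (simp add: analysis_def \<phi>eq)
    also have "\<dots> = pairing (U (I1 f)) (single n 1)"
      by (rule adj_pair_pairing[OF UI dp1[OF f], symmetric])
    finally show "analysis \<phi> f n = U (I1 f) n" by simp
  qed
  have TV: "adj_pair (analysis \<phi>) (\<lambda>c. I1s (Us c))"
    by (rule adj_pair_cong[OF UI]) (simp_all add: T)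
  have Ts: "analysis_adj \<phi> c = I1s (Us c)" if "c \<in> lp \<infinity>" for c
    by (rule analysis_adj_eq_adjoint(2)[OF TV that])
  have TT: "adj_pair (analysis \<phi>) (analysis_adj \<phi>)"
    by (rule adj_pair_cong[OF TV]) (simp_all add: Ts)
  have S: "frame_op \<phi> f = I1s (Us (U (I1 f)))" if f: "f \<in> lp \<infinity>" for f
    unfolding frame_op_def T[OF f] by (rule Ts) (rule adj_pair_mem(1)[OF UI i f])
  have SS: "adj_pair (frame_op \<phi>) (frame_op \<phi>)"
    unfolding frame_op_def[abs_def] by (rule adj_pair_comp[OF TT adj_pair_sym[OF TT]])
  \<comment> \<open>The adjoints of \<open>J1\<close> and \<open>I1\<close> are mutually inverse as
    well, so this undoes the factors of I1^* U^* U I1 one by one.\<close>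
  define R where "R f = J1 (G (J1s f))" for f
  have R0: "adj_pair R (\<lambda>f. J1 (Gs (J1s f)))"
    unfolding R_def[abs_def]
    by (rule adj_pair_comp[OF adj_pair_comp[OF adj_pair_sym[OF J1(1)] G(1)] J1(1)])
  have m: "I1 f \<in> lp \<infinity>" "J1s f \<in> lp \<infinity>" "G f \<in> lp \<infinity>" "Us (U f) \<in> lp \<infinity>" if "f \<in> lp \<infinity>" for f
    using adj_pair_mem(1)[OF I1(1) i that] adj_pair_mem(2)[OF J1(1) i that] adj_pair_mem(1)[OF G(1) i that]
      adj_pair_mem(2)[OF U(1) i adj_pair_mem(1)[OF U(1) i that]] by auto
  have IJs: "I1s (J1s f) = f" if "f \<in> lp \<infinity>" for f
    by (rule adj_pair_left_inverse_adjoint[OF I1(1) J1(1) JI that])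
  have JIs: "J1s (I1s f) = f" if "f \<in> lp \<infinity>" for f
    by (rule adj_pair_left_inverse_adjoint[OF J1(1) I1(1) IJ that])
  have SR: "frame_op \<phi> (R f) = f" if f: "f \<in> lp \<infinity>" for f
  proof -
    have "R f \<in> lp \<infinity>" by (rule adj_pair_mem(1)[OF R0 i f])
    then show ?thesis by (simp add: S R_def IJ G(3) IJs m f)
  qed
  have RS: "R (frame_op \<phi> f) = f" if f: "f \<in> lp \<infinity>" for f
    by (simp add: S[OF f] R_def JIs G(2) JI m f)
  have "((\<lambda>n. A m n (x n)) has_sum analysis \<phi> (J1 x) m) UNIV" if x: "x \<in> lp \<infinity>" for x m
    using hs[OF x, of m] T[OF adj_pair_mem(1)[OF J1(1) i x]] IJ[OF x] by simp
  note AJ1 = this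
  show ?thesis
    by (rule that[OF TT adj_pair_inverse_selfadjoint[OF SS R0 SR] RS SR J1(1) I1(1) JI IJ A AJ1])
qed

lemma localized_frameI:
  fixes \<phi> :: "int ^ 'd::finite \<Rightarrow> int ^ 'd \<Rightarrow> 'h::chilbert_space"
    and J W :: "(int ^ 'd \<Rightarrow> 'h) \<Rightarrow> int ^ 'd \<Rightarrow> 'h"
  assumes q: "q \<in> lp_index" and s: "1 < s" "\<alpha> \<noteq> 0" and fr: "is_frame q \<phi>"
    and J: "adj_pair J J'" and W: "adj_pair W W'"
    and inverse: "\<And>f. f \<in> lp \<infinity> \<Longrightarrow> W (J f) = f" "\<And>f. f \<in> lp \<infinity> \<Longrightarrow> J (W f) = f"
    and A: "A \<in> slanted_class \<alpha> (poly_weight s)"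
    and AJ: "\<And>x m. x \<in> lp \<infinity> \<Longrightarrow> ((\<lambda>n. A m n (x n)) has_sum analysis \<phi> (J x) m) UNIV"
  shows "localized_frame s \<alpha> q \<phi>"
  unfolding localized_frame_def
proof (intro conjI exI[of _ J] ballI fr s)
  show "linf_isomorphism J" by (rule linf_isomorphism_adj_pair(1)[OF J W inverse])
  show "J ` lp q = lp q" if "q \<in> lp_index" for q
    by (rule linf_isomorphism_adj_pair(2)[OF J W inverse that])
  show "in_slanted_class \<alpha> (poly_weight s) q (\<lambda>f. analysis \<phi> (J f))"
    unfolding in_slanted_class_def using A AJ lp_imp_infty[OF q] by blast
qed

theorem theorem3p1:
  fixes \<phi> :: "int ^ 'd::finite \<Rightarrow> int ^ 'd \<Rightarrow> 'h::chilbert_space"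
    and \<alpha> s :: real and p :: ereal
  assumes "separable_space (euclidean :: 'h topology)"
    and "\<alpha> \<noteq> 0"
    and "s > (real CARD('d) + 1)\<^sup>2"
    and "p \<in> lp_index"
    and "localized_frame s \<alpha> p \<phi>"
  shows
    "(\<forall>q\<in>lp_index.
        lp_operator q (analysis \<phi>) \<and>
        (\<exists>L :: (int ^ 'd \<Rightarrow> complex) \<Rightarrow> (int ^ 'd \<Rightarrow> 'h).
           lp_operator q L \<and> (\<forall>f\<in>lp q. L (analysis \<phi> f) = f)) \<and>
        (\<forall>c\<in>lp q. \<forall>m. (\<lambda>n. scaleC (c n) (\<phi> n m)) summable_on UNIV) \<and>
        lp_operator q (analysis_adj \<phi>) \<and>
        bij_betw (frame_op \<phi>) (lp q) (lp q) \<and>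
        lp_operator q (frame_op_inv q \<phi>) \<and>
        lp_operator q (synthesis q \<phi>)) \<and>
     (\<forall>q\<in>lp_index.
        localized_frame s \<alpha> q \<phi> \<and> localized_frame s \<alpha> q (dual_sequence \<phi>)) \<and>
     (\<forall>q\<in>lp_index - {\<infinity>}. \<forall>f\<in>lp q.
        f = synthesis q \<phi> (analysis \<phi> f) \<and>
        lp_has_sum q (\<lambda>n m. scaleC (pairing f (\<phi> n)) (dual_sequence \<phi> n m)) f \<and>
        lp_has_sum q (\<lambda>n m. scaleC (pairing f (dual_sequence \<phi> n)) (\<phi> n m)) f) \<and>
     (\<forall>f\<in>lp \<infinity>.
        f = synthesis \<infinity> \<phi> (analysis \<phi> f) \<and>
        weak_star_has_sum (\<lambda>n m. scaleC (pairing f (\<phi> n)) (dual_sequence \<phi> n m)) f \<and>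
        weak_star_has_sum (\<lambda>n m. scaleC (pairing f (dual_sequence \<phi> n)) (\<phi> n m)) f)"
proof -
  obtain R J1 J1s I1 I1s :: "(int ^ 'd \<Rightarrow> 'h) \<Rightarrow> int ^ 'd \<Rightarrow> 'h" and A where
    T: "adj_pair (analysis \<phi>) (analysis_adj \<phi>)" and
    R: "adj_pair R R" and RS: "\<And>f. f \<in> lp \<infinity> \<Longrightarrow> R (frame_op \<phi> f) = f" and
    SR: "\<And>f. f \<in> lp \<infinity> \<Longrightarrow> frame_op \<phi> (R f) = f" and
    J: "adj_pair J1 J1s" and I: "adj_pair I1 I1s" and
    JI: "\<And>f. f \<in> lp \<infinity> \<Longrightarrow> J1 (I1 f) = f" and IJ: "\<And>f. f \<in> lp \<infinity> \<Longrightarrow> I1 (J1 f) = f" and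
    A: "A \<in> slanted_class \<alpha> (poly_weight s)" and
    AJ: "\<And>x m. x \<in> lp \<infinity> \<Longrightarrow> ((\<lambda>n. A m n (x n)) has_sum analysis \<phi> (J1 x) m) UNIV"
    by (rule localized_frame_structure[OF assms(2-5)]) (rule that)
  note i = lp_imp_infty
  have i': "\<infinity> \<in> lp_index" "1 \<in> lp_index" by auto
  have s1: "1 < s"
    using assms(5) by (simp add: localized_frame_def)
  have S: "adj_pair (frame_op \<phi>) (frame_op \<phi>)"
    unfolding frame_op_def[abs_def] by (rule adj_pair_comp[OF T adj_pair_sym[OF T]])
  \<comment> \<open>The columns of T^* are the frame vectors; this turns operator identities into
    the series of the reconstruction formula.\<close>
  have \<phi>: "analysis_adj \<phi> (single n 1) = \<phi> n" for n
  proof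
    fix m
    show "analysis_adj \<phi> (single n 1) m = \<phi> n m"
      unfolding analysis_adj_def
      by (rule infsumI, rule has_sum_finite_neutralI[of "{n}"]) (auto simp: single_def)
  qed
  have \<phi>1: "\<phi> n \<in> lp 1" for n
    using adj_pair_mem(2)[OF T i'(2) single_lp(1)[OF i'(2)]] \<phi> by metis
  have inv: "frame_op_inv q \<phi> f = R f" if "q \<in> lp_index" "f \<in> lp q" for q f
    unfolding frame_op_inv_def by (rule mutually_inverse_on_lp(2)[OF S R RS SR that])
  have dual: "dual_sequence \<phi> n = R (\<phi> n)" for n
    unfolding dual_sequence_def by (rule inv[OF i'(1) i[OF i'(2) \<phi>1]])
  have dual1: "dual_sequence \<phi> n \<in> lp 1" for n
    unfolding dual by (rule adj_pair_mem(1)[OF R i'(2) \<phi>1])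
  \<comment> \<open>Self-adjointness of \<open>R\<close> moves it from \<phi>^n to f, so the
    analysis operator of the dual sequence is T R.\<close>
  have Td: "analysis (dual_sequence \<phi>) f = analysis \<phi> (R f)" if f: "f \<in> lp \<infinity>" for f
  proof
    fix n
    have "dual_pair f (\<phi> n)" using f \<phi>1 by (simp add: dual_pair_def)
    from adj_pair_pairing[OF R this]
    show "analysis (dual_sequence \<phi>) f n = analysis \<phi> (R f) n" by (simp add: analysis_def dual)
  qed
  have Tdop: "lp_operator q (analysis (dual_sequence \<phi>))" if q: "q \<in> lp_index" for q
    by (rule lp_operator_cong[OF adj_pair_operator(1)[OF adj_pair_comp[OF R T] q] q]) (rule Td[OF i[OF q]])
  have W: "adj_pair (\<lambda>c. R (analysis_adj \<phi> c)) (\<lambda>f. analysis \<phi> (R f))"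
    by (rule adj_pair_comp[OF adj_pair_sym[OF T] R])
  have syn: "synthesis q \<phi> c = R (analysis_adj \<phi> c)" if "q \<in> lp_index" "c \<in> lp q" for q c
    unfolding synthesis_def by (rule inv[OF that(1) adj_pair_mem(2)[OF T that]])
  have rec: "R (analysis_adj \<phi> (analysis \<phi> f)) = f" if "f \<in> lp \<infinity>" for f
    using RS[OF that] by (simp add: frame_op_def)
  \<comment> \<open>T^* T R is the identity, so T^* is a left inverse of the dual analysis operator;
    this gives the second expansion and the lower frame bound of the dual sequence.\<close>
  have rec2: "analysis_adj \<phi> (analysis (dual_sequence \<phi>) f) = f" if "f \<in> lp \<infinity>" for f
    using SR[OF that] by (simp add: frame_op_def Td[OF that])
  have Tm: "analysis \<phi> f \<in> lp q" "analysis (dual_sequence \<phi>) f \<in> lp q" if "q \<in> lp_index" "f \<in> lp q" for q f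
    using adj_pair_mem(1)[OF T that] lp_operator_mem[OF Tdop[OF that(1)] that(2)] by auto
  have synth: "f = synthesis q \<phi> (analysis \<phi> f)" if "q \<in> lp_index" "f \<in> lp q" for q f
    using syn[OF that(1) Tm(1)[OF that]] rec[OF i[OF that]] by simp
  have synop: "lp_operator q (synthesis q \<phi>)" if q: "q \<in> lp_index" for q
    by (rule lp_operator_cong[OF adj_pair_operator(1)[OF W q] q]) (rule syn[OF q])

  have part1: "lp_operator q (analysis \<phi>) \<and>
        (\<exists>L :: (int ^ 'd \<Rightarrow> complex) \<Rightarrow> (int ^ 'd \<Rightarrow> 'h).
           lp_operator q L \<and> (\<forall>f\<in>lp q. L (analysis \<phi> f) = f)) \<and>
        (\<forall>c\<in>lp q. \<forall>m. (\<lambda>n. scaleC (c n) (\<phi> n m)) summable_on UNIV) \<and>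
        lp_operator q (analysis_adj \<phi>) \<and>
        bij_betw (frame_op \<phi>) (lp q) (lp q) \<and>
        lp_operator q (frame_op_inv q \<phi>) \<and>
        lp_operator q (synthesis q \<phi>)" if q: "q \<in> lp_index" for q
  proof (intro conjI ballI allI exI[of _ "synthesis q \<phi>"])
    show "lp_operator q (analysis \<phi>)" "lp_operator q (analysis_adj \<phi>)"
      using adj_pair_operator[OF T q] by auto
    show "synthesis q \<phi> (analysis \<phi> f) = f" if "f \<in> lp q" for f using synth[OF q that] by simp
    show "(\<lambda>n. scaleC (c n) (\<phi> n m)) summable_on UNIV" if "c \<in> lp q" for c m
      by (rule analysis_adj_eq_adjoint(1)[OF T i[OF q that]])
    show "bij_betw (frame_op \<phi>) (lp q) (lp q)" by (rule mutually_inverse_on_lp(1)[OF S R RS SR q])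
    show "lp_operator q (frame_op_inv q \<phi>)"
      by (rule lp_operator_cong[OF adj_pair_operator(1)[OF R q] q]) (rule inv[OF q])
  qed (rule synop[OF q])+

  have part2: "localized_frame s \<alpha> q \<phi> \<and> localized_frame s \<alpha> q (dual_sequence \<phi>)"
    if q: "q \<in> lp_index" for q
  proof
    have fr: "is_frame q \<phi>"
      by (rule is_frameI[OF q \<phi>1 adj_pair_operator(1)[OF T q] adj_pair_operator(1)[OF W q]])
        (rule rec[OF i[OF q]])
    have fr': "is_frame q (dual_sequence \<phi>)"
      by (rule is_frameI[OF q dual1 Tdop[OF q] adj_pair_operator(2)[OF T q]]) (rule rec2[OF i[OF q]])
    show "localized_frame s \<alpha> q \<phi>"
      by (rule localized_frameI[OF q s1 assms(2) fr J I _ _ A]; rule IJ JI AJ; assumption)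
    have mem: "J1 f \<in> lp \<infinity>" "R f \<in> lp \<infinity>" "frame_op \<phi> f \<in> lp \<infinity>" if "f \<in> lp \<infinity>" for f
      using adj_pair_mem(1)[OF J i'(1) that] adj_pair_mem(1)[OF R i'(1) that]
        adj_pair_mem(1)[OF S i'(1) that] by auto
    show "localized_frame s \<alpha> q (dual_sequence \<phi>)"
    \<comment> \<open>The localizing isomorphism is the frame operator composed with
      \<open>J1\<close>; its inverse is \<open>R\<close> followed by \<open>I1\<close>.\<close>
    proof (rule localized_frameI[OF q s1 assms(2) fr' adj_pair_comp[OF J S] adj_pair_comp[OF R I] _ _ A])
      show "I1 (R (frame_op \<phi> (J1 f))) = f" if "f \<in> lp \<infinity>" for f
        by (simp add: RS mem IJ that)
      show "frame_op \<phi> (J1 (I1 (R f))) = f" if "f \<in> lp \<infinity>" for f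
        by (simp add: SR mem JI that)
      show "((\<lambda>n. A m n (x n)) has_sum analysis (dual_sequence \<phi>) (frame_op \<phi> (J1 x)) m) UNIV"
        if x: "x \<in> lp \<infinity>" for x m
        using AJ[OF x, of m] by (simp add: Td mem x RS)
    qed
  qed

  have part3: "f = synthesis q \<phi> (analysis \<phi> f) \<and>
        lp_has_sum q (\<lambda>n m. scaleC (pairing f (\<phi> n)) (dual_sequence \<phi> n m)) f \<and>
        lp_has_sum q (\<lambda>n m. scaleC (pairing f (dual_sequence \<phi> n)) (\<phi> n m)) f"
    if q: "q \<in> lp_index" "q \<noteq> \<infinity>" and f: "f \<in> lp q" for q f
    using synth[OF q(1) f]
      lp_has_sum_operator[OF adj_pair_operator(1)[OF W q(1)] q Tm(1)[OF q(1) f]]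
      lp_has_sum_operator[OF adj_pair_operator(2)[OF T q(1)] q Tm(2)[OF q(1) f]]
    unfolding rec[OF i[OF q(1) f]] rec2[OF i[OF q(1) f]] \<phi> dual[symmetric]
    unfolding analysis_def by blast

  have part4: "f = synthesis \<infinity> \<phi> (analysis \<phi> f) \<and>
        weak_star_has_sum (\<lambda>n m. scaleC (pairing f (\<phi> n)) (dual_sequence \<phi> n m)) f \<and>
        weak_star_has_sum (\<lambda>n m. scaleC (pairing f (dual_sequence \<phi> n)) (\<phi> n m)) f"
    if f: "f \<in> lp \<infinity>" for f
    using synth[OF i'(1) f]
      weak_star_has_sum_operator[OF W Tm(1)[OF i'(1) f]]
      weak_star_has_sum_operator[OF adj_pair_sym[OF T] Tm(2)[OF i'(1) f]]
    unfolding rec[OF f] rec2[OF f] \<phi> dual[symmetric]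
    unfolding analysis_def by blast

  show ?thesis
    by (rule conjI, rule ballI, erule part1, rule conjI, rule ballI, erule part2, rule conjI,
        rule ballI, rule ballI, rule part3, erule DiffD1, blast, assumption, rule ballI, erule part4)
qed

end
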